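(* Let $\mathcal{A}$ be a locally noetherian Grothendieck category. (1) The atom spectrum $\operatorname{ASpec}\mathcal{A}$ of $\mathcal{A}$ is homeomorphic to the Ziegler spectrum $\operatorname{Zg}\mathcal{A}$ of $\mathcal{A}$. (2) There exist one-to-one correspondences between localizing subcategories of $\mathcal{A}$, Serre subcategories of $\operatorname{noeth}\mathcal{A}$, and open subsets of the atom spectrum $\operatorname{ASpec}\mathcal{A}$.
   Context: Conventions: a subcategory means a full subcategory which contains zero objects and is closed under isomorphisms. A Grothendieck category is locally noetherian if it has a set of generators consisting of noetherian objects. $\operatorname{noeth}\mathcal{A}$ denotes the subcategory of noetherian objects of $\mathcal{A}$, which is an abelian category. A Serre subcategory is a subcategory closed under subobjects, quotient objects, and extensions; a localizing subcategory is a Serre subcategory closed under arbitrary direct sums. A nonzero object $H$ of an abelian category $\mathcal{A}$ is a monoform object if for every nonzero subobject $N$ of $H$ there does not exist a nonzero subobject of $H$ which is isomorphic to a subobject of $H/N$. Monoform objects $H$ and $H'$ are atom-equivalent if there exists a common nonzero subobject of $H$ and $H'$ (a nonzero object isomorphic to a subobject of each); this is an equivalence relation. The atom spectrum $\operatorname{ASpec}\mathcal{A}$ is the collection of equivalence classes of monoform objects (it is a set here); the class of $H$ is denoted $\overline{H}$ and called the atom of $H$. For an object $M$, $\operatorname{ASupp}M$ is the collection of atoms $\overline{H}$ such that some $H'\in\overline{H}$ is a subquotient of $M$ (a subobject of a quotient object of $M$). A subset $\Phi\subset\operatorname{ASpec}\mathcal{A}$ is open if for any $\overline{H}\in\Phi$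 there exists $H'\in\overline{H}$ such that $\operatorname{ASupp}H'\subset\Phi$. The Ziegler spectrum $\operatorname{Zg}\mathcal{A}$ is the collection of all isomorphism classes of indecomposable injective objects in $\mathcal{A}$, with the topology having as a basis of open sets the family of $\mathcal{O}(M)=\{I\in\operatorname{Zg}\mathcal{A}\mid \operatorname{Hom}_{\mathcal{A}}(M,I)\neq 0\}$, where $M$ runs over the noetherian objects in $\mathcal{A}$. *)

theory Defs
  imports "HOL-Analysis.Abstract_Topology" "HOL-Algebra.Group" "HOL-Library.Equipollence"
begin

section \<open>Smallness\<close>

text \<open>
  Categorical notions such as ``arbitrary direct sums'' are relative to a Grothendieck universe.
  The universe is presented by a predicate \<open>small\<close> on the subsets of a fixed type \<open>'u\<close>,
  which serve as index sets; a set of any other type is small when it injects into one of them.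
  The axioms say that the small subsets of \<open>'u\<close> are those of cardinality below some uncountable
  strongly inaccessible cardinal.
\<close>

locale universe =
  fixes small :: "'u set \<Rightarrow> bool"
  assumes ex_infinite_small: "\<exists>S. small S \<and> infinite S"
    and small_lepoll: "small S \<Longrightarrow> T \<lesssim> S \<Longrightarrow> small T"
    and small_Pow: "small S \<Longrightarrow> \<exists>T. small T \<and> Pow S \<lesssim> T"
    and small_UN: "small (I :: 'u set) \<Longrightarrow> (\<And>i. i \<in> I \<Longrightarrow> small (F i)) \<Longrightarrow> small (\<Union>i\<in>I. F i)"

definition is_small :: "('u set \<Rightarrow> bool) \<Rightarrow> 'x set \<Rightarrow> bool"
  where "is_small small A \<longleftrightarrow> (\<exists>S. small S \<and> A \<lesssim> S)"


section \<open>Preadditive categories\<close>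

text \<open>\<open>g \<odot>\<^bsub>C\<^esub> f\<close> is \<open>g\<close> after \<open>f\<close>. \<open>Zero C A B\<close> is the zero morphism from \<open>A\<close> to \<open>B\<close>.\<close>

record ('o, 'm) category =
  Obj :: "'o set"
  Arr :: "'m set"
  Dom :: "'m \<Rightarrow> 'o"
  Cod :: "'m \<Rightarrow> 'o"
  Ident :: "'o \<Rightarrow> 'm"
  Comp :: "'m \<Rightarrow> 'm \<Rightarrow> 'm"  (infixl "\<odot>\<index>" 70)
  Add :: "'m \<Rightarrow> 'm \<Rightarrow> 'm"  (infixl "\<boxplus>\<index>" 65)
  Zero :: "'o \<Rightarrow> 'o \<Rightarrow> 'm"

definition Hom :: "('o, 'm) category \<Rightarrow> 'o \<Rightarrow> 'o \<Rightarrow> 'm set"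
  where "Hom C A B = {f \<in> Arr C. Dom C f = A \<and> Cod C f = B}"

definition Hom_group :: "('o, 'm) category \<Rightarrow> 'o \<Rightarrow> 'o \<Rightarrow> 'm monoid"
  where "Hom_group C A B = \<lparr>carrier = Hom C A B, monoid.mult = Add C, one = Zero C A B\<rparr>"

locale category =
  fixes C :: "('o, 'm) category" (structure)
  assumes Dom_closed: "f \<in> Arr C \<Longrightarrow> Dom C f \<in> Obj C"
    and Cod_closed: "f \<in> Arr C \<Longrightarrow> Cod C f \<in> Obj C"
    and Ident_closed: "A \<in> Obj C \<Longrightarrow> Ident C A \<in> Hom C A A"
    and Comp_closed: "f \<in> Hom C A B \<Longrightarrow> g \<in> Hom C B D \<Longrightarrow> g \<odot> f \<in> Hom C A D"
    and Ident_left: "f \<in> Hom C A B \<Longrightarrow> Ident C B \<odot> f = f"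
    and Ident_right: "f \<in> Hom C A B \<Longrightarrow> f \<odot> Ident C A = f"
    and Comp_assoc: "f \<in> Hom C A B \<Longrightarrow> g \<in> Hom C B D \<Longrightarrow> h \<in> Hom C D E
      \<Longrightarrow> h \<odot> (g \<odot> f) = (h \<odot> g) \<odot> f"

locale preadditive_category = category +
  assumes Hom_comm_group: "A \<in> Obj C \<Longrightarrow> B \<in> Obj C \<Longrightarrow> comm_group (Hom_group C A B)"
    and Comp_Add_right: "f \<in> Hom C A B \<Longrightarrow> f' \<in> Hom C A B \<Longrightarrow> g \<in> Hom C B D
      \<Longrightarrow> g \<odot> (f \<boxplus> f') = (g \<odot> f) \<boxplus> (g \<odot> f')"
    and Comp_Add_left: "f \<in> Hom C A B \<Longrightarrow> g \<in> Hom C B D \<Longrightarrow> g' \<in> Hom C B D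
      \<Longrightarrow> (g \<boxplus> g') \<odot> f = (g \<odot> f) \<boxplus> (g' \<odot> f)"


section \<open>Basic notions\<close>

definition is_zero :: "('o, 'm) category \<Rightarrow> 'o \<Rightarrow> bool"
  where "is_zero C Z \<longleftrightarrow> Z \<in> Obj C \<and>
    (\<forall>A\<in>Obj C. (\<exists>!f. f \<in> Hom C A Z) \<and> (\<exists>!f. f \<in> Hom C Z A))"

definition is_iso :: "('o, 'm) category \<Rightarrow> 'm \<Rightarrow> bool"
  where "is_iso C f \<longleftrightarrow> f \<in> Arr C \<and> (\<exists>g \<in> Hom C (Cod C f) (Dom C f).
    g \<odot>\<^bsub>C\<^esub> f = Ident C (Dom C f) \<and> f \<odot>\<^bsub>C\<^esub> g = Ident C (Cod C f))"

definition isomorphic :: "('o, 'm) category \<Rightarrow> 'o \<Rightarrow> 'o \<Rightarrow> bool"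
  where "isomorphic C A B \<longleftrightarrow> (\<exists>f \<in> Hom C A B. is_iso C f)"

definition is_mono :: "('o, 'm) category \<Rightarrow> 'm \<Rightarrow> bool"
  where "is_mono C f \<longleftrightarrow> f \<in> Arr C \<and>
    (\<forall>A. \<forall>g \<in> Hom C A (Dom C f). \<forall>h \<in> Hom C A (Dom C f). f \<odot>\<^bsub>C\<^esub> g = f \<odot>\<^bsub>C\<^esub> h \<longrightarrow> g = h)"

definition is_epi :: "('o, 'm) category \<Rightarrow> 'm \<Rightarrow> bool"
  where "is_epi C f \<longleftrightarrow> f \<in> Arr C \<and>
    (\<forall>B. \<forall>g \<in> Hom C (Cod C f) B. \<forall>h \<in> Hom C (Cod C f) B. g \<odot>\<^bsub>C\<^esub> f = h \<odot>\<^bsub>C\<^esub> f \<longrightarrow> g = h)"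

definition is_kernel :: "('o, 'm) category \<Rightarrow> 'm \<Rightarrow> 'm \<Rightarrow> bool"
  where "is_kernel C k f \<longleftrightarrow> f \<in> Arr C \<and> k \<in> Arr C \<and> Cod C k = Dom C f \<and>
    f \<odot>\<^bsub>C\<^esub> k = Zero C (Dom C k) (Cod C f) \<and>
    (\<forall>A. \<forall>g \<in> Hom C A (Dom C f). f \<odot>\<^bsub>C\<^esub> g = Zero C A (Cod C f) \<longrightarrow>
      (\<exists>!h. h \<in> Hom C A (Dom C k) \<and> k \<odot>\<^bsub>C\<^esub> h = g))"

definition is_cokernel :: "('o, 'm) category \<Rightarrow> 'm \<Rightarrow> 'm \<Rightarrow> bool"
  where "is_cokernel C c f \<longleftrightarrow> f \<in> Arr C \<and> c \<in> Arr C \<and> Dom C c = Cod C f \<and>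
    c \<odot>\<^bsub>C\<^esub> f = Zero C (Dom C f) (Cod C c) \<and>
    (\<forall>B. \<forall>g \<in> Hom C (Cod C f) B. g \<odot>\<^bsub>C\<^esub> f = Zero C (Dom C f) B \<longrightarrow>
      (\<exists>!h. h \<in> Hom C (Cod C c) B \<and> h \<odot>\<^bsub>C\<^esub> c = g))"

text \<open>Exactness of \<open>0 \<rightarrow> L \<rightarrow> M \<rightarrow> N \<rightarrow> 0\<close>.\<close>

definition short_exact :: "('o, 'm) category \<Rightarrow> 'm \<Rightarrow> 'm \<Rightarrow> bool"
  where "short_exact C f g \<longleftrightarrow> is_kernel C f g \<and> is_cokernel C g f"

definition is_biproduct ::
    "('o, 'm) category \<Rightarrow> 'o \<Rightarrow> 'o \<Rightarrow> 'o \<Rightarrow> 'm \<Rightarrow> 'm \<Rightarrow> 'm \<Rightarrow> 'm \<Rightarrow> bool"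
  where "is_biproduct C A B S i1 i2 p1 p2 \<longleftrightarrow>
    A \<in> Obj C \<and> B \<in> Obj C \<and> S \<in> Obj C \<and>
    i1 \<in> Hom C A S \<and> i2 \<in> Hom C B S \<and> p1 \<in> Hom C S A \<and> p2 \<in> Hom C S B \<and>
    p1 \<odot>\<^bsub>C\<^esub> i1 = Ident C A \<and> p2 \<odot>\<^bsub>C\<^esub> i2 = Ident C B \<and>
    p1 \<odot>\<^bsub>C\<^esub> i2 = Zero C B A \<and> p2 \<odot>\<^bsub>C\<^esub> i1 = Zero C A B \<and>
    (i1 \<odot>\<^bsub>C\<^esub> p1) \<boxplus>\<^bsub>C\<^esub> (i2 \<odot>\<^bsub>C\<^esub> p2) = Ident C S"

definition is_coproduct ::
    "('o, 'm) category \<Rightarrow> 'u set \<Rightarrow> ('u \<Rightarrow> 'o) \<Rightarrow> 'o \<Rightarrow> ('u \<Rightarrow> 'm) \<Rightarrow> bool"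
  where "is_coproduct C I F S \<iota> \<longleftrightarrow>
    S \<in> Obj C \<and> (\<forall>i\<in>I. \<iota> i \<in> Hom C (F i) S) \<and>
    (\<forall>T\<in>Obj C. \<forall>g. (\<forall>i\<in>I. g i \<in> Hom C (F i) T) \<longrightarrow>
      (\<exists>!h. h \<in> Hom C S T \<and> (\<forall>i\<in>I. h \<odot>\<^bsub>C\<^esub> \<iota> i = g i)))"

definition generating_set :: "('o, 'm) category \<Rightarrow> 'o set \<Rightarrow> bool"
  where "generating_set C \<G> \<longleftrightarrow> \<G> \<subseteq> Obj C \<and>
    (\<forall>A B. \<forall>f \<in> Hom C A B. \<forall>g \<in> Hom C A B. f \<noteq> g \<longrightarrow>
      (\<exists>G\<in>\<G>. \<exists>h \<in> Hom C G A. f \<odot>\<^bsub>C\<^esub> h \<noteq> g \<odot>\<^bsub>C\<^esub> h))"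


section \<open>Abelian and Grothendieck categories\<close>

locale abelian_category = preadditive_category +
  assumes ex_zero: "\<exists>Z. is_zero C Z"
    and ex_biproduct: "A \<in> Obj C \<Longrightarrow> B \<in> Obj C \<Longrightarrow> \<exists>S i1 i2 p1 p2. is_biproduct C A B S i1 i2 p1 p2"
    and ex_kernel: "f \<in> Arr C \<Longrightarrow> \<exists>k. is_kernel C k f"
    and ex_cokernel: "f \<in> Arr C \<Longrightarrow> \<exists>c. is_cokernel C c f"
    and mono_is_kernel: "is_mono C f \<Longrightarrow> \<exists>g. is_kernel C f g"
    and epi_is_cokernel: "is_epi C f \<Longrightarrow> \<exists>g. is_cokernel C f g"

definition directed_index :: "'u set \<Rightarrow> 'u rel \<Rightarrow> bool"
  where "directed_index I r \<longleftrightarrow> preorder_on I r \<and> I \<noteq> {} \<and>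
    (\<forall>i\<in>I. \<forall>j\<in>I. \<exists>k\<in>I. (i, k) \<in> r \<and> (j, k) \<in> r)"

definition direct_system ::
    "('o, 'm) category \<Rightarrow> 'u set \<Rightarrow> 'u rel \<Rightarrow> ('u \<Rightarrow> 'o) \<Rightarrow> ('u \<Rightarrow> 'u \<Rightarrow> 'm) \<Rightarrow> bool"
  where "direct_system C I r X t \<longleftrightarrow> directed_index I r \<and>
    (\<forall>i\<in>I. X i \<in> Obj C \<and> t i i = Ident C (X i)) \<and>
    (\<forall>i j. (i, j) \<in> r \<longrightarrow> t i j \<in> Hom C (X i) (X j)) \<and>
    (\<forall>i j k. (i, j) \<in> r \<and> (j, k) \<in> r \<longrightarrow> t j k \<odot>\<^bsub>C\<^esub> t i j = t i k)"

definition is_cocone :: "('o, 'm) category \<Rightarrow> 'u set \<Rightarrow> 'u rel \<Rightarrow> ('u \<Rightarrow> 'o) \<Rightarrow> ('u \<Rightarrow> 'u \<Rightarrow> 'm) \<Rightarrow>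
    'o \<Rightarrow> ('u \<Rightarrow> 'm) \<Rightarrow> bool"
  where "is_cocone C I r X t T g \<longleftrightarrow> T \<in> Obj C \<and> (\<forall>i\<in>I. g i \<in> Hom C (X i) T) \<and>
    (\<forall>i j. (i, j) \<in> r \<longrightarrow> g j \<odot>\<^bsub>C\<^esub> t i j = g i)"

definition is_direct_limit :: "('o, 'm) category \<Rightarrow> 'u set \<Rightarrow> 'u rel \<Rightarrow> ('u \<Rightarrow> 'o) \<Rightarrow>
    ('u \<Rightarrow> 'u \<Rightarrow> 'm) \<Rightarrow> 'o \<Rightarrow> ('u \<Rightarrow> 'm) \<Rightarrow> bool"
  where "is_direct_limit C I r X t L x \<longleftrightarrow> direct_system C I r X t \<and> is_cocone C I r X t L x \<and>
    (\<forall>T g. is_cocone C I r X t T g \<longrightarrow>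
      (\<exists>!h. h \<in> Hom C L T \<and> (\<forall>i\<in>I. h \<odot>\<^bsub>C\<^esub> x i = g i)))"

definition system_morphism :: "('o, 'm) category \<Rightarrow> 'u set \<Rightarrow> 'u rel \<Rightarrow> ('u \<Rightarrow> 'o) \<Rightarrow>
    ('u \<Rightarrow> 'u \<Rightarrow> 'm) \<Rightarrow> ('u \<Rightarrow> 'o) \<Rightarrow> ('u \<Rightarrow> 'u \<Rightarrow> 'm) \<Rightarrow> ('u \<Rightarrow> 'm) \<Rightarrow> bool"
  where "system_morphism C I r X t Y s u \<longleftrightarrow> (\<forall>i\<in>I. u i \<in> Hom C (X i) (Y i)) \<and>
    (\<forall>i j. (i, j) \<in> r \<longrightarrow> u j \<odot>\<^bsub>C\<^esub> t i j = s i j \<odot>\<^bsub>C\<^esub> u i)"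

text \<open>
  Small coproducts and cokernels already yield all small direct limits, so only their exactness
  has to be required. In \<open>direct_limits_exact\<close>, \<open>lu\<close> and \<open>lv\<close> are the morphisms induced by
  \<open>u\<close> and \<open>v\<close> on the direct limits.
\<close>

locale grothendieck_category = abelian_category C + universe small
  for C :: "('o, 'm) category" (structure) and small :: "'u set \<Rightarrow> bool" +
  assumes small_Hom: "A \<in> Obj C \<Longrightarrow> B \<in> Obj C \<Longrightarrow> is_small small (Hom C A B)"
    and ex_generator: "\<exists>G. generating_set C {G}"
    and ex_coproduct: "small I \<Longrightarrow> F ` I \<subseteq> Obj C \<Longrightarrow> \<exists>S \<iota>. is_coproduct C I F S \<iota>"
    and direct_limits_exact:
      "\<lbrakk>small I;
        is_direct_limit C I r X tX LX x; is_direct_limit C I r Y tY LY y;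
        is_direct_limit C I r Z tZ LZ z;
        system_morphism C I r X tX Y tY u; system_morphism C I r Y tY Z tZ v;
        \<And>i. i \<in> I \<Longrightarrow> short_exact C (u i) (v i);
        lu \<in> Hom C LX LY; \<And>i. i \<in> I \<Longrightarrow> lu \<odot> x i = y i \<odot> u i;
        lv \<in> Hom C LY LZ; \<And>i. i \<in> I \<Longrightarrow> lv \<odot> y i = z i \<odot> v i\<rbrakk>
       \<Longrightarrow> short_exact C lu lv"

text \<open>A subobject of \<open>M\<close> is represented by a monomorphism with codomain \<open>M\<close>.\<close>

definition subobject_le :: "('o, 'm) category \<Rightarrow> 'm \<Rightarrow> 'm \<Rightarrow> bool"
  where "subobject_le C m n \<longleftrightarrow> (\<exists>h \<in> Hom C (Dom C m) (Dom C n). n \<odot>\<^bsub>C\<^esub> h = m)"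

definition noetherian :: "('o, 'm) category \<Rightarrow> 'o \<Rightarrow> bool"
  where "noetherian C M \<longleftrightarrow> M \<in> Obj C \<and>
    (\<forall>s :: nat \<Rightarrow> 'm. (\<forall>n. is_mono C (s n) \<and> Cod C (s n) = M \<and> subobject_le C (s n) (s (Suc n)))
      \<longrightarrow> (\<exists>n. \<forall>k\<ge>n. subobject_le C (s k) (s n)))"

locale locally_noetherian_grothendieck_category = grothendieck_category +
  assumes ex_noetherian_generators:
    "\<exists>\<G>. is_small small \<G> \<and> generating_set C \<G> \<and> (\<forall>G\<in>\<G>. noetherian C G)"


section \<open>Subcategories\<close>

text \<open>A full subcategory is given by its set of objects.\<close>

definition full_subcategory :: "('o, 'm) category \<Rightarrow> 'o set \<Rightarrow> ('o, 'm) category"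
  where "full_subcategory C \<X> =
    C\<lparr>Obj := \<X>, Arr := {f \<in> Arr C. Dom C f \<in> \<X> \<and> Cod C f \<in> \<X>}\<rparr>"

definition noeth :: "('o, 'm) category \<Rightarrow> ('o, 'm) category"
  where "noeth C = full_subcategory C {M. noetherian C M}"

definition subcategory :: "('o, 'm) category \<Rightarrow> 'o set \<Rightarrow> bool"
  where "subcategory C \<X> \<longleftrightarrow> \<X> \<subseteq> Obj C \<and> (\<forall>Z. is_zero C Z \<longrightarrow> Z \<in> \<X>) \<and>
    (\<forall>A\<in>\<X>. \<forall>B. isomorphic C A B \<longrightarrow> B \<in> \<X>)"

definition serre_subcategory :: "('o, 'm) category \<Rightarrow> 'o set \<Rightarrow> bool"
  where "serre_subcategory C \<X> \<longleftrightarrow> subcategory C \<X> \<and>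
    (\<forall>f. is_mono C f \<and> Cod C f \<in> \<X> \<longrightarrow> Dom C f \<in> \<X>) \<and>
    (\<forall>f. is_epi C f \<and> Dom C f \<in> \<X> \<longrightarrow> Cod C f \<in> \<X>) \<and>
    (\<forall>f g. short_exact C f g \<and> Dom C f \<in> \<X> \<and> Cod C g \<in> \<X> \<longrightarrow> Cod C f \<in> \<X>)"

definition localizing_subcategory :: "('o, 'm) category \<Rightarrow> ('u set \<Rightarrow> bool) \<Rightarrow> 'o set \<Rightarrow> bool"
  where "localizing_subcategory C small \<X> \<longleftrightarrow> serre_subcategory C \<X> \<and>
    (\<forall>I F S \<iota>. small I \<and> F ` I \<subseteq> \<X> \<and> is_coproduct C I F S \<iota> \<longrightarrow> S \<in> \<X>)"


section \<open>The atom spectrum\<close>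

text \<open>\<open>embeds C X Y\<close>: \<open>X\<close> is isomorphic to a subobject of \<open>Y\<close>.\<close>

definition embeds :: "('o, 'm) category \<Rightarrow> 'o \<Rightarrow> 'o \<Rightarrow> bool"
  where "embeds C X Y \<longleftrightarrow> (\<exists>f \<in> Hom C X Y. is_mono C f)"

definition common_nonzero_subobject :: "('o, 'm) category \<Rightarrow> 'o \<Rightarrow> 'o \<Rightarrow> bool"
  where "common_nonzero_subobject C A B \<longleftrightarrow> (\<exists>X\<in>Obj C. \<not> is_zero C X \<and> embeds C X A \<and> embeds C X B)"

text \<open>The quotient of \<open>H\<close> by a subobject \<open>n\<close> is the codomain of a cokernel of \<open>n\<close>.\<close>

definition monoform :: "('o, 'm) category \<Rightarrow> 'o \<Rightarrow> bool"
  where "monoform C H \<longleftrightarrow> H \<in> Obj C \<and> \<not> is_zero C H \<and>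
    (\<forall>n c. is_mono C n \<and> Cod C n = H \<and> \<not> is_zero C (Dom C n) \<and> is_cokernel C c n
      \<longrightarrow> \<not> common_nonzero_subobject C H (Cod C c))"

definition atom_equiv :: "('o, 'm) category \<Rightarrow> 'o rel"
  where "atom_equiv C =
    {(H, H'). monoform C H \<and> monoform C H' \<and> common_nonzero_subobject C H H'}"

definition ASpec :: "('o, 'm) category \<Rightarrow> 'o set set"
  where "ASpec C = {H. monoform C H} // atom_equiv C"

definition subquotient :: "('o, 'm) category \<Rightarrow> 'o \<Rightarrow> 'o \<Rightarrow> bool"
  where "subquotient C X M \<longleftrightarrow> (\<exists>Q. \<exists>q \<in> Hom C M Q. is_epi C q \<and> embeds C X Q)"

definition ASupp :: "('o, 'm) category \<Rightarrow> 'o \<Rightarrow> 'o set set"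
  where "ASupp C M = {\<alpha> \<in> ASpec C. \<exists>H\<in>\<alpha>. subquotient C H M}"

definition aspec_open :: "('o, 'm) category \<Rightarrow> 'o set set \<Rightarrow> bool"
  where "aspec_open C \<Phi> \<longleftrightarrow> \<Phi> \<subseteq> ASpec C \<and> (\<forall>\<alpha>\<in>\<Phi>. \<exists>H\<in>\<alpha>. ASupp C H \<subseteq> \<Phi>)"

definition ASpec_topology :: "('o, 'm) category \<Rightarrow> 'o set topology"
  where "ASpec_topology C = topology (aspec_open C)"


section \<open>The Ziegler spectrum\<close>

definition injective_object :: "('o, 'm) category \<Rightarrow> 'o \<Rightarrow> bool"
  where "injective_object C I \<longleftrightarrow> I \<in> Obj C \<and>
    (\<forall>m. is_mono C m \<longrightarrow> (\<forall>f \<in> Hom C (Dom C m) I. \<exists>g \<in> Hom C (Cod C m) I. g \<odot>\<^bsub>C\<^esub> m = f))"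

definition indecomposable :: "('o, 'm) category \<Rightarrow> 'o \<Rightarrow> bool"
  where "indecomposable C I \<longleftrightarrow> I \<in> Obj C \<and> \<not> is_zero C I \<and>
    (\<forall>A B i1 i2 p1 p2. is_biproduct C A B I i1 i2 p1 p2 \<longrightarrow> is_zero C A \<or> is_zero C B)"

definition Zg :: "('o, 'm) category \<Rightarrow> 'o set set"
  where "Zg C = {I. indecomposable C I \<and> injective_object C I} //
    {(I, J). indecomposable C I \<and> injective_object C I \<and>
       indecomposable C J \<and> injective_object C J \<and> isomorphic C I J}"

definition Zg_basic :: "('o, 'm) category \<Rightarrow> 'o \<Rightarrow> 'o set set"
  where "Zg_basic C M = {\<xi> \<in> Zg C. \<exists>I\<in>\<xi>. Hom C M I \<noteq> {Zero C M I}}"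

definition Zg_topology :: "('o, 'm) category \<Rightarrow> 'o set topology"
  where "Zg_topology C = topology (arbitrary union_of (\<lambda>U. \<exists>M. noetherian C M \<and> U = Zg_basic C M))"

end

theory Submission
  imports Defs
begin

text \<open>
  Arrows with codomain \<open>M\<close> are treated as generalised elements of \<open>M\<close>, and \<open>x \<preceq> m\<close> says that \<open>x\<close>
  lies in the subobject \<open>m\<close>. Exactness of direct limits enters only through \<open>directed_cover\<close>:
  a directed jointly epimorphic family of subobjects remains jointly epimorphic after pulling back.
  It gives maximal disjoint subobjects by Zorn's lemma, finite support of elements of coproducts,
  and Baer's criterion. As the generators are noetherian, adjoining extensions countably often already
  embeds every object into an injective one.

  Every subobject of an injective object is essential in a direct summand. Hence indecomposable
  injectives are uniform, each monoform object \<open>H\<close> has an indecomposable injective hull, and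
  two such hulls are isomorphic exactly when the monoform objects share a nonzero subobject. This
  bijection of the spectra carries \<open>ASupp C M\<close> to \<open>Zg_basic C M\<close>, and for noetherian \<open>M\<close> these sets
  form bases.

  By noetherian induction, membership of a noetherian object \<open>M\<close> in a Serre subcategory only depends on
  \<open>ASupp C M\<close>, and every object is a quotient of a coproduct of noetherian subobjects. So both
  kinds of subcategories are determined by, and arise from, open sets of atoms.
\<close>

section \<open>Arrows and zero arrows\<close>

text \<open>Generalised elements differ from actual ones in one respect: an element of a quotient
  lifts to the source only after precomposition with an epimorphism. A diagram chase therefore takes
  such a cover from \<open>epi_cover\<close> and discards it at the end, because nullity
  (\<open>epi_null\<close>) and membership in a subobject (\<open>le_epi\<close>) can be tested on a
  cover. Equality of arrows is reduced to nullity of a difference. The topology axioms on the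
  Ziegler side are not checked by hand: an injective map carries the open sets of atoms over, and
  images of intersections under it are intersections of images. Both kinds of subcategories are
  matched with open sets by the same formula, the union of the supports of their objects, so the
  correspondence between them is one bijection followed by the inverse of the other.\<close>

context category
begin

lemma Hom_iff [simp]: "f \<in> Hom C A B \<longleftrightarrow> f \<in> Arr C \<and> Dom C f = A \<and> Cod C f = B"
  by (simp add: Hom_def)

lemma Dom_Cod_obj [simp]:
  "f \<in> Arr C \<Longrightarrow> Dom C f \<in> Obj C" "f \<in> Arr C \<Longrightarrow> Cod C f \<in> Obj C"
  by (simp_all add: Dom_closed Cod_closed)

lemma Ident_simps [simp]:
  "A \<in> Obj C \<Longrightarrow> Ident C A \<in> Arr C"
  "A \<in> Obj C \<Longrightarrow> Dom C (Ident C A) = A"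
  "A \<in> Obj C \<Longrightarrow> Cod C (Ident C A) = A"
  using Ident_closed[of A] by simp_all

lemma Comp_simps [simp]:
  assumes "f \<in> Arr C" "g \<in> Arr C" "Cod C f = Dom C g"
  shows "g \<odot> f \<in> Arr C" "Dom C (g \<odot> f) = Dom C f" "Cod C (g \<odot> f) = Cod C g"
  using Comp_closed[of f "Dom C f" "Dom C g" g "Cod C g"] assms by simp_all

lemma Comp_Ident [simp]:
  "f \<in> Arr C \<Longrightarrow> Cod C f = B \<Longrightarrow> Ident C B \<odot> f = f"
  "f \<in> Arr C \<Longrightarrow> Dom C f = A \<Longrightarrow> f \<odot> Ident C A = f"
  using Ident_left[of f "Dom C f" B] Ident_right[of f A "Cod C f"] by simp_all

lemma assoc [simp]:
  assumes "f \<in> Arr C" "g \<in> Arr C" "h \<in> Arr C" "Cod C f = Dom C g" "Cod C g = Dom C h"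
  shows "(h \<odot> g) \<odot> f = h \<odot> (g \<odot> f)"
  using Comp_assoc[of f "Dom C f" "Dom C g" g "Dom C h" h "Cod C h"] assms by simp

text \<open>The simp rule \<open>assoc\<close> brackets composites to the right, which hides the
  factor \<open>h \<odot> g\<close> of \<open>h \<odot> (g \<odot> f)\<close>; this form still
  applies an equation for that factor.\<close>

lemma comp_subst:
  assumes "h \<odot> g = k" "f \<in> Arr C" "g \<in> Arr C" "h \<in> Arr C" "Cod C f = Dom C g" "Cod C g = Dom C h"
  shows "h \<odot> (g \<odot> f) = k \<odot> f"
  using assms assoc by metis

abbreviation le  (infix "\<preceq>" 50)
  where "x \<preceq> m \<equiv> subobject_le C x m"

lemma leE:
  assumes "x \<preceq> m"
  obtains h where "h \<in> Arr C" "Dom C h = Dom C x" "Cod C h = Dom C m" "m \<odot> h = x"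
  using assms unfolding subobject_le_def by auto

lemma leI: "h \<in> Arr C \<Longrightarrow> m \<in> Arr C \<Longrightarrow> Cod C h = Dom C m \<Longrightarrow> m \<odot> h = x \<Longrightarrow> x \<preceq> m"
  unfolding subobject_le_def by auto

lemma le_refl [simp]: "m \<in> Arr C \<Longrightarrow> m \<preceq> m"
  by (rule leI[of "Ident C (Dom C m)"]) auto

lemma le_Cod: "x \<preceq> m \<Longrightarrow> m \<in> Arr C \<Longrightarrow> Cod C x = Cod C m"
  by (erule leE) auto

lemma le_Arr: "x \<preceq> m \<Longrightarrow> m \<in> Arr C \<Longrightarrow> x \<in> Arr C"
  by (erule leE) auto

lemma le_trans:
  assumes "x \<preceq> m" "m \<preceq> n" "n \<in> Arr C"
  shows "x \<preceq> n"
proof -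
  obtain h where h: "h \<in> Arr C" "Dom C h = Dom C x" "Cod C h = Dom C m" "m \<odot> h = x"
    using assms leE by metis
  obtain k where k: "k \<in> Arr C" "Dom C k = Dom C m" "Cod C k = Dom C n" "n \<odot> k = m"
    using assms leE by metis
  show ?thesis
    using h k assms by (intro leI[of "k \<odot> h"]) (auto simp flip: assoc)
qed

lemma le_comp:
  assumes "x \<preceq> m" "y \<in> Arr C" "Cod C y = Dom C x" "m \<in> Arr C"
  shows "x \<odot> y \<preceq> m"
  using assms le_trans[of "x \<odot> y" x m] leI[of y x] le_Arr by auto

lemma comp_le:
  assumes "x \<preceq> m" "m \<in> Arr C" "f \<in> Arr C" "Dom C f = Cod C m"
  shows "f \<odot> x \<preceq> f \<odot> m"
  using assms(1) by (rule leE) (use assms in \<open>auto intro!: leI\<close>)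

lemma comp_le_self [simp]: "f \<in> Arr C \<Longrightarrow> y \<in> Arr C \<Longrightarrow> Cod C y = Dom C f \<Longrightarrow> f \<odot> y \<preceq> f"
  by (rule leI[of y]) auto

end

context preadditive_category
begin

lemma
  assumes "f \<in> Arr C" "g \<in> Arr C" "Dom C g = Dom C f" "Cod C g = Cod C f"
  shows Add_Arr [simp]: "f \<boxplus> g \<in> Arr C"
    and Add_Dom [simp]: "Dom C (f \<boxplus> g) = Dom C f"
    and Add_Cod [simp]: "Cod C (f \<boxplus> g) = Cod C f"
proof -
  interpret H: comm_group "Hom_group C (Dom C f) (Cod C f)" by (simp add: Hom_comm_group assms)
  show "f \<boxplus> g \<in> Arr C" "Dom C (f \<boxplus> g) = Dom C f" "Cod C (f \<boxplus> g) = Cod C f"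
    using H.m_closed[of f g] assms by (simp_all add: Hom_group_def)
qed

lemma
  assumes "A \<in> Obj C" "B \<in> Obj C"
  shows Zero_Arr [simp]: "Zero C A B \<in> Arr C"
    and Zero_Dom [simp]: "Dom C (Zero C A B) = A"
    and Zero_Cod [simp]: "Cod C (Zero C A B) = B"
proof -
  interpret H: comm_group "Hom_group C A B" by (simp add: Hom_comm_group assms)
  show "Zero C A B \<in> Arr C" "Dom C (Zero C A B) = A" "Cod C (Zero C A B) = B"
    using H.one_closed by (simp_all add: Hom_group_def)
qed

lemma Add_Zero [simp]:
  assumes "f \<in> Arr C" "Dom C f = A" "Cod C f = B"
  shows "f \<boxplus> Zero C A B = f" "Zero C A B \<boxplus> f = f"
proof -
  interpret H: comm_group "Hom_group C A B" using assms by (auto simp add: Hom_comm_group)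
  show "f \<boxplus> Zero C A B = f" "Zero C A B \<boxplus> f = f"
    using H.r_one[of f] H.l_one[of f] assms by (simp_all add: Hom_group_def)
qed

lemma Add_idem_Zero:
  assumes "f \<in> Arr C" "f \<boxplus> f = f"
  shows "f = Zero C (Dom C f) (Cod C f)"
proof -
  interpret H: comm_group "Hom_group C (Dom C f) (Cod C f)" using assms by (auto simp add: Hom_comm_group)
  show ?thesis
    using H.l_cancel_one[of f f] assms by (simp add: Hom_group_def)
qed

text \<open>By bilinearity a composite with a zero arrow is its own double, and only zero has that
  property in a group.\<close>

lemma Comp_Zero [simp]:
  assumes "f \<in> Arr C" "A \<in> Obj C"
  shows "Dom C f = B \<Longrightarrow> f \<odot> Zero C A B = Zero C A (Cod C f)"
    and "Cod C f = B \<Longrightarrow> Zero C B A \<odot> f = Zero C (Dom C f) A"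
proof -
  assume B: "Dom C f = B"
  then have o: "B \<in> Obj C" using assms by auto
  have "f \<odot> Zero C A B \<boxplus> f \<odot> Zero C A B = f \<odot> (Zero C A B \<boxplus> Zero C A B)"
    using assms o B by (subst Comp_Add_right) auto
  then show "f \<odot> Zero C A B = Zero C A (Cod C f)"
    using assms o B Add_idem_Zero[of "f \<odot> Zero C A B"] by simp
next
  assume B: "Cod C f = B"
  then have o: "B \<in> Obj C" using assms by auto
  have "Zero C B A \<odot> f \<boxplus> Zero C B A \<odot> f = (Zero C B A \<boxplus> Zero C B A) \<odot> f"
    using assms o B by (subst Comp_Add_left) auto
  then show "Zero C B A \<odot> f = Zero C (Dom C f) A"
    using assms o B Add_idem_Zero[of "Zero C B A \<odot> f"] by simp
qed

text \<open>A zero arrow whose two objects are read off from the arrow itself, so that nullity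
  propagates through composites without naming objects.\<close>

definition null
  where "null f \<longleftrightarrow> f \<in> Arr C \<and> f = Zero C (Dom C f) (Cod C f)"

lemma null_Zero [simp]: "A \<in> Obj C \<Longrightarrow> B \<in> Obj C \<Longrightarrow> null (Zero C A B)"
  by (simp add: null_def)

lemma nullI: "f \<in> Arr C \<Longrightarrow> f = Zero C A B \<Longrightarrow> A = Dom C f \<Longrightarrow> B = Cod C f \<Longrightarrow> null f"
  by (metis null_def)

lemma null_eq: "null f \<Longrightarrow> Dom C f = A \<Longrightarrow> Cod C f = B \<Longrightarrow> f = Zero C A B"
  by (simp add: null_def)

lemma null_unique: "null f \<Longrightarrow> null g \<Longrightarrow> Dom C f = Dom C g \<Longrightarrow> Cod C f = Cod C g \<Longrightarrow> f = g"
  by (metis null_def)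

lemma null_comp1: "null f \<Longrightarrow> g \<in> Arr C \<Longrightarrow> Dom C g = Cod C f \<Longrightarrow> null (g \<odot> f)"
  using Comp_Zero(1)[of g "Dom C f" "Cod C f"] unfolding null_def
  by (metis Dom_Cod_obj Zero_Arr Zero_Cod Zero_Dom)

lemma null_comp2: "null g \<Longrightarrow> f \<in> Arr C \<Longrightarrow> Dom C g = Cod C f \<Longrightarrow> null (g \<odot> f)"
  using Comp_Zero(2)[of f "Cod C g" "Dom C g"] unfolding null_def
  by (metis Dom_Cod_obj Zero_Arr Zero_Cod Zero_Dom)

text \<open>The record has no negation, so the inverse is taken in the Hom group fixed by the first
  argument. The value is meaningful only for parallel arrows.\<close>

definition sub  (infixl "\<ominus>" 65)
  where "f \<ominus> g = f \<boxplus> inv\<^bsub>Hom_group C (Dom C f) (Cod C f)\<^esub> g"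

context
  fixes f g
  assumes fg: "f \<in> Arr C" "g \<in> Arr C" "Dom C g = Dom C f" "Cod C g = Cod C f"
begin

interpretation H: comm_group "Hom_group C (Dom C f) (Cod C f)"
  by (simp add: Hom_comm_group fg)

lemma sub_carrier: "f \<in> carrier (Hom_group C (Dom C f) (Cod C f))"
   "g \<in> carrier (Hom_group C (Dom C f) (Cod C f))"
   "f \<ominus> g \<in> carrier (Hom_group C (Dom C f) (Cod C f))"
proof -
  show f: "f \<in> carrier (Hom_group C (Dom C f) (Cod C f))"
    and g: "g \<in> carrier (Hom_group C (Dom C f) (Cod C f))"
    using fg by (simp_all add: Hom_group_def)
  show "f \<ominus> g \<in> carrier (Hom_group C (Dom C f) (Cod C f))"
    using H.m_closed[OF f H.inv_closed[OF g]] by (simp add: sub_def Hom_group_def)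
qed

lemma sub_simps [simp]: "f \<ominus> g \<in> Arr C" "Dom C (f \<ominus> g) = Dom C f" "Cod C (f \<ominus> g) = Cod C f"
  using sub_carrier(3) by (simp_all add: Hom_group_def)

lemma sub_add [simp]: "f \<ominus> g \<boxplus> g = f"
  using H.m_assoc[of f "inv\<^bsub>Hom_group C (Dom C f) (Cod C f)\<^esub> g" g] sub_carrier H.l_inv[of g] H.inv_closed[of g]
    H.r_one[of f]
  by (simp add: sub_def Hom_group_def)

lemma add_right_cancel: "h \<in> Arr C \<Longrightarrow> Dom C h = Dom C f \<Longrightarrow> Cod C h = Cod C f \<Longrightarrow>
  f \<boxplus> h = g \<boxplus> h \<longleftrightarrow> f = g"
  using H.right_cancel[of h f g] fg by (auto simp: Hom_group_def)

lemma null_sub [simp]: "null (f \<ominus> g) \<longleftrightarrow> f = g"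
proof
  assume "null (f \<ominus> g)"
  then have "f \<ominus> g = Zero C (Dom C f) (Cod C f)" by (simp add: null_def)
  then show "f = g" using sub_add fg by simp
next
  assume "f = g"
  then show "null (f \<ominus> g)"
    using H.r_inv[of g] sub_carrier sub_simps unfolding null_def sub_def
    by (simp add: Hom_group_def)
qed

end

text \<open>Characterises the difference by an additive equation; distributivity of composition over
  differences then follows from that over sums.\<close>

lemma sub_unique:
  assumes "d \<in> Arr C" "g \<in> Arr C" "Dom C d = Dom C g" "Cod C d = Cod C g" "d \<boxplus> g = f"
  shows "d = f \<ominus> g"
proof -
  have f: "f \<in> Arr C" "Dom C f = Dom C g" "Cod C f = Cod C g"
    using assms by auto
  show ?thesis
    by (rule iffD1[OF add_right_cancel[of d "f \<ominus> g" g]]) (use assms f in auto)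
qed

lemma comp_sub:
  assumes "f \<in> Arr C" "g \<in> Arr C" "Dom C g = Dom C f" "Cod C g = Cod C f" "h \<in> Arr C" "Dom C h = Cod C f"
  shows "h \<odot> (f \<ominus> g) = (h \<odot> f) \<ominus> (h \<odot> g)"
proof (rule sub_unique)
  show "h \<odot> (f \<ominus> g) \<boxplus> h \<odot> g = h \<odot> f"
    using Comp_Add_right[of "f \<ominus> g" "Dom C f" "Cod C f" g h "Cod C h"] assms by simp
qed (use assms in auto)

lemma sub_comp:
  assumes "f \<in> Arr C" "g \<in> Arr C" "Dom C g = Dom C f" "Cod C g = Cod C f" "x \<in> Arr C" "Cod C x = Dom C f"
  shows "(f \<ominus> g) \<odot> x = (f \<odot> x) \<ominus> (g \<odot> x)"
proof (rule sub_unique)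
  show "(f \<ominus> g) \<odot> x \<boxplus> g \<odot> x = f \<odot> x"
    using Comp_Add_left[of x "Dom C x" "Dom C f" "f \<ominus> g" "Cod C f" g] assms by simp
qed (use assms in auto)

lemma sub_Zero [simp]:
  assumes "f \<in> Arr C" "Dom C f = A" "Cod C f = B"
  shows "f \<ominus> Zero C A B = f"
  using sub_unique[of f "Zero C A B" f] assms by auto

text \<open>Every arrow into or out of \<open>Z\<close> factors through the identity of
  \<open>Z\<close>; once that identity is null, so is the arrow, which makes it unique.\<close>

lemma is_zero_iff: "is_zero C Z \<longleftrightarrow> Z \<in> Obj C \<and> null (Ident C Z)"
proof
  assume z: "is_zero C Z"
  then have "Z \<in> Obj C" and "\<exists>!f. f \<in> Hom C Z Z" by (auto simp: is_zero_def)
  moreover have "Ident C Z \<in> Hom C Z Z" "Zero C Z Z \<in> Hom C Z Z" using \<open>Z \<in> Obj C\<close> by auto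
  ultimately have "Ident C Z = Zero C Z Z" by blast
  then show "Z \<in> Obj C \<and> null (Ident C Z)" using \<open>Z \<in> Obj C\<close> by auto
next
  assume z: "Z \<in> Obj C \<and> null (Ident C Z)"
  have a: "f = Zero C A Z" if "f \<in> Hom C A Z" "A \<in> Obj C" for f A
    by (rule null_eq) (use null_comp2[of "Ident C Z" f] that z in simp_all)
  have b: "f = Zero C Z A" if "f \<in> Hom C Z A" "A \<in> Obj C" for f A
    by (rule null_eq) (use null_comp1[of "Ident C Z" f] that z in simp_all)
  show "is_zero C Z" unfolding is_zero_def
  proof (intro conjI ballI)
    show "Z \<in> Obj C" using z by simp
    fix A assume A: "A \<in> Obj C"
    show "\<exists>!f. f \<in> Hom C A Z" by (rule ex1I[of _ "Zero C A Z"]) (use a[OF _ A] A z in auto)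
    show "\<exists>!f. f \<in> Hom C Z A" by (rule ex1I[of _ "Zero C Z A"]) (use b[OF _ A] A z in auto)
  qed
qed

lemma is_zero_Obj: "is_zero C Z \<Longrightarrow> Z \<in> Obj C"
  by (simp add: is_zero_iff)

lemma is_zero_null: "is_zero C Z \<Longrightarrow> f \<in> Arr C \<Longrightarrow> Dom C f = Z \<or> Cod C f = Z \<Longrightarrow> null f"
  unfolding is_zero_iff using null_comp1[of "Ident C Z" f] null_comp2[of "Ident C Z" f] by auto

section \<open>Monomorphisms and epimorphisms via null arrows\<close>

lemma mono_Arr [simp]: "is_mono C f \<Longrightarrow> f \<in> Arr C"
  by (simp add: is_mono_def)

lemma epi_Arr [simp]: "is_epi C f \<Longrightarrow> f \<in> Arr C"
  by (simp add: is_epi_def)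

text \<open>Two arrows with equal composites have a difference killed by \<open>f\<close>, so
  testing against zero suffices in a preadditive category.\<close>

lemma monoI:
  assumes "f \<in> Arr C" "\<And>x. x \<in> Arr C \<Longrightarrow> Cod C x = Dom C f \<Longrightarrow> null (f \<odot> x) \<Longrightarrow> null x"
  shows "is_mono C f"
  unfolding is_mono_def
proof (intro conjI allI ballI impI)
  fix A g h assume gh: "g \<in> Hom C A (Dom C f)" "h \<in> Hom C A (Dom C f)" "f \<odot> g = f \<odot> h"
  then have "null (g \<ominus> h)"
    using assms(1) by (rule_tac assms(2)) (auto simp: comp_sub)
  then show "g = h" using gh by auto
qed (rule assms)

lemma mono_null:
  assumes "is_mono C f" "x \<in> Arr C" "Cod C x = Dom C f"
  shows "null (f \<odot> x) \<longleftrightarrow> null x"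
proof
  assume "null (f \<odot> x)"
  have f: "f \<in> Arr C" using assms by simp
  have "f \<odot> x = f \<odot> Zero C (Dom C x) (Cod C x)"
    using null_eq[OF \<open>null (f \<odot> x)\<close>] assms f by simp
  then have "x = Zero C (Dom C x) (Cod C x)"
    using assms unfolding is_mono_def by (metis Dom_Cod_obj Hom_iff Zero_Arr Zero_Cod Zero_Dom)
  then show "null x" using assms by (simp add: null_def)
qed (use assms null_comp1 in auto)

lemma mono_cancel:
  "is_mono C f \<Longrightarrow> f \<odot> x = f \<odot> y \<Longrightarrow> x \<in> Arr C \<Longrightarrow> y \<in> Arr C \<Longrightarrow> Dom C x = Dom C y \<Longrightarrow>
    Cod C x = Dom C f \<Longrightarrow> Cod C y = Dom C f \<Longrightarrow> x = y"
  unfolding is_mono_def by auto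

lemma epiI:
  assumes "f \<in> Arr C" "\<And>x. x \<in> Arr C \<Longrightarrow> Dom C x = Cod C f \<Longrightarrow> null (x \<odot> f) \<Longrightarrow> null x"
  shows "is_epi C f"
  unfolding is_epi_def
proof (intro conjI allI ballI impI)
  fix B g h assume gh: "g \<in> Hom C (Cod C f) B" "h \<in> Hom C (Cod C f) B" "g \<odot> f = h \<odot> f"
  then have "null (g \<ominus> h)"
    using assms(1) by (rule_tac assms(2)) (auto simp: sub_comp)
  then show "g = h" using gh by auto
qed (rule assms)

lemma epi_null:
  assumes "is_epi C f" "x \<in> Arr C" "Dom C x = Cod C f"
  shows "null (x \<odot> f) \<longleftrightarrow> null x"
proof
  assume "null (x \<odot> f)"
  have f: "f \<in> Arr C" using assms by simp
  have "x \<odot> f = Zero C (Dom C x) (Cod C x) \<odot> f"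
    using null_eq[OF \<open>null (x \<odot> f)\<close>] assms f by simp
  then have "x = Zero C (Dom C x) (Cod C x)"
    using assms unfolding is_epi_def by (metis Dom_Cod_obj Hom_iff Zero_Arr Zero_Cod Zero_Dom)
  then show "null x" using assms by (simp add: null_def)
qed (use assms null_comp2 in auto)

lemma epi_cancel:
  "is_epi C f \<Longrightarrow> x \<odot> f = y \<odot> f \<Longrightarrow> x \<in> Arr C \<Longrightarrow> y \<in> Arr C \<Longrightarrow> Cod C x = Cod C y \<Longrightarrow>
    Dom C x = Cod C f \<Longrightarrow> Dom C y = Cod C f \<Longrightarrow> x = y"
  unfolding is_epi_def by auto

lemma mono_comp: "is_mono C f \<Longrightarrow> is_mono C g \<Longrightarrow> Dom C g = Cod C f \<Longrightarrow> is_mono C (g \<odot> f)"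
  by (rule monoI) (auto simp: mono_null)

lemma epi_comp: "is_epi C f \<Longrightarrow> is_epi C g \<Longrightarrow> Dom C g = Cod C f \<Longrightarrow> is_epi C (g \<odot> f)"
  by (rule epiI) (auto simp: epi_null simp flip: assoc)

lemma mono_factor:
  assumes "is_mono C (g \<odot> f)" "f \<in> Arr C" "g \<in> Arr C" "Dom C g = Cod C f"
  shows "is_mono C f"
proof (rule monoI)
  fix x assume x: "x \<in> Arr C" "Cod C x = Dom C f" "null (f \<odot> x)"
  then have "null ((g \<odot> f) \<odot> x)" using assms null_comp1[of "f \<odot> x" g] by simp
  then show "null x" using mono_null[OF assms(1), of x] x assms by simp
qed (rule assms)

lemma epi_factor:
  assumes "is_epi C (g \<odot> f)" "f \<in> Arr C" "g \<in> Arr C" "Dom C g = Cod C f"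
  shows "is_epi C g"
proof (rule epiI)
  fix x assume x: "x \<in> Arr C" "Dom C x = Cod C g" "null (x \<odot> g)"
  then have "null (x \<odot> (g \<odot> f))" using assms null_comp2[of "x \<odot> g" f] by simp
  then show "null x" using epi_null[OF assms(1), of x] x assms by simp
qed (rule assms)

lemma mono_Ident [simp]: "A \<in> Obj C \<Longrightarrow> is_mono C (Ident C A)"
  by (rule monoI) auto

lemma epi_Ident [simp]: "A \<in> Obj C \<Longrightarrow> is_epi C (Ident C A)"
  by (rule epiI) auto

lemma zero_Dom_iff: "is_mono C m \<Longrightarrow> is_zero C (Dom C m) \<longleftrightarrow> null m"
  using mono_null[of m "Ident C (Dom C m)"] by (auto simp: is_zero_iff)

lemma zero_Cod_iff: "is_epi C e \<Longrightarrow> is_zero C (Cod C e) \<longleftrightarrow> null e"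
  using epi_null[of e "Ident C (Cod C e)"] by (auto simp: is_zero_iff)

section \<open>Kernels and cokernels\<close>

lemma kernel_univ:
  "is_kernel C k f \<Longrightarrow> g \<in> Hom C A (Dom C f) \<Longrightarrow> f \<odot> g = Zero C A (Cod C f) \<Longrightarrow>
    \<exists>!h. h \<in> Hom C A (Dom C k) \<and> k \<odot> h = g"
  unfolding is_kernel_def by blast

lemma cokernel_univ:
  "is_cokernel C c f \<Longrightarrow> g \<in> Hom C (Cod C f) B \<Longrightarrow> g \<odot> f = Zero C (Dom C f) B \<Longrightarrow>
    \<exists>!h. h \<in> Hom C (Cod C c) B \<and> h \<odot> c = g"
  unfolding is_cokernel_def by blast

text \<open>If \<open>k\<close> kills \<open>x\<close>, then \<open>x\<close> and the zero arrow
  both factor the zero arrow through \<open>k\<close>, and uniqueness of such factorizations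
  identifies them.\<close>

lemma kernel_mono:
  assumes "is_kernel C k f"
  shows "is_mono C k"
proof (rule monoI)
  show k: "k \<in> Arr C" using assms by (simp add: is_kernel_def)
  have f: "f \<in> Arr C" "Cod C k = Dom C f" "f \<odot> k = Zero C (Dom C k) (Cod C f)"
    using assms by (auto simp: is_kernel_def)
  fix x assume x: "x \<in> Arr C" "Cod C x = Dom C k" "null (k \<odot> x)"
  let ?z = "Zero C (Dom C x) (Dom C f)"
  have "f \<odot> ?z = Zero C (Dom C x) (Cod C f)" using x f by simp
  then have "\<exists>!h. h \<in> Hom C (Dom C x) (Dom C k) \<and> k \<odot> h = ?z"
    using x f by (intro kernel_univ[OF assms]) auto
  moreover have "x \<in> Hom C (Dom C x) (Dom C k)" "k \<odot> x = ?z"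
    using x k f null_eq[OF x(3)] by auto
  moreover have "Zero C (Dom C x) (Dom C k) \<in> Hom C (Dom C x) (Dom C k)" "k \<odot> Zero C (Dom C x) (Dom C k) = ?z"
    using x k f by auto
  ultimately have "x = Zero C (Dom C x) (Dom C k)" by blast
  then show "null x" using x by (simp add: null_def)
qed

lemma cokernel_epi:
  assumes "is_cokernel C k f"
  shows "is_epi C k"
proof (rule epiI)
  show k: "k \<in> Arr C" using assms by (simp add: is_cokernel_def)
  have f: "f \<in> Arr C" "Dom C k = Cod C f" "k \<odot> f = Zero C (Dom C f) (Cod C k)"
    using assms by (auto simp: is_cokernel_def)
  fix x assume x: "x \<in> Arr C" "Dom C x = Cod C k" "null (x \<odot> k)"
  let ?z = "Zero C (Cod C f) (Cod C x)"
  have "?z \<odot> f = Zero C (Dom C f) (Cod C x)" using x f by simp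
  then have "\<exists>!h. h \<in> Hom C (Cod C k) (Cod C x) \<and> h \<odot> k = ?z"
    using x f by (intro cokernel_univ[OF assms]) auto
  moreover have "x \<in> Hom C (Cod C k) (Cod C x)" "x \<odot> k = ?z"
    using x k f null_eq[OF x(3)] by auto
  moreover have "Zero C (Cod C k) (Cod C x) \<in> Hom C (Cod C k) (Cod C x)" "Zero C (Cod C k) (Cod C x) \<odot> k = ?z"
    using x k f by auto
  ultimately have "x = Zero C (Cod C k) (Cod C x)" by blast
  then show "null x" using x by (simp add: null_def)
qed

lemma kernel_simps:
  assumes "is_kernel C k f"
  shows "k \<in> Arr C" "f \<in> Arr C" "Cod C k = Dom C f" "null (f \<odot> k)"
  using assms by (auto simp: is_kernel_def intro: nullI)

lemma cokernel_simps:
  assumes "is_cokernel C c f"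
  shows "c \<in> Arr C" "f \<in> Arr C" "Dom C c = Cod C f" "null (c \<odot> f)"
  using assms by (auto simp: is_cokernel_def intro: nullI)

text \<open>The universal property in terms of elements; chases use kernels mostly in this
  shape.\<close>

lemma kernel_le_iff:
  assumes "is_kernel C k f" "x \<in> Arr C" "Cod C x = Dom C f"
  shows "x \<preceq> k \<longleftrightarrow> null (f \<odot> x)"
proof
  note [simp] = kernel_simps[OF assms(1)]
  { assume "x \<preceq> k"
    then obtain h where h: "h \<in> Arr C" "Dom C h = Dom C x" "Cod C h = Dom C k" "k \<odot> h = x"
      by (rule leE)
    have "null ((f \<odot> k) \<odot> h)"
      by (rule null_comp2) (use h kernel_simps(4)[OF assms(1)] in simp_all)
    then show "null (f \<odot> x)" using h by simp }
  { assume "null (f \<odot> x)"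
    then have "f \<odot> x = Zero C (Dom C x) (Cod C f)" by (rule null_eq) (use assms in auto)
    then have "\<exists>!h. h \<in> Hom C (Dom C x) (Dom C k) \<and> k \<odot> h = x"
      using assms by (intro kernel_univ[OF assms(1)]) auto
    then show "x \<preceq> k" unfolding subobject_le_def by blast }
qed

lemma cokernel_desc:
  assumes "is_cokernel C c f" "x \<in> Arr C" "Dom C x = Cod C f" "null (x \<odot> f)"
  obtains h where "h \<in> Arr C" "Dom C h = Cod C c" "Cod C h = Cod C x" "h \<odot> c = x"
proof -
  note [simp] = cokernel_simps[OF assms(1)]
  have "x \<odot> f = Zero C (Dom C f) (Cod C x)" using assms(4) by (rule null_eq) (use assms in auto)
  then have "\<exists>!h. h \<in> Hom C (Cod C c) (Cod C x) \<and> h \<odot> c = x"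
    using assms by (intro cokernel_univ[OF assms(1)]) auto
  then show ?thesis using that by auto
qed

lemma is_kernelI:
  assumes "is_mono C k" "f \<in> Arr C" "Cod C k = Dom C f" "null (f \<odot> k)"
    and "\<And>x. x \<in> Arr C \<Longrightarrow> Cod C x = Dom C f \<Longrightarrow> null (f \<odot> x) \<Longrightarrow> x \<preceq> k"
  shows "is_kernel C k f"
  unfolding is_kernel_def
proof (intro conjI allI ballI impI)
  show "f \<odot> k = Zero C (Dom C k) (Cod C f)" using assms by (intro null_eq) auto
  fix A g assume g: "g \<in> Hom C A (Dom C f)" "f \<odot> g = Zero C A (Cod C f)"
  then have "null (f \<odot> g)" using assms by (intro nullI) auto
  then have "g \<preceq> k" using g assms by auto
  then show "\<exists>!h. h \<in> Hom C A (Dom C k) \<and> k \<odot> h = g"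
  proof (rule leE)
    fix h assume h: "h \<in> Arr C" "Dom C h = Dom C g" "Cod C h = Dom C k" "k \<odot> h = g"
    have "h' = h" if "h' \<in> Hom C A (Dom C k)" "k \<odot> h' = g" for h'
      by (rule mono_cancel[OF assms(1)]) (use h g that in simp_all)
    moreover have "h \<in> Hom C A (Dom C k)" using g h by simp
    ultimately show ?thesis using h(4) by blast
  qed
qed (use assms in auto)

lemma is_cokernelI:
  assumes "is_epi C c" "f \<in> Arr C" "Dom C c = Cod C f" "null (c \<odot> f)"
    and "\<And>x. x \<in> Arr C \<Longrightarrow> Dom C x = Cod C f \<Longrightarrow> null (x \<odot> f) \<Longrightarrow>
      \<exists>h. h \<in> Arr C \<and> Dom C h = Cod C c \<and> Cod C h = Cod C x \<and> h \<odot> c = x"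
  shows "is_cokernel C c f"
  unfolding is_cokernel_def
proof (intro conjI allI ballI impI)
  show "c \<odot> f = Zero C (Dom C f) (Cod C c)" using assms by (intro null_eq) auto
  fix B g assume g: "g \<in> Hom C (Cod C f) B" "g \<odot> f = Zero C (Dom C f) B"
  then have "null (g \<odot> f)" using assms by (intro nullI) auto
  then obtain h where h: "h \<in> Arr C \<and> Dom C h = Cod C c \<and> Cod C h = Cod C g \<and> h \<odot> c = g"
    using g assms(3) assms(5)[of g] by auto
  moreover have "h' = h" if "h' \<in> Hom C (Cod C c) B" "h' \<odot> c = g" for h'
    by (rule epi_cancel[OF assms(1)]) (use h g that in simp_all)
  moreover have "h \<in> Hom C (Cod C c) B" using g h by simp
  ultimately show "\<exists>!h. h \<in> Hom C (Cod C c) B \<and> h \<odot> c = g" using h by blast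
qed (use assms in auto)

section \<open>Diagram chasing in abelian categories\<close>

lemma biproduct_simps:
  assumes "is_biproduct C A B S i1 i2 p1 p2"
  shows "A \<in> Obj C" "B \<in> Obj C" "S \<in> Obj C"
    "i1 \<in> Arr C" "i2 \<in> Arr C" "p1 \<in> Arr C" "p2 \<in> Arr C"
    "Dom C i1 = A" "Dom C i2 = B" "Cod C i1 = S" "Cod C i2 = S"
    "Dom C p1 = S" "Dom C p2 = S" "Cod C p1 = A" "Cod C p2 = B"
    "p1 \<odot> i1 = Ident C A" "p2 \<odot> i2 = Ident C B" "p1 \<odot> i2 = Zero C B A" "p2 \<odot> i1 = Zero C A B"
  using assms unfolding is_biproduct_def by simp_all

lemma biproduct_elem:
  assumes "is_biproduct C A B S i1 i2 p1 p2" "x \<in> Arr C"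
  shows "Cod C x = A \<Longrightarrow> p1 \<odot> (i1 \<odot> x) = x"
    and "Cod C x = B \<Longrightarrow> p2 \<odot> (i2 \<odot> x) = x"
    and "Cod C x = A \<Longrightarrow> p2 \<odot> (i1 \<odot> x) = Zero C (Dom C x) B"
    and "Cod C x = B \<Longrightarrow> p1 \<odot> (i2 \<odot> x) = Zero C (Dom C x) A"
proof -
  note b = biproduct_simps[OF assms(1)]
  show "Cod C x = A \<Longrightarrow> p1 \<odot> (i1 \<odot> x) = x" using comp_subst[OF b(16), of x] b assms(2) by simp
  show "Cod C x = B \<Longrightarrow> p2 \<odot> (i2 \<odot> x) = x" using comp_subst[OF b(17), of x] b assms(2) by simp
  show "Cod C x = A \<Longrightarrow> p2 \<odot> (i1 \<odot> x) = Zero C (Dom C x) B"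
    using comp_subst[OF b(19), of x] b assms(2) by simp
  show "Cod C x = B \<Longrightarrow> p1 \<odot> (i2 \<odot> x) = Zero C (Dom C x) A"
    using comp_subst[OF b(18), of x] b assms(2) by simp
qed

text \<open>The identity of \<open>S\<close> is \<open>i1 \<odot> p1\<close> plus
  \<open>i2 \<odot> p2\<close>, so \<open>x\<close> is the sum of its two null components.\<close>

lemma biproduct_null_into:
  assumes "is_biproduct C A B S i1 i2 p1 p2" "x \<in> Arr C" "Cod C x = S" "null (p1 \<odot> x)" "null (p2 \<odot> x)"
  shows "null x"
proof -
  note b = biproduct_simps[OF assms(1)]
  have s: "(i1 \<odot> p1) \<boxplus> (i2 \<odot> p2) = Ident C S" using assms(1) unfolding is_biproduct_def by simp
  have "null (i1 \<odot> (p1 \<odot> x))" "null (i2 \<odot> (p2 \<odot> x))"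
    using assms b by (auto intro!: null_comp1)
  then have n: "i1 \<odot> (p1 \<odot> x) = Zero C (Dom C x) S" "i2 \<odot> (p2 \<odot> x) = Zero C (Dom C x) S"
    using assms b by (auto intro!: null_eq)
  have "x = ((i1 \<odot> p1) \<boxplus> (i2 \<odot> p2)) \<odot> x" using assms s by simp
  also have "\<dots> = (i1 \<odot> (p1 \<odot> x)) \<boxplus> (i2 \<odot> (p2 \<odot> x))"
    by (subst Comp_Add_left[of x "Dom C x" S _ S]) (use assms b in simp_all)
  also have "\<dots> = Zero C (Dom C x) S" using n assms b by simp
  finally show ?thesis using assms(2) b nullI assms(3) by metis
qed

lemma biproduct_null_from:
  assumes "is_biproduct C A B S i1 i2 p1 p2" "x \<in> Arr C" "Dom C x = S" "null (x \<odot> i1)" "null (x \<odot> i2)"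
  shows "null x"
proof -
  note b = biproduct_simps[OF assms(1)]
  have s: "(i1 \<odot> p1) \<boxplus> (i2 \<odot> p2) = Ident C S" using assms(1) unfolding is_biproduct_def by simp
  have "null ((x \<odot> i1) \<odot> p1)" "null ((x \<odot> i2) \<odot> p2)"
    using assms b by (auto intro!: null_comp2 simp del: assoc)
  then have n: "x \<odot> (i1 \<odot> p1) = Zero C S (Cod C x)" "x \<odot> (i2 \<odot> p2) = Zero C S (Cod C x)"
    using assms b by (auto intro!: null_eq)
  have "x = x \<odot> ((i1 \<odot> p1) \<boxplus> (i2 \<odot> p2))" using assms s by simp
  also have "\<dots> = (x \<odot> (i1 \<odot> p1)) \<boxplus> (x \<odot> (i2 \<odot> p2))"
    by (subst Comp_Add_right[of _ S S _ x "Cod C x"]) (use assms b in simp_all)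
  also have "\<dots> = Zero C S (Cod C x)" using n assms b by simp
  finally show ?thesis using assms(2) b nullI assms(3) by metis
qed

lemma ses_simps:
  assumes "short_exact C k c"
  shows "k \<in> Arr C" "c \<in> Arr C" "Cod C k = Dom C c" "is_mono C k" "is_epi C c" "null (c \<odot> k)"
  using assms kernel_simps[of k c] kernel_mono[of k c] cokernel_epi[of c k]
  by (auto simp: short_exact_def)

lemma ses_le_iff:
  "short_exact C k c \<Longrightarrow> x \<in> Arr C \<Longrightarrow> Cod C x = Dom C c \<Longrightarrow> x \<preceq> k \<longleftrightarrow> null (c \<odot> x)"
  using kernel_le_iff[of k c x] by (simp add: short_exact_def)

lemma ses_desc:
  assumes "short_exact C k c" "x \<in> Arr C" "Dom C x = Cod C k" "null (x \<odot> k)"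
  obtains h where "h \<in> Arr C" "Dom C h = Cod C c" "Cod C h = Cod C x" "h \<odot> c = x"
  using assms cokernel_desc[of c k x] by (auto simp: short_exact_def)

end

context abelian_category
begin

text \<open>A monomorphism \<open>m\<close> is the kernel of some \<open>g\<close>. This
  \<open>g\<close> factors through the cokernel \<open>c\<close> of \<open>m\<close>, so whatever
  \<open>c\<close> kills is killed by \<open>g\<close> and lies in \<open>m\<close>.\<close>

lemma mono_ses:
  assumes "is_mono C m"
  obtains c where "short_exact C m c"
proof -
  obtain g where g: "is_kernel C m g" using assms mono_is_kernel by blast
  obtain c where c: "is_cokernel C c m" using assms ex_cokernel[of m] by auto
  note s = kernel_simps[OF g] cokernel_simps[OF c]
  have "is_kernel C m c"
  proof (rule is_kernelI)
    fix x assume x: "x \<in> Arr C" "Cod C x = Dom C c" "null (c \<odot> x)"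
    obtain h where h: "h \<in> Arr C" "Dom C h = Cod C c" "Cod C h = Cod C g" "h \<odot> c = g"
      using cokernel_desc[OF c, of g] s by auto
    have "null (h \<odot> (c \<odot> x))" using x h s by (rule_tac null_comp1) simp_all
    then have "null (g \<odot> x)" using h x s comp_subst[of h c g x] by simp
    then show "x \<preceq> m" using kernel_le_iff[OF g, of x] x s by simp
  qed (use assms s in simp_all)
  then show ?thesis using that c by (simp add: short_exact_def)
qed

lemma epi_ses:
  assumes "is_epi C e"
  obtains k where "short_exact C k e"
proof -
  obtain g where g: "is_cokernel C e g" using assms epi_is_cokernel by blast
  obtain k where k: "is_kernel C k e" using assms ex_kernel[of e] by auto
  note s = cokernel_simps[OF g] kernel_simps[OF k]
  have "is_cokernel C e k"
  proof (rule is_cokernelI)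
    fix x assume x: "x \<in> Arr C" "Dom C x = Cod C k" "null (x \<odot> k)"
    have "g \<preceq> k" using kernel_le_iff[OF k, of g] s by simp
    then obtain h where h: "h \<in> Arr C" "Dom C h = Dom C g" "Cod C h = Dom C k" "k \<odot> h = g"
      by (rule leE)
    have "null ((x \<odot> k) \<odot> h)" using x h s by (rule_tac null_comp2) simp_all
    then have "null (x \<odot> g)" using h x s by simp
    then show "\<exists>h. h \<in> Arr C \<and> Dom C h = Cod C e \<and> Cod C h = Cod C x \<and> h \<odot> e = x"
      using cokernel_desc[OF g, of x] x s by metis
  qed (use assms s in simp_all)
  then show ?thesis using that k by (simp add: short_exact_def)
qed

lemma kernelE:
  assumes "f \<in> Arr C"
  obtains k where "is_mono C k" "Cod C k = Dom C f"
    "\<And>x. x \<in> Arr C \<Longrightarrow> Cod C x = Dom C f \<Longrightarrow> x \<preceq> k \<longleftrightarrow> null (f \<odot> x)"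
  using ex_kernel[OF assms] kernel_le_iff kernel_mono kernel_simps by metis

text \<open>Only the kernel side has to be verified by the user: the true kernel \<open>l\<close> of
  \<open>c\<close> lies in \<open>k\<close>, so an arrow vanishing on \<open>k\<close> vanishes on
  \<open>l\<close> and descends along \<open>c\<close>.\<close>

lemma short_exactI:
  assumes "is_mono C k" "is_epi C c" "Cod C k = Dom C c" "null (c \<odot> k)"
    "\<And>x. x \<in> Arr C \<Longrightarrow> Cod C x = Dom C c \<Longrightarrow> null (c \<odot> x) \<Longrightarrow> x \<preceq> k"
  shows "short_exact C k c"
proof -
  obtain l where l: "short_exact C l c" using assms epi_ses by blast
  note s = ses_simps[OF l]
  have kl: "l \<preceq> k" using assms s by auto
  have "is_kernel C k c" by (rule is_kernelI) (use assms s in auto)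
  moreover have "is_cokernel C c k"
  proof (rule is_cokernelI)
    fix x assume x: "x \<in> Arr C" "Dom C x = Cod C k" "null (x \<odot> k)"
    obtain h where h: "h \<in> Arr C" "Dom C h = Dom C l" "Cod C h = Dom C k" "k \<odot> h = l"
      using kl by (rule leE)
    have "null ((x \<odot> k) \<odot> h)" using x h s assms(1) by (rule_tac null_comp2) simp_all
    then have "null (x \<odot> l)" using h x s assms(1) by simp
    then show "\<exists>h. h \<in> Arr C \<and> Dom C h = Cod C c \<and> Cod C h = Cod C x \<and> h \<odot> c = x"
      using ses_desc[OF l, of x] x s assms(3) by metis
  qed (use assms in simp_all)
  ultimately show ?thesis by (simp add: short_exact_def)
qed

text \<open>The image \<open>m\<close> is the kernel of the cokernel \<open>c\<close> of
  \<open>f\<close>. If \<open>g\<close> kills \<open>e\<close> and \<open>k\<close> is the kernel of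
  \<open>g\<close>, then \<open>f\<close> already lies in \<open>m \<odot> k\<close>; the cokernel
  of \<open>m \<odot> k\<close> kills \<open>f\<close>, hence factors through \<open>c\<close>,
  hence kills \<open>m\<close>. So \<open>m\<close> lies in \<open>m \<odot> k\<close>, which makes
  \<open>k\<close> a split epimorphism and \<open>g\<close> null.\<close>

lemma image_factorization:
  assumes f: "f \<in> Arr C"
  obtains e m where "is_epi C e" "is_mono C m" "Cod C e = Dom C m" "Dom C e = Dom C f"
    "Cod C m = Cod C f" "m \<odot> e = f"
proof -
  obtain c where c: "is_cokernel C c f" using f ex_cokernel by blast
  note cs = cokernel_simps[OF c]
  obtain m where m: "is_kernel C m c" using cs ex_kernel by blast
  note ms = kernel_simps[OF m] kernel_mono[OF m]
  have "f \<preceq> m" using kernel_le_iff[OF m, of f] cs by simp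
  then obtain e where e: "e \<in> Arr C" "Dom C e = Dom C f" "Cod C e = Dom C m" "m \<odot> e = f"
    by (rule leE)
  have "is_epi C e"
  proof (rule epiI)
    fix g assume g: "g \<in> Arr C" "Dom C g = Cod C e" "null (g \<odot> e)"
    obtain k where k: "is_mono C k" "Cod C k = Dom C g"
      "\<And>x. x \<in> Arr C \<Longrightarrow> Cod C x = Dom C g \<Longrightarrow> x \<preceq> k \<longleftrightarrow> null (g \<odot> x)"
      using g kernelE by metis
    have "e \<preceq> k" using k(3)[of e] g e by simp
    then obtain d where d: "d \<in> Arr C" "Dom C d = Dom C e" "Cod C d = Dom C k" "k \<odot> d = e"
      by (rule leE)
    have mk: "is_mono C (m \<odot> k)" using mono_comp k ms g e by metis
    have mkA: "m \<odot> k \<in> Arr C" "Cod C (m \<odot> k) = Cod C f" "Dom C (m \<odot> k) = Dom C k"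
      using k ms g e cs by simp_all
    obtain h where h: "short_exact C (m \<odot> k) h" using mk mono_ses by blast
    note hs = ses_simps[OF h]
    have f': "(m \<odot> k) \<odot> d = f" using d e k g ms by simp
    have "f \<preceq> m \<odot> k" by (rule leI[OF _ _ _ f']) (use d k ms mkA in simp_all)
    then have "null (h \<odot> f)" using ses_le_iff[OF h, of f] f hs mkA by simp
    then obtain t where t: "t \<in> Arr C" "Dom C t = Cod C c" "Cod C t = Cod C h" "t \<odot> c = h"
      using cokernel_desc[OF c, of h] hs mkA by metis
    have "null (t \<odot> (c \<odot> m))" using t ms cs by (rule_tac null_comp1) simp_all
    then have "null (h \<odot> m)" using comp_subst[of t c h m] t ms cs by simp
    then have "m \<preceq> m \<odot> k" using ses_le_iff[OF h, of m] ms cs hs mkA by simp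
    then obtain s where s: "s \<in> Arr C" "Dom C s = Dom C m" "Cod C s = Dom C (m \<odot> k)" "(m \<odot> k) \<odot> s = m"
      by (rule leE)
    have ks: "k \<odot> s = Ident C (Dom C m)"
      by (rule mono_cancel[OF ms(5)]) (use s mkA ms k g e in simp_all)
    have "null (g \<odot> k)" using k(3)[of k] k by simp
    then have "null ((g \<odot> k) \<odot> s)" using s g k mkA by (rule_tac null_comp2) simp_all
    then show "null g" using ks g k s mkA e by simp
  qed (use e in simp)
  then show ?thesis using that e ms cs by metis
qed

text \<open>Stability of epimorphisms under pullback. The pullback is the kernel \<open>k\<close> of
  the difference of \<open>f \<odot> p1\<close> and \<open>g \<odot> p2\<close>, and that difference
  is itself epi because on the second summand it is the negative of \<open>g\<close>.\<close>

lemma epi_cover: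
  assumes g: "is_epi C g" and f: "f \<in> Arr C" "Cod C f = Cod C g"
  obtains e h where "is_epi C e" "Cod C e = Dom C f" "h \<in> Arr C" "Dom C h = Dom C e"
    "Cod C h = Dom C g" "f \<odot> e = g \<odot> h"
proof -
  have gA: "g \<in> Arr C" using g by simp
  obtain S i1 i2 p1 p2 where B: "is_biproduct C (Dom C f) (Dom C g) S i1 i2 p1 p2"
    using ex_biproduct[of "Dom C f" "Dom C g"] f gA by auto
  note b = biproduct_simps[OF B]
  let ?h = "f \<odot> p1 \<ominus> g \<odot> p2"
  have hA: "?h \<in> Arr C" "Dom C ?h = S" "Cod C ?h = Cod C g" using b f gA by simp_all
  have hi2: "?h \<odot> i2 = Zero C (Dom C g) (Cod C g) \<ominus> g"
    using b f gA by (simp add: sub_comp)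
  have *: "null t" if t: "t \<in> Arr C" "Dom C t = Cod C g" "null (t \<odot> (?h \<odot> i2))" for t
  proof -
    have "null (Zero C (Dom C g) (Cod C t) \<ominus> t \<odot> g)"
      using t gA by (simp add: hi2 comp_sub)
    then have "Zero C (Dom C g) (Cod C t) = t \<odot> g" using t gA by simp
    then have "null (t \<odot> g)" using t gA null_Zero by (metis Dom_Cod_obj)
    then show ?thesis using epi_null[OF g] t by simp
  qed
  have "is_epi C ?h"
  proof (rule epiI[OF hA(1)])
    fix t assume t: "t \<in> Arr C" "Dom C t = Cod C ?h" "null (t \<odot> ?h)"
    have "null ((t \<odot> ?h) \<odot> i2)" using t(1,2) hA b by (rule_tac null_comp2[OF t(3)]) simp_all
    then show "null t" using *[of t] t hA b by simp
  qed
  then obtain k where k: "short_exact C k ?h" using epi_ses by blast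
  note ks = ses_simps[OF k]
  have eq: "f \<odot> (p1 \<odot> k) = g \<odot> (p2 \<odot> k)"
    using ks(6) ks(1,3) b f gA hA by (simp add: sub_comp)
  have "is_epi C (p1 \<odot> k)"
  proof (rule epiI)
    show pk: "p1 \<odot> k \<in> Arr C" using ks hA b by simp
    fix u assume u: "u \<in> Arr C" "Dom C u = Cod C (p1 \<odot> k)" "null (u \<odot> (p1 \<odot> k))"
    have uD: "Dom C u = Dom C f" using u ks hA b by simp
    \<comment> \<open>As \<open>u \<odot> p1\<close> vanishes on the kernel, it descends along the
      epi \<open>?h\<close>. Restricting to the second summand, where \<open>p1\<close> vanishes,
      shows that the induced \<open>v\<close> is null.\<close>
    obtain v where v: "v \<in> Arr C" "Dom C v = Cod C ?h" "Cod C v = Cod C (u \<odot> p1)" "v \<odot> ?h = u \<odot> p1"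
      using ses_desc[OF k, of "u \<odot> p1"] u uD ks(1,3) hA b by auto
    have "v \<odot> (?h \<odot> i2) = (u \<odot> p1) \<odot> i2" using comp_subst[OF v(4), of i2] v(1,2) hA b by simp
    also have "\<dots> = Zero C (Dom C g) (Cod C u)" using u uD b by simp
    finally have "null (v \<odot> (?h \<odot> i2))" using u gA by simp
    then have "null v" using *[of v] v(1,2) hA by simp
    then have "null (u \<odot> p1)" using v(4) null_comp2[of v ?h] v(2) hA by simp
    then have "null ((u \<odot> p1) \<odot> i1)" using u uD b by (rule_tac null_comp2) simp_all
    then show "null u" using u uD b by simp
  qed
  then show ?thesis using that[of "p1 \<odot> k" "p2 \<odot> k"] eq ks(1,3) hA b by simp
qed

text \<open>Dual to the pullback: the pushout is the cokernel of the difference of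
  \<open>i1 \<odot> m\<close> and \<open>i2 \<odot> f\<close>, which is monic because
  \<open>p1\<close> recovers \<open>m\<close> from it. The last clause, joint epimorphy of
  \<open>m'\<close> and \<open>f'\<close>, serves to transfer epimorphisms along a pushout.\<close>

lemma pushout:
  assumes m: "is_mono C m" and f: "f \<in> Arr C" "Dom C f = Dom C m"
  obtains m' f' where "is_mono C m'" "Dom C m' = Cod C f" "f' \<in> Arr C" "Dom C f' = Cod C m"
    "Cod C f' = Cod C m'" "m' \<odot> f = f' \<odot> m"
    "\<And>t. t \<in> Arr C \<Longrightarrow> Dom C t = Cod C m' \<Longrightarrow> null (t \<odot> m') \<Longrightarrow> null (t \<odot> f') \<Longrightarrow> null t"
proof -
  have mA: "m \<in> Arr C" using m by simp
  obtain S i1 i2 p1 p2 where B: "is_biproduct C (Cod C m) (Cod C f) S i1 i2 p1 p2"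
    using ex_biproduct[of "Cod C m" "Cod C f"] f mA by auto
  note b = biproduct_simps[OF B]
  let ?h = "i1 \<odot> m \<ominus> i2 \<odot> f"
  have hA: "?h \<in> Arr C" "Dom C ?h = Dom C m" "Cod C ?h = S" using b f mA by simp_all
  have ph: "p1 \<odot> ?h = m" using b f mA by (simp add: comp_sub biproduct_elem[OF B])
  have "is_mono C ?h" by (rule mono_factor[of p1]) (use ph m hA b in simp_all)
  then obtain c where c: "short_exact C ?h c" using mono_ses by blast
  note cs = ses_simps[OF c]
  have cD: "Dom C c = S" using cs(3) hA by simp
  have eq: "c \<odot> (i1 \<odot> m) = c \<odot> (i2 \<odot> f)"
    using cs(6) cs(2) cD hA b f mA by (simp add: comp_sub)
  have "is_mono C (c \<odot> i2)"
  proof (rule monoI)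
    show "c \<odot> i2 \<in> Arr C" using cs cD b by simp
    fix x assume x: "x \<in> Arr C" "Cod C x = Dom C (c \<odot> i2)" "null ((c \<odot> i2) \<odot> x)"
    have xC: "Cod C x = Cod C f" using x(2) cs(2) cD b by simp
    have "null (c \<odot> (i2 \<odot> x))" using x(1,3) xC cs(2) cD b by simp
    then have "i2 \<odot> x \<preceq> ?h" using ses_le_iff[OF c, of "i2 \<odot> x"] x(1) xC cs(2) cD b by simp
    then obtain y where y: "y \<in> Arr C" "Dom C y = Dom C (i2 \<odot> x)" "Cod C y = Dom C ?h" "?h \<odot> y = i2 \<odot> x"
      by (rule leE)
    have "(p1 \<odot> ?h) \<odot> y = p1 \<odot> (i2 \<odot> x)" using y(1,3,4) hA b by (simp del: sub_simps)
    then have "null (m \<odot> y)" using ph x(1) xC f mA by (simp add: biproduct_elem[OF B])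
    then have "null y" using mono_null[OF m, of y] y hA by simp
    then have "null (i2 \<odot> x)" using y(3,4) null_comp1[of y ?h] hA by simp
    then have "null (p2 \<odot> (i2 \<odot> x))" using x(1) xC b by (rule_tac null_comp1) simp_all
    then show "null x" using x(1) xC by (simp add: biproduct_elem[OF B])
  qed
  moreover have "null t" if t: "t \<in> Arr C" "Dom C t = Cod C (c \<odot> i2)" "null (t \<odot> (c \<odot> i2))" "null (t \<odot> (c \<odot> i1))" for t
  proof -
    have tD: "Dom C t = Cod C c" using t(2) cs(2) cD b by simp
    have "null (t \<odot> c)" by (rule biproduct_null_from[OF B]) (use t tD cs(2) cD b in simp_all)
    then show ?thesis using epi_null[OF cs(5), of t] t(1) tD by simp
  qed
  ultimately show ?thesis using that[of "c \<odot> i2" "c \<odot> i1"] eq cs(2) cD b f mA by simp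
qed

text \<open>The cokernel of an epimorphism is null, so the identity of the codomain lies in the
  subobject \<open>m\<close>; the factor is the inverse.\<close>

lemma isoE:
  assumes m: "is_mono C m" "is_epi C m"
  obtains s where "s \<in> Arr C" "Dom C s = Cod C m" "Cod C s = Dom C m"
    "m \<odot> s = Ident C (Cod C m)" "s \<odot> m = Ident C (Dom C m)"
proof -
  have mA: "m \<in> Arr C" using m by simp
  obtain c where c: "short_exact C m c" using m mono_ses by blast
  note cs = ses_simps[OF c]
  have "null c" using epi_null[OF m(2), of c] cs by simp
  then have "Ident C (Cod C m) \<preceq> m" using ses_le_iff[OF c, of "Ident C (Cod C m)"] cs by simp
  then obtain s where s: "s \<in> Arr C" "Dom C s = Cod C m" "Cod C s = Dom C m" "m \<odot> s = Ident C (Cod C m)"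
    using mA by (auto elim: leE)
  moreover have "s \<odot> m = Ident C (Dom C m)"
    by (rule mono_cancel[OF m(1)]) (use s mA comp_subst[OF s(4), of m] in simp_all)
  ultimately show ?thesis using that by blast
qed

lemma is_iso_iff: "is_iso C f \<longleftrightarrow> is_mono C f \<and> is_epi C f"
proof
  assume "is_iso C f"
  then obtain g where g: "f \<in> Arr C" "g \<in> Arr C" "Dom C g = Cod C f" "Cod C g = Dom C f"
    "g \<odot> f = Ident C (Dom C f)" "f \<odot> g = Ident C (Cod C f)"
    unfolding is_iso_def by auto
  show "is_mono C f \<and> is_epi C f"
    using mono_factor[of g f] epi_factor[of f g] g by simp
next
  assume "is_mono C f \<and> is_epi C f"
  then show "is_iso C f" unfolding is_iso_def by (auto elim!: isoE)
qed

lemma isomorphicE: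
  assumes "isomorphic C A B"
  obtains f where "is_mono C f" "is_epi C f" "Dom C f = A" "Cod C f = B"
  using assms unfolding isomorphic_def is_iso_iff by auto

lemma isomorphicI: "is_mono C f \<Longrightarrow> is_epi C f \<Longrightarrow> isomorphic C (Dom C f) (Cod C f)"
  unfolding isomorphic_def is_iso_iff by auto

lemma isomorphic_refl: "A \<in> Obj C \<Longrightarrow> isomorphic C A A"
  using isomorphicI[of "Ident C A"] by simp

lemma isomorphic_sym:
  assumes "isomorphic C A B" shows "isomorphic C B A"
proof -
  obtain f where f: "is_mono C f" "is_epi C f" "Dom C f = A" "Cod C f = B"
    using assms by (rule isomorphicE)
  then obtain s where s: "s \<in> Arr C" "Dom C s = Cod C f" "Cod C s = Dom C f"
    "f \<odot> s = Ident C (Cod C f)" "s \<odot> f = Ident C (Dom C f)"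
    using isoE by metis
  have "f \<in> Arr C" using f by simp
  then have "is_mono C s" "is_epi C s" using mono_factor[of f s] epi_factor[of s f] s by simp_all
  then show ?thesis using isomorphicI[of s] s f by simp
qed

lemma isomorphic_trans:
  assumes "isomorphic C A B" "isomorphic C B D" shows "isomorphic C A D"
proof -
  obtain f where f: "is_mono C f" "is_epi C f" "Dom C f = A" "Cod C f = B"
    using assms(1) by (rule isomorphicE)
  obtain g where g: "is_mono C g" "is_epi C g" "Dom C g = B" "Cod C g = D"
    using assms(2) by (rule isomorphicE)
  show ?thesis using isomorphicI[of "g \<odot> f"] mono_comp[of f g] epi_comp[of f g] f g by simp
qed

lemma le_null:
  assumes "is_mono C m" "x \<in> Arr C" "Cod C x = Cod C m" "null x"
  shows "x \<preceq> m"
proof -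
  obtain c where c: "short_exact C m c" using assms mono_ses by blast
  show ?thesis using ses_le_iff[OF c, of x] ses_simps[OF c] assms null_comp1[of x c] by simp
qed

text \<open>Membership in \<open>m\<close> means being killed by the cokernel of \<open>m\<close>,
  and epimorphisms detect that.\<close>

lemma le_epi:
  assumes "is_mono C m" "is_epi C e" "x \<in> Arr C" "Cod C x = Cod C m" "Cod C e = Dom C x" "x \<odot> e \<preceq> m"
  shows "x \<preceq> m"
proof -
  obtain c where c: "short_exact C m c" using assms mono_ses by blast
  have "e \<in> Arr C" using assms by simp
  then have "null ((c \<odot> x) \<odot> e)" using ses_le_iff[OF c, of "x \<odot> e"] ses_simps[OF c] assms by simp
  then have "null (c \<odot> x)" using epi_null[OF assms(2), of "c \<odot> x"] ses_simps[OF c] assms by simp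
  then show ?thesis using ses_le_iff[OF c, of x] ses_simps[OF c] assms by simp
qed

text \<open>The preimage is the kernel of \<open>f\<close> followed by a cokernel of
  \<open>m\<close>.\<close>

lemma preimageE:
  assumes "is_mono C m" "f \<in> Arr C" "Cod C f = Cod C m"
  obtains k where "is_mono C k" "Cod C k = Dom C f"
    "\<And>x. x \<in> Arr C \<Longrightarrow> Cod C x = Dom C f \<Longrightarrow> x \<preceq> k \<longleftrightarrow> f \<odot> x \<preceq> m"
proof -
  obtain c where c: "short_exact C m c" using assms mono_ses by blast
  note cs = ses_simps[OF c]
  obtain k where k: "is_mono C k" "Cod C k = Dom C (c \<odot> f)"
    "\<And>x. x \<in> Arr C \<Longrightarrow> Cod C x = Dom C (c \<odot> f) \<Longrightarrow> x \<preceq> k \<longleftrightarrow> null ((c \<odot> f) \<odot> x)"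
    using kernelE[of "c \<odot> f"] assms cs by auto
  have D: "Dom C (c \<odot> f) = Dom C f" using assms cs by simp
  have "x \<preceq> k \<longleftrightarrow> f \<odot> x \<preceq> m" if "x \<in> Arr C" "Cod C x = Dom C f" for x
    using k(3)[of x] ses_le_iff[OF c, of "f \<odot> x"] that assms cs by simp
  then show ?thesis using that k D by simp
qed

end

section \<open>Small sets and coproducts\<close>

context universe
begin

text \<open>The axioms offer unions over small index sets only, so two indices are borrowed from an
  infinite small set.\<close>

lemma small_Un:
  assumes "small A" "small B"
  shows "small (A \<union> B)"
proof -
  obtain S where S: "small S" "infinite S" using ex_infinite_small by blast
  then obtain a b where ab: "a \<in> S" "b \<in> S" "a \<noteq> b"
    by (metis finite.emptyI finite_insert finite_subset insert_iff subsetI)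
  have "{a, b} \<lesssim> S" using ab by (intro subset_imp_lepoll) auto
  then have "small {a, b}" using S small_lepoll by blast
  then have "small (\<Union>i\<in>{a, b}. if i = a then A else B)"
    by (rule small_UN) (use assms in auto)
  then show ?thesis using ab by (simp add: Un_commute)
qed

lemma is_small_lepoll: "is_small small B \<Longrightarrow> A \<lesssim> B \<Longrightarrow> is_small small A"
  unfolding is_small_def using lepoll_trans by blast

lemma is_small_subset: "is_small small B \<Longrightarrow> A \<subseteq> B \<Longrightarrow> is_small small A"
  using is_small_lepoll subset_imp_lepoll by blast

lemma is_small_Pow:
  assumes "is_small small A"
  shows "is_small small (Pow A)"
proof -
  obtain S where S: "small S" "A \<lesssim> S" using assms by (auto simp: is_small_def)
  obtain T where T: "small T" "Pow S \<lesssim> T" using small_Pow[OF S(1)] by blast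
  obtain f where f: "inj_on f A" "f ` A \<subseteq> S" using S(2) by (auto simp: lepoll_def)
  have "Pow A \<lesssim> Pow S" unfolding lepoll_def
    by (rule exI[of _ "image f"]) (use f inj_on_image_Pow[OF f(1)] in blast)
  then show ?thesis using T lepoll_trans unfolding is_small_def by blast
qed

lemma is_small_nat: "is_small small (UNIV :: nat set)"
  using ex_infinite_small unfolding is_small_def infinite_le_lepoll by blast

text \<open>All index sets and fibres are injected into one infinite small set, and an infinite set
  absorbs its own square.\<close>

lemma is_small_Sigma:
  assumes "is_small small I" "\<And>i. i \<in> I \<Longrightarrow> is_small small (F i)"
  shows "is_small small (Sigma I F)"
proof -
  obtain U \<phi> where U: "small U" "inj_on \<phi> I" "\<phi> ` I \<subseteq> U"
    using assms(1) by (auto simp: is_small_def lepoll_def)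
  have "\<forall>i\<in>I. \<exists>T f. small T \<and> inj_on f (F i) \<and> f ` F i \<subseteq> T"
    using assms(2) unfolding is_small_def lepoll_def by blast
  then obtain T f where T: "\<And>i. i \<in> I \<Longrightarrow> small (T i)" "\<And>i. i \<in> I \<Longrightarrow> inj_on (f i) (F i)"
    "\<And>i. i \<in> I \<Longrightarrow> f i ` F i \<subseteq> T i"
    by metis
  obtain S where S: "small S" "infinite S" using ex_infinite_small by blast
  have "small (\<phi> ` I)" using small_lepoll U subset_imp_lepoll by blast
  then have "small (\<Union>j\<in>\<phi> ` I. T (inv_into I \<phi> j))"
    by (rule small_UN) (rule T(1), rule inv_into_into)
  moreover have "(\<Union>j\<in>\<phi> ` I. T (inv_into I \<phi> j)) = (\<Union>i\<in>I. T i)" using U(2) by auto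
  \<comment> \<open>Adding \<open>S\<close> makes the set infinite even if all fibres are finite, as
    the cardinality of the square requires.\<close>
  ultimately have W: "small (U \<union> (\<Union>i\<in>I. T i) \<union> S)" using U S small_Un by simp
  let ?W = "U \<union> (\<Union>i\<in>I. T i) \<union> S"
  have "Sigma I F \<lesssim> ?W \<times> ?W" unfolding lepoll_def
  proof (intro exI conjI)
    show "inj_on (\<lambda>(i, x). (\<phi> i, f i x)) (Sigma I F)"
    proof (rule inj_onI, clarify)
      fix i x j y assume a: "i \<in> I" "x \<in> F i" "j \<in> I" "y \<in> F j" "\<phi> i = \<phi> j" "f i x = f j y"
      have "i = j" using inj_onD[OF U(2) a(5) a(1) a(3)] .
      then show "i = j \<and> x = y" using inj_onD[OF T(2)[OF a(1)], of x y] a by simp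
    qed
    show "(\<lambda>(i, x). (\<phi> i, f i x)) ` Sigma I F \<subseteq> ?W \<times> ?W"
      using U(3) T(3) by fastforce
  qed
  moreover have "?W \<times> ?W \<lesssim> ?W"
    using card_of_Times_same_infinite[of ?W] S(2)
    unfolding lepoll_def card_of_ordLeq by (metis finite_Un ordIso_imp_ordLeq)
  ultimately show ?thesis using W lepoll_trans unfolding is_small_def by blast
qed

end

context category
begin

lemma coproduct_simps:
  assumes "is_coproduct C I F S \<iota>"
  shows "S \<in> Obj C" "i \<in> I \<Longrightarrow> \<iota> i \<in> Arr C" "i \<in> I \<Longrightarrow> Dom C (\<iota> i) = F i" "i \<in> I \<Longrightarrow> Cod C (\<iota> i) = S"
  using assms unfolding is_coproduct_def by auto

lemma coproduct_univ:
  "is_coproduct C I F S \<iota> \<Longrightarrow> T \<in> Obj C \<Longrightarrow> \<forall>i\<in>I. g i \<in> Hom C (F i) T \<Longrightarrow>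
    \<exists>!h. h \<in> Hom C S T \<and> (\<forall>i\<in>I. h \<odot> \<iota> i = g i)"
  unfolding is_coproduct_def by blast

lemma coproduct_desc:
  assumes "is_coproduct C I F S \<iota>" "T \<in> Obj C"
    and "\<And>i. i \<in> I \<Longrightarrow> g i \<in> Arr C" "\<And>i. i \<in> I \<Longrightarrow> Dom C (g i) = F i" "\<And>i. i \<in> I \<Longrightarrow> Cod C (g i) = T"
  obtains h where "h \<in> Arr C" "Dom C h = S" "Cod C h = T" "\<And>i. i \<in> I \<Longrightarrow> h \<odot> \<iota> i = g i"
proof -
  have "\<forall>i\<in>I. g i \<in> Hom C (F i) T" using assms by simp
  then have "\<exists>!h. h \<in> Hom C S T \<and> (\<forall>i\<in>I. h \<odot> \<iota> i = g i)"
    by (rule coproduct_univ[OF assms(1,2)])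
  then show ?thesis using that by auto
qed

lemma coproduct_eqI:
  assumes "is_coproduct C I F S \<iota>" "h \<in> Arr C" "h' \<in> Arr C" "Dom C h = S" "Dom C h' = S" "Cod C h = Cod C h'"
    and "\<And>i. i \<in> I \<Longrightarrow> h \<odot> \<iota> i = h' \<odot> \<iota> i"
  shows "h = h'"
proof -
  note s = coproduct_simps[OF assms(1)]
  have "\<forall>i\<in>I. h' \<odot> \<iota> i \<in> Hom C (F i) (Cod C h')" using s assms(3,5) by simp
  then have "\<exists>!k. k \<in> Hom C S (Cod C h') \<and> (\<forall>i\<in>I. k \<odot> \<iota> i = h' \<odot> \<iota> i)"
    using assms(3) by (intro coproduct_univ[OF assms(1)]) simp_all
  moreover have "h \<in> Hom C S (Cod C h')" "h' \<in> Hom C S (Cod C h')" using assms(2-6) by simp_all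
  moreover have "\<forall>i\<in>I. h \<odot> \<iota> i = h' \<odot> \<iota> i" using assms(7) by blast
  moreover have "\<forall>i\<in>I. h' \<odot> \<iota> i = h' \<odot> \<iota> i" by simp
  ultimately show ?thesis by (metis (no_types, lifting))
qed

end

context preadditive_category
begin

lemma coproduct_null:
  assumes "is_coproduct C I F S \<iota>" "t \<in> Arr C" "Dom C t = S" "\<And>i. i \<in> I \<Longrightarrow> null (t \<odot> \<iota> i)"
  shows "null t"
proof -
  note s = coproduct_simps[OF assms(1)]
  have "t = Zero C S (Cod C t)"
  proof (rule coproduct_eqI[OF assms(1)])
    fix i assume i: "i \<in> I"
    have "t \<odot> \<iota> i = Zero C (F i) (Cod C t)"
      using null_eq[OF assms(4)[OF i], of "F i" "Cod C t"] s i assms(2,3) by simp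
    then show "t \<odot> \<iota> i = Zero C S (Cod C t) \<odot> \<iota> i" using s i assms(2,3) by simp
  qed (use s assms(2,3) in simp_all)
  then show ?thesis using assms nullI by metis
qed

text \<open>Directedness makes the composites \<open>g i \<odot> p i\<close> of a cocone independent
  of \<open>i\<close>, so a cocone is the same as one arrow out of \<open>P\<close> that factors
  through every \<open>p i\<close>. The hypothesis \<open>univ\<close> says that these arrows are
  the ones factoring through \<open>q\<close>.\<close>

lemma quotient_system_direct_limit:
  assumes I: "directed_index I r"
    and p: "\<And>i. i \<in> I \<Longrightarrow> is_epi C (p i)" "\<And>i. i \<in> I \<Longrightarrow> Dom C (p i) = P"
    and t: "\<And>i j. (i, j) \<in> r \<Longrightarrow> t i j \<in> Arr C \<and> Dom C (t i j) = Cod C (p i) \<and>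
      Cod C (t i j) = Cod C (p j) \<and> t i j \<odot> p i = p j"
    and q: "is_epi C q" "Dom C q = P"
    and x: "\<And>i. i \<in> I \<Longrightarrow> x i \<in> Arr C \<and> Dom C (x i) = Cod C (p i) \<and> Cod C (x i) = Cod C q \<and> x i \<odot> p i = q"
    and univ: "\<And>g. g \<in> Arr C \<Longrightarrow> Dom C g = P \<Longrightarrow>
      (\<And>i. i \<in> I \<Longrightarrow> \<exists>h\<in>Arr C. Dom C h = Cod C (p i) \<and> Cod C h = Cod C g \<and> h \<odot> p i = g) \<Longrightarrow>
      \<exists>h\<in>Arr C. Dom C h = Cod C q \<and> Cod C h = Cod C g \<and> h \<odot> q = g"
  shows "is_direct_limit C I r (\<lambda>i. Cod C (p i)) t (Cod C q) x"
  unfolding is_direct_limit_def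
proof (intro conjI allI impI)
  have r: "i \<in> I" "j \<in> I" if "(i, j) \<in> r" for i j
    using I that unfolding directed_index_def preorder_on_def by auto
  have r_refl: "(i, i) \<in> r" if "i \<in> I" for i
    using I that unfolding directed_index_def preorder_on_def refl_on_def by auto
  have r_trans: "(i, k) \<in> r" if "(i, j) \<in> r" "(j, k) \<in> r" for i j k
    using I that unfolding directed_index_def preorder_on_def trans_def by blast
  have pA: "p i \<in> Arr C" if "i \<in> I" for i using p(1)[OF that] by simp
  have qA: "q \<in> Arr C" using q by simp
  show "direct_system C I r (\<lambda>i. Cod C (p i)) t"
    unfolding direct_system_def
  proof (intro conjI ballI allI impI)
    fix i assume i: "i \<in> I"
    show "t i i = Ident C (Cod C (p i))"
      by (rule epi_cancel[OF p(1)[OF i]]) (use t[OF r_refl[OF i]] pA[OF i] in simp_all)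
  next
    fix i j k assume ij: "(i, j) \<in> r \<and> (j, k) \<in> r"
    note i = r[OF conjunct1[OF ij]] and k = r(2)[OF conjunct2[OF ij]]
    have ik: "(i, k) \<in> r" using r_trans ij by blast
    have "t j k \<odot> t i j \<odot> p i = t i k \<odot> p i" using t[of i j] t[of j k] t[OF ik] ij pA i k by simp
    then show "t j k \<odot> t i j = t i k"
      by (rule epi_cancel[OF p(1)[OF i(1)]]) (use t[of i j] t[of j k] t[OF ik] ij pA i k in simp_all)
  qed (use I t pA in auto)
  show "is_cocone C I r (\<lambda>i. Cod C (p i)) t (Cod C q) x"
    unfolding is_cocone_def
  proof (intro conjI ballI allI impI)
    fix i j assume ij: "(i, j) \<in> r"
    note i = r[OF ij]
    have "x j \<odot> t i j \<odot> p i = x i \<odot> p i" using t[OF ij] x[OF i(1)] x[OF i(2)] pA i by simp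
    then show "x j \<odot> t i j = x i"
      by (rule epi_cancel[OF p(1)[OF i(1)]]) (use t[OF ij] x[OF i(1)] x[OF i(2)] pA i in simp_all)
  qed (use x qA in auto)
  fix T g assume c: "is_cocone C I r (\<lambda>i. Cod C (p i)) t T g"
  have gA: "g i \<in> Arr C" "Dom C (g i) = Cod C (p i)" "Cod C (g i) = T" if "i \<in> I" for i
    using c that unfolding is_cocone_def by auto
  have gt: "g i \<odot> p i = g k \<odot> p k" if "(i, k) \<in> r" for i k
  proof -
    note i = r[OF that]
    have "g k \<odot> t i k = g i" using c that unfolding is_cocone_def by blast
    then show ?thesis using comp_subst[of "g k" "t i k" "g i" "p i"] t[OF that] gA i pA by simp
  qed
  obtain i0 where i0: "i0 \<in> I" using I unfolding directed_index_def by blast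
  have G: "g i \<odot> p i = g i0 \<odot> p i0" if i: "i \<in> I" for i
  proof -
    obtain k where "(i, k) \<in> r" "(i0, k) \<in> r" using I i i0 unfolding directed_index_def by blast
    then show ?thesis using gt[of i k] gt[of i0 k] by simp
  qed
  have "\<exists>h\<in>Arr C. Dom C h = Cod C q \<and> Cod C h = Cod C (g i0 \<odot> p i0) \<and> h \<odot> q = g i0 \<odot> p i0"
  proof (rule univ)
    fix i assume i: "i \<in> I"
    show "\<exists>h\<in>Arr C. Dom C h = Cod C (p i) \<and> Cod C h = Cod C (g i0 \<odot> p i0) \<and> h \<odot> p i = g i0 \<odot> p i0"
      using gA[OF i] gA[OF i0] G[OF i] pA[OF i0] by (intro bexI[of _ "g i"]) simp_all
  qed (use gA i0 p pA in simp_all)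
  then obtain h where h: "h \<in> Arr C" "Dom C h = Cod C q" "Cod C h = T" "h \<odot> q = g i0 \<odot> p i0"
    using gA i0 pA by auto
  show "\<exists>!h. h \<in> Hom C (Cod C q) T \<and> (\<forall>i\<in>I. h \<odot> x i = g i)"
  proof (intro ex1I[of _ h] conjI ballI)
    fix i assume i: "i \<in> I"
    show "h \<odot> x i = g i"
      by (rule epi_cancel[OF p(1)[OF i]]) (use x[OF i] h gA[OF i] pA[OF i] G[OF i] in simp_all)
  next
    fix h' assume h': "h' \<in> Hom C (Cod C q) T \<and> (\<forall>i\<in>I. h' \<odot> x i = g i)"
    have "h' \<odot> q = h' \<odot> (x i0 \<odot> p i0)" using x[OF i0] by simp
    also have "\<dots> = g i0 \<odot> p i0"
      using h' i0 x[OF i0] pA[OF i0] by (intro comp_subst) simp_all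
    finally show "h' = h"
      by (rule_tac epi_cancel[OF q(1)]) (use h h' in simp_all)
  qed (use h in simp)
qed

end

context grothendieck_category
begin

text \<open>The locale provides coproducts for index sets in \<open>'u\<close> only; an injection
  into \<open>'u\<close> transports them to any small index set, such as a set of subsets, of
  triples, or of natural numbers.\<close>

lemma coproduct_exists:
  fixes F :: "'x \<Rightarrow> 'o"
  assumes "is_small small I" "F ` I \<subseteq> Obj C"
  obtains S \<iota> where "is_coproduct C I F S \<iota>"
proof -
  obtain U \<phi> where U: "small U" "inj_on \<phi> I" "\<phi> ` I \<subseteq> U"
    using assms(1) by (auto simp: is_small_def lepoll_def)
  let ?J = "\<phi> ` I" and ?\<psi> = "inv_into I \<phi>"
  have "small ?J" using U small_lepoll subset_imp_lepoll by blast
  moreover have "(\<lambda>j. F (?\<psi> j)) ` ?J \<subseteq> Obj C" using U(2) assms(2) by auto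
  ultimately obtain S \<iota> where S: "is_coproduct C ?J (\<lambda>j. F (?\<psi> j)) S \<iota>"
    using ex_coproduct by blast
  have "is_coproduct C I F S (\<lambda>i. \<iota> (\<phi> i))"
    unfolding is_coproduct_def
  proof (intro conjI ballI allI impI)
    show "S \<in> Obj C" using S by (simp add: is_coproduct_def)
    show "\<iota> (\<phi> i) \<in> Hom C (F i) S" if "i \<in> I" for i
      using S that U(2) unfolding is_coproduct_def by force
    fix T g assume T: "T \<in> Obj C" "\<forall>i\<in>I. g i \<in> Hom C (F i) T"
    then have "\<forall>j\<in>?J. g (?\<psi> j) \<in> Hom C (F (?\<psi> j)) T" using U(2) by auto
    then have "\<exists>!h. h \<in> Hom C S T \<and> (\<forall>j\<in>?J. h \<odot> \<iota> j = g (?\<psi> j))"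
      using S T(1) unfolding is_coproduct_def by (elim conjE) (drule bspec, assumption, drule spec[of _ "\<lambda>j. g (?\<psi> j)"], blast)
    moreover have "(\<forall>j\<in>?J. h \<odot> \<iota> j = g (?\<psi> j)) \<longleftrightarrow> (\<forall>i\<in>I. h \<odot> \<iota> (\<phi> i) = g i)" for h
      using U(2) by auto
    ultimately show "\<exists>!h. h \<in> Hom C S T \<and> (\<forall>i\<in>I. h \<odot> \<iota> (\<phi> i) = g i)" by simp
  qed
  then show ?thesis by (rule that)
qed

section \<open>Directed covers\<close>

text \<open>The quotients of \<open>S\<close> by the \<open>l i\<close> have direct limit zero, and so do the cokernels of the
  monomorphisms \<open>b i\<close> from the quotients of \<open>Dom C f\<close> by the preimages of the \<open>l i\<close> into them. Hence exactness forces the direct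
  limit of the latter quotients to vanish as well.\<close>

lemma small_directed_cover:
  fixes l :: "'u \<Rightarrow> 'm"
  assumes I: "small I" "I \<noteq> {}"
    and l: "\<And>i. i \<in> I \<Longrightarrow> is_mono C (l i)" "\<And>i. i \<in> I \<Longrightarrow> Cod C (l i) = S"
    and dir: "\<And>i j. i \<in> I \<Longrightarrow> j \<in> I \<Longrightarrow> \<exists>k\<in>I. l i \<preceq> l k \<and> l j \<preceq> l k"
    and cov: "\<And>t. t \<in> Arr C \<Longrightarrow> Dom C t = S \<Longrightarrow> (\<And>i. i \<in> I \<Longrightarrow> null (t \<odot> l i)) \<Longrightarrow> null t"
    and f: "f \<in> Arr C" "Cod C f = S"
    and g: "g \<in> Arr C" "Dom C g = Dom C f"
    and loc: "\<And>i x. i \<in> I \<Longrightarrow> x \<in> Arr C \<Longrightarrow> Cod C x = Dom C f \<Longrightarrow> f \<odot> x \<preceq> l i \<Longrightarrow> null (g \<odot> x)"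
  shows "null g"
proof -
  define r where "r = {(i, j). i \<in> I \<and> j \<in> I \<and> l i \<preceq> l j}"
  have lA: "l i \<in> Arr C" if "i \<in> I" for i using l(1)[OF that] by simp
  have rI: "i \<in> I" "j \<in> I" "l i \<preceq> l j" if "(i, j) \<in> r" for i j using that by (auto simp: r_def)
  have dI: "directed_index I r"
    unfolding directed_index_def preorder_on_def
  proof (intro conjI ballI)
    show "r \<subseteq> I \<times> I" by (auto simp: r_def)
    show "refl_on I r" using lA by (auto simp: r_def refl_on_def)
    show "trans r" using lA le_trans by (auto simp: r_def trans_def)
    show "\<exists>k\<in>I. (i, k) \<in> r \<and> (j, k) \<in> r" if "i \<in> I" "j \<in> I" for i j
      using dir[OF that] that by (auto simp: r_def)
  qed (rule I(2))
  have SO: "S \<in> Obj C" using f by auto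
  have "\<forall>i\<in>I. \<exists>s. short_exact C (l i) s" using l(1) mono_ses by metis
  then obtain s where s: "\<And>i. i \<in> I \<Longrightarrow> short_exact C (l i) (s i)" by metis
  have s': "s i \<in> Arr C" "Dom C (s i) = S" "is_epi C (s i)" "null (s i \<odot> l i)" if "i \<in> I" for i
    using ses_simps[OF s[OF that]] l(2)[OF that] by simp_all
  \<comment> \<open>The \<open>k i\<close> are the preimages of the \<open>l i\<close> under
    \<open>f\<close>; the arrows \<open>b i\<close> below compare the quotient by \<open>k i\<close>
    with the quotient by \<open>l i\<close>.\<close>
  have "\<forall>i\<in>I. \<exists>k. is_mono C k \<and> Cod C k = Dom C f \<and>
      (\<forall>x\<in>Arr C. Cod C x = Dom C f \<longrightarrow> (x \<preceq> k \<longleftrightarrow> f \<odot> x \<preceq> l i))"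
    using l f preimageE by metis
  then obtain k where k: "\<And>i. i \<in> I \<Longrightarrow> is_mono C (k i)" "\<And>i. i \<in> I \<Longrightarrow> Cod C (k i) = Dom C f"
    "\<And>i x. i \<in> I \<Longrightarrow> x \<in> Arr C \<Longrightarrow> Cod C x = Dom C f \<Longrightarrow> x \<preceq> k i \<longleftrightarrow> f \<odot> x \<preceq> l i"
    by metis
  have kA: "k i \<in> Arr C" if "i \<in> I" for i using k(1)[OF that] by simp
  have fk: "f \<odot> k i \<preceq> l i" if "i \<in> I" for i using k(3)[OF that kA[OF that] k(2)[OF that]] kA[OF that] by simp
  have "\<forall>i\<in>I. \<exists>p. short_exact C (k i) p" using k(1) mono_ses by metis
  then obtain p where p: "\<And>i. i \<in> I \<Longrightarrow> short_exact C (k i) (p i)" by metis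
  have p': "p i \<in> Arr C" "Dom C (p i) = Dom C f" "is_epi C (p i)" "null (p i \<odot> k i)" if "i \<in> I" for i
    using ses_simps[OF p[OF that]] k(2)[OF that] by simp_all
  have "\<exists>b\<in>Arr C. Dom C b = Cod C (p i) \<and> Cod C b = Cod C (s i) \<and> b \<odot> p i = s i \<odot> f" if i: "i \<in> I" for i
  proof -
    have "null (s i \<odot> (f \<odot> k i))" using ses_le_iff[OF s[OF i], of "f \<odot> k i"] fk[OF i] s'[OF i] kA[OF i] k(2)[OF i] f by simp
    then have "null ((s i \<odot> f) \<odot> k i)" using s'[OF i] kA[OF i] k(2)[OF i] f by simp
    then show ?thesis using ses_desc[OF p[OF i], of "s i \<odot> f"] s'[OF i] f k(2)[OF i] by (metis Comp_simps)
  qed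
  then obtain b where b: "\<And>i. i \<in> I \<Longrightarrow> b i \<in> Arr C" "\<And>i. i \<in> I \<Longrightarrow> Dom C (b i) = Cod C (p i)"
     "\<And>i. i \<in> I \<Longrightarrow> Cod C (b i) = Cod C (s i)" "\<And>i. i \<in> I \<Longrightarrow> b i \<odot> p i = s i \<odot> f"
    by metis
  have bm: "is_mono C (b i)" if i: "i \<in> I" for i
  proof (rule monoI[OF b(1)[OF i]])
    fix z assume z: "z \<in> Arr C" "Cod C z = Dom C (b i)" "null (b i \<odot> z)"
    \<comment> \<open>Lifted along a cover, an element killed by \<open>b i\<close> comes from some
      \<open>w\<close> with \<open>f \<odot> w\<close> in \<open>l i\<close>, that is, with
      \<open>w\<close> in \<open>k i\<close>.\<close>
    obtain e w where e: "is_epi C e" "Cod C e = Dom C z" "w \<in> Arr C" "Dom C w = Dom C e"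
       "Cod C w = Dom C (p i)" "z \<odot> e = p i \<odot> w"
      using epi_cover[OF p'(3)[OF i], of z] z b(2)[OF i] by metis
    have eA: "e \<in> Arr C" using e by simp
    have "null ((b i \<odot> z) \<odot> e)" using z e eA b[OF i] by (rule_tac null_comp2) simp_all
    then have "null (b i \<odot> (p i \<odot> w))" using e eA z b[OF i] by simp
    then have "null (s i \<odot> (f \<odot> w))" using comp_subst[OF b(4)[OF i], of w] e b[OF i] p'[OF i] s'[OF i] f by simp
    then have "f \<odot> w \<preceq> l i" using ses_le_iff[OF s[OF i], of "f \<odot> w"] e p'[OF i] s'[OF i] f by simp
    then have "w \<preceq> k i" using k(3)[OF i, of w] e p'[OF i] by simp
    then have "null (p i \<odot> w)" using ses_le_iff[OF p[OF i], of w] e by simp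
    then have "null (z \<odot> e)" using e by simp
    then show "null z" using epi_null[OF e(1), of z] z e by simp
  qed
  have "\<forall>i\<in>I. \<exists>c. short_exact C (b i) c" using bm mono_ses by metis
  then obtain c where c: "\<And>i. i \<in> I \<Longrightarrow> short_exact C (b i) (c i)" by metis
  have c': "c i \<in> Arr C" "Dom C (c i) = Cod C (s i)" "is_epi C (c i)" "null (c i \<odot> b i)" if "i \<in> I" for i
    using ses_simps[OF c[OF that]] b(3)[OF that] by simp_all
  have "\<exists>t\<in>Arr C. Dom C t = Cod C (p i) \<and> Cod C t = Cod C (p j) \<and> t \<odot> p i = p j" if ij: "(i, j) \<in> r" for i j
  proof -
    note i = rI[OF ij]
    have "f \<odot> k i \<preceq> l j" using le_trans[OF fk[OF i(1)] i(3) lA[OF i(2)]] .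
    then have "k i \<preceq> k j" using k(3)[OF i(2) kA[OF i(1)] k(2)[OF i(1)]] by simp
    then have "null (p j \<odot> k i)" using ses_le_iff[OF p[OF i(2)], of "k i"] k kA i p' by simp
    then show ?thesis using ses_desc[OF p[OF i(1)], of "p j"] k kA i p' by metis
  qed
  then obtain tX where tX: "\<And>i j. (i, j) \<in> r \<Longrightarrow> tX i j \<in> Arr C \<and> Dom C (tX i j) = Cod C (p i) \<and>
      Cod C (tX i j) = Cod C (p j) \<and> tX i j \<odot> p i = p j"
    by metis
  have "\<exists>t\<in>Arr C. Dom C t = Cod C (s i) \<and> Cod C t = Cod C (s j) \<and> t \<odot> s i = s j" if ij: "(i, j) \<in> r" for i j
  proof -
    note i = rI[OF ij]
    have "null (s j \<odot> l i)" using ses_le_iff[OF s[OF i(2)], of "l i"] i l lA s' by simp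
    then show ?thesis using ses_desc[OF s[OF i(1)], of "s j"] l i s' by metis
  qed
  then obtain tY where tY: "\<And>i j. (i, j) \<in> r \<Longrightarrow> tY i j \<in> Arr C \<and> Dom C (tY i j) = Cod C (s i) \<and>
      Cod C (tY i j) = Cod C (s j) \<and> tY i j \<odot> s i = s j"
    by metis
  have sm: "b j \<odot> tX i j = tY i j \<odot> b i" if ij: "(i, j) \<in> r" for i j
  proof -
    note i = rI[OF ij]
    have "b j \<odot> tX i j \<odot> p i = tY i j \<odot> b i \<odot> p i"
      using tX[OF ij] tY[OF ij] b[OF i(1)] b[OF i(2)] p'[OF i(1)] s'[OF i(1)] f
        comp_subst[of "tY i j" "s i" "s j" f] by simp
    then show ?thesis
      by (rule epi_cancel[OF p'(3)[OF i(1)]])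
        (use tX[OF ij] tY[OF ij] b[OF i(1)] b[OF i(2)] in simp_all)
  qed
  have "\<exists>t\<in>Arr C. Dom C t = Cod C (c i) \<and> Cod C t = Cod C (c j) \<and> t \<odot> c i = c j \<odot> tY i j" if ij: "(i, j) \<in> r" for i j
  proof -
    note i = rI[OF ij]
    have "null ((c j \<odot> b j) \<odot> tX i j)"
      using c'[OF i(2)] tX[OF ij] b[OF i(2)] by (rule_tac null_comp2) simp_all
    then have "null ((c j \<odot> tY i j) \<odot> b i)"
      using c'[OF i(2)] tX[OF ij] tY[OF ij] b[OF i(2)] b[OF i(1)] sm[OF ij] by simp
    then show ?thesis
      using ses_desc[OF c[OF i(1)], of "c j \<odot> tY i j"] c'[OF i(2)] tY[OF ij] b[OF i(1)] by (metis Comp_simps)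
  qed
  then obtain tZ where tZ: "\<And>i j. (i, j) \<in> r \<Longrightarrow> tZ i j \<in> Arr C \<and> Dom C (tZ i j) = Cod C (c i) \<and>
      Cod C (tZ i j) = Cod C (c j) \<and> tZ i j \<odot> c i = c j \<odot> tY i j"
    by metis
  have "(\<lambda>i. Dom C (k i)) ` I \<subseteq> Obj C" using kA by auto
  \<comment> \<open>The arrow \<open>\<kappa>\<close> out of this coproduct has the sum of all
    preimages as image, so its cokernel \<open>q\<close> is the direct limit of the quotients
    \<open>p i\<close>.\<close>
  then obtain S' \<iota> where S': "is_coproduct C I (\<lambda>i. Dom C (k i)) S' \<iota>"
    using ex_coproduct[OF I(1)] by blast
  note S's = coproduct_simps[OF S']
  have "Dom C f \<in> Obj C" using f by simp
  then obtain \<kappa> where \<kappa>: "\<kappa> \<in> Arr C" "Dom C \<kappa> = S'" "Cod C \<kappa> = Dom C f" "\<And>i. i \<in> I \<Longrightarrow> \<kappa> \<odot> \<iota> i = k i"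
    using coproduct_desc[OF S', of "Dom C f" k] kA k(2) by metis
  obtain q where q: "is_cokernel C q \<kappa>" using ex_cokernel[OF \<kappa>(1)] by blast
  note q' = cokernel_simps[OF q] cokernel_epi[OF q]
  have q_null: "null (q \<odot> k i)" if i: "i \<in> I" for i
  proof -
    have "null (q \<odot> \<kappa> \<odot> \<iota> i)"
      using q' \<kappa> S's(2-4)[OF i] by (rule_tac null_comp2) simp_all
    then show ?thesis using q' \<kappa> S's(2-4)[OF i] i by simp
  qed
  have q_desc: "\<exists>h\<in>Arr C. Dom C h = Cod C q \<and> Cod C h = Cod C u \<and> h \<odot> q = u"
    if u: "u \<in> Arr C" "Dom C u = Dom C f" "\<And>i. i \<in> I \<Longrightarrow> null (u \<odot> k i)" for u
  proof -
    have "null (u \<odot> \<kappa>)"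
    proof (rule coproduct_null[OF S'])
      fix i assume i: "i \<in> I"
      show "null (u \<odot> \<kappa> \<odot> \<iota> i)" using u(1,2) u(3)[OF i] \<kappa> i S's(2-4)[OF i] by simp
    qed (use u(1,2) \<kappa> in simp_all)
    then show ?thesis using cokernel_desc[OF q, of u] u(1,2) \<kappa> by metis
  qed
  have "\<exists>x\<in>Arr C. Dom C x = Cod C (p i) \<and> Cod C x = Cod C q \<and> x \<odot> p i = q" if i: "i \<in> I" for i
    using ses_desc[OF p[OF i], of q] q_null[OF i] q' k(2)[OF i] \<kappa> by metis
  then obtain x where x: "\<And>i. i \<in> I \<Longrightarrow> x i \<in> Arr C \<and> Dom C (x i) = Cod C (p i) \<and> Cod C (x i) = Cod C q \<and> x i \<odot> p i = q"
    by metis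
  obtain Z where Z: "is_zero C Z" using ex_zero by blast
  note ZO = is_zero_Obj[OF Z]
  have zero_epi: "is_epi C (Zero C A Z)" if "A \<in> Obj C" for A
    by (rule epiI) (use is_zero_null[OF Z] that ZO in simp_all)
  have limX: "is_direct_limit C I r (\<lambda>i. Cod C (p i)) tX (Cod C q) x"
  proof (rule quotient_system_direct_limit[OF dI])
    fix u assume u: "u \<in> Arr C" "Dom C u = Dom C f"
      "\<And>i. i \<in> I \<Longrightarrow> \<exists>h\<in>Arr C. Dom C h = Cod C (p i) \<and> Cod C h = Cod C u \<and> h \<odot> p i = u"
    show "\<exists>h\<in>Arr C. Dom C h = Cod C q \<and> Cod C h = Cod C u \<and> h \<odot> q = u"
    proof (rule q_desc[OF u(1,2)])
      fix i assume i: "i \<in> I"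
      obtain h where h: "h \<in> Arr C" "Dom C h = Cod C (p i)" "Cod C h = Cod C u" "h \<odot> p i = u"
        using u(3)[OF i] by blast
      have "null (h \<odot> (p i \<odot> k i))" using h p'[OF i] by (rule_tac null_comp1) (simp_all add: kA k i)
      then show "null (u \<odot> k i)" using comp_subst[OF h(4), of "k i"] h p'[OF i] kA[OF i] k(2)[OF i] by simp
    qed
  qed (use p' tX q' \<kappa> x in simp_all)
  have null_desc: "\<exists>h\<in>Arr C. Dom C h = Cod C (Zero C S Z) \<and> Cod C h = Cod C u \<and> h \<odot> Zero C S Z = u"
    if "u \<in> Arr C" "Dom C u = S" "null u" for u
    using that ZO SO null_eq[OF that(3)] by (intro bexI[of _ "Zero C Z (Cod C u)"]) simp_all
  have limY: "is_direct_limit C I r (\<lambda>i. Cod C (s i)) tY (Cod C (Zero C S Z)) (\<lambda>i. Zero C (Cod C (s i)) Z)"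
  proof (rule quotient_system_direct_limit[OF dI])
    fix u assume u: "u \<in> Arr C" "Dom C u = S"
      "\<And>i. i \<in> I \<Longrightarrow> \<exists>h\<in>Arr C. Dom C h = Cod C (s i) \<and> Cod C h = Cod C u \<and> h \<odot> s i = u"
    have "null u"
    proof (rule cov[OF u(1,2)])
      fix i assume i: "i \<in> I"
      obtain h where h: "h \<in> Arr C" "Dom C h = Cod C (s i)" "Cod C h = Cod C u" "h \<odot> s i = u"
        using u(3)[OF i] by blast
      have "null (h \<odot> (s i \<odot> l i))" using h s'[OF i] by (rule_tac null_comp1) (simp_all add: lA l i)
      then show "null (u \<odot> l i)" using comp_subst[OF h(4), of "l i"] h s'[OF i] lA[OF i] l(2)[OF i] by simp
    qed
    then show "\<exists>h\<in>Arr C. Dom C h = Cod C (Zero C S Z) \<and> Cod C h = Cod C u \<and> h \<odot> Zero C S Z = u"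
      using null_desc u by blast
  qed (use s' tY zero_epi SO ZO in simp_all)
  have limZ: "is_direct_limit C I r (\<lambda>i. Cod C (c i \<odot> s i)) tZ (Cod C (Zero C S Z)) (\<lambda>i. Zero C (Cod C (c i)) Z)"
  proof (rule quotient_system_direct_limit[OF dI])
    fix u assume u: "u \<in> Arr C" "Dom C u = S"
      "\<And>i. i \<in> I \<Longrightarrow> \<exists>h\<in>Arr C. Dom C h = Cod C (c i \<odot> s i) \<and> Cod C h = Cod C u \<and> h \<odot> (c i \<odot> s i) = u"
    have "null u"
    proof (rule cov[OF u(1,2)])
      fix i assume i: "i \<in> I"
      obtain h where h: "h \<in> Arr C" "Dom C h = Cod C (c i \<odot> s i)" "Cod C h = Cod C u" "h \<odot> (c i \<odot> s i) = u"
        using u(3)[OF i] by blast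
      have "null ((h \<odot> c i) \<odot> (s i \<odot> l i))" using h s'[OF i] c'[OF i] by (rule_tac null_comp1) (simp_all add: lA l i)
      then show "null (u \<odot> l i)" using comp_subst[OF h(4), of "l i"] h s'[OF i] c'[OF i] lA[OF i] l(2)[OF i] by simp
    qed
    then show "\<exists>h\<in>Arr C. Dom C h = Cod C (Zero C S Z) \<and> Cod C h = Cod C u \<and> h \<odot> Zero C S Z = u"
      using null_desc u by blast
  next
    fix i j assume ij: "(i, j) \<in> r"
    note i = rI[OF ij]
    show "tZ i j \<in> Arr C \<and> Dom C (tZ i j) = Cod C (c i \<odot> s i) \<and> Cod C (tZ i j) = Cod C (c j \<odot> s j) \<and>
        tZ i j \<odot> (c i \<odot> s i) = c j \<odot> s j"
      using tZ[OF ij] tY[OF ij] c'[OF i(1)] c'[OF i(2)] s'[OF i(1)] s'[OF i(2)]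
        comp_subst[of "tZ i j" "c i" "c j \<odot> tY i j" "s i"] by simp
  next
    fix i assume i: "i \<in> I"
    show "is_epi C (c i \<odot> s i)" using epi_comp s'[OF i] c'[OF i] by simp
  qed (use s' c' zero_epi SO ZO in simp_all)
  \<comment> \<open>The other two limits are the zero object \<open>Z\<close>, so exactness makes
    the arrow from \<open>Cod C q\<close> to \<open>Z\<close> monic and \<open>Cod C q\<close>
    zero.\<close>
  have "short_exact C (Zero C (Cod C q) Z) (Zero C Z Z)"
  proof (rule direct_limits_exact[OF I(1) limX limY limZ, of b c])
    show "system_morphism C I r (\<lambda>i. Cod C (p i)) tX (\<lambda>i. Cod C (s i)) tY b"
      using b sm unfolding system_morphism_def by simp
    show "system_morphism C I r (\<lambda>i. Cod C (s i)) tY (\<lambda>i. Cod C (c i \<odot> s i)) tZ c"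
      unfolding system_morphism_def using c' s' tZ by simp
    show "short_exact C (b i) (c i)" if "i \<in> I" for i using c[OF that] .
    show "Zero C (Cod C q) Z \<in> Hom C (Cod C q) (Cod C (Zero C S Z))" using q' ZO SO by simp
    show "Zero C Z Z \<in> Hom C (Cod C (Zero C S Z)) (Cod C (Zero C S Z))" using ZO SO by simp
    fix i assume i: "i \<in> I"
    show "Zero C (Cod C q) Z \<odot> x i = Zero C (Cod C (s i)) Z \<odot> b i"
      using x[OF i] b[OF i] q' ZO s'[OF i] p'[OF i] by simp
    show "Zero C Z Z \<odot> Zero C (Cod C (s i)) Z = Zero C (Cod C (c i)) Z \<odot> c i"
      using ZO s'[OF i] c'[OF i] by simp
  qed
  then have "is_mono C (Zero C (Cod C q) Z)" using ses_simps by blast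
  then have "is_zero C (Cod C q)" using zero_Dom_iff[of "Zero C (Cod C q) Z"] q' ZO by simp
  then have qn: "null q" using zero_Cod_iff q' by blast
  \<comment> \<open>Each \<open>k i\<close> is itself one of the elements covered by
    \<open>loc\<close>; hence \<open>g\<close> vanishes on all of them and factors through the null
    arrow \<open>q\<close>.\<close>
  have "null (g \<odot> k i)" if i: "i \<in> I" for i
    using loc[OF i kA[OF i] k(2)[OF i] fk[OF i]] .
  then obtain h where "h \<in> Arr C" "Dom C h = Cod C q" "h \<odot> q = g"
    using q_desc[OF g] by blast
  then show "null g" using null_comp1[OF qn, of h] by simp
qed

lemma directed_cover:
  fixes l :: "'x \<Rightarrow> 'm"
  assumes I: "is_small small I" "I \<noteq> {}"
    and l: "\<And>i. i \<in> I \<Longrightarrow> is_mono C (l i)" "\<And>i. i \<in> I \<Longrightarrow> Cod C (l i) = S"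
    and dir: "\<And>i j. i \<in> I \<Longrightarrow> j \<in> I \<Longrightarrow> \<exists>k\<in>I. l i \<preceq> l k \<and> l j \<preceq> l k"
    and cov: "\<And>t. t \<in> Arr C \<Longrightarrow> Dom C t = S \<Longrightarrow> (\<And>i. i \<in> I \<Longrightarrow> null (t \<odot> l i)) \<Longrightarrow> null t"
    and f: "f \<in> Arr C" "Cod C f = S"
    and g: "g \<in> Arr C" "Dom C g = Dom C f"
    and loc: "\<And>i x. i \<in> I \<Longrightarrow> x \<in> Arr C \<Longrightarrow> Cod C x = Dom C f \<Longrightarrow> f \<odot> x \<preceq> l i \<Longrightarrow> null (g \<odot> x)"
  shows "null g"
proof -
  obtain U \<phi> where U: "small U" "inj_on \<phi> I" "\<phi> ` I \<subseteq> U"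
    using I(1) by (auto simp: is_small_def lepoll_def)
  have inv: "inv_into I \<phi> (\<phi> i) = i" if "i \<in> I" for i using U(2) that by simp
  show ?thesis
  proof (rule small_directed_cover[of "\<phi> ` I" "\<lambda>j. l (inv_into I \<phi> j)" S f g])
    show "small (\<phi> ` I)" using U small_lepoll subset_imp_lepoll by blast
    show "\<exists>k\<in>\<phi> ` I. l (inv_into I \<phi> i) \<preceq> l (inv_into I \<phi> k) \<and> l (inv_into I \<phi> j) \<preceq> l (inv_into I \<phi> k)"
      if "i \<in> \<phi> ` I" "j \<in> \<phi> ` I" for i j
      using dir that inv by (auto simp: bex_simps)
    show "null t" if "t \<in> Arr C" "Dom C t = S" "\<And>i. i \<in> \<phi> ` I \<Longrightarrow> null (t \<odot> l (inv_into I \<phi> i))" for t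
      using cov[OF that(1,2)] that(3) inv by (metis imageI)
  qed (use I(2) l f g loc inv in auto)
qed

end

section \<open>Finite support and disjoint subobjects\<close>

context preadditive_category
begin

lemma generating_set_null:
  assumes "generating_set C \<G>" "t \<in> Arr C"
    and "\<And>G h. G \<in> \<G> \<Longrightarrow> h \<in> Arr C \<Longrightarrow> Dom C h = G \<Longrightarrow> Cod C h = Dom C t \<Longrightarrow> null (t \<odot> h)"
  shows "null t"
proof (rule ccontr)
  assume n: "\<not> null t"
  let ?z = "Zero C (Dom C t) (Cod C t)"
  have "t \<noteq> ?z" using n assms(2) by (auto simp: null_def)
  moreover have "t \<in> Hom C (Dom C t) (Cod C t)" "?z \<in> Hom C (Dom C t) (Cod C t)"
    using assms(2) by simp_all
  ultimately obtain G h where h: "G \<in> \<G>" "h \<in> Hom C G (Dom C t)" "t \<odot> h \<noteq> ?z \<odot> h"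
    using assms(1) unfolding generating_set_def by blast
  have "null (t \<odot> h)" by (rule assms(3)) (use h in simp_all)
  then have "t \<odot> h = Zero C (Dom C h) (Cod C t)" by (rule null_eq) (use h assms(2) in simp_all)
  then show False using h assms(2) by simp
qed

text \<open>Zero intersection, phrased with elements so that no intersection object has to be
  constructed.\<close>

definition disj where
  "disj a b \<longleftrightarrow> (\<forall>x. x \<preceq> a \<longrightarrow> x \<preceq> b \<longrightarrow> null x)"

lemma disjD: "disj a b \<Longrightarrow> x \<preceq> a \<Longrightarrow> x \<preceq> b \<Longrightarrow> null x"
  unfolding disj_def by blast

text \<open>The element \<open>x\<close> lies in the subobject generated by the \<open>\<iota> i\<close> with \<open>i \<in> A\<close>; testing
  against arrows \<open>t\<close> avoids finite sums of arrows.\<close>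

definition supported where
  "supported S \<iota> A x \<longleftrightarrow>
    (\<forall>t. t \<in> Arr C \<longrightarrow> Dom C t = S \<longrightarrow> (\<forall>i\<in>A. null (t \<odot> \<iota> i)) \<longrightarrow> null (t \<odot> x))"

lemma supportedD:
  "supported S \<iota> A x \<Longrightarrow> t \<in> Arr C \<Longrightarrow> Dom C t = S \<Longrightarrow> (\<And>i. i \<in> A \<Longrightarrow> null (t \<odot> \<iota> i)) \<Longrightarrow> null (t \<odot> x)"
  unfolding supported_def by blast

end

context abelian_category
begin

text \<open>The cokernel of \<open>m\<close> detects membership, and its nullity on \<open>x\<close>
  can be tested on generators.\<close>

lemma le_generating:
  assumes G: "generating_set C \<G>" and m: "is_mono C m" and x: "x \<in> Arr C" "Cod C x = Cod C m"
    and le: "\<And>G h. G \<in> \<G> \<Longrightarrow> h \<in> Arr C \<Longrightarrow> Dom C h = G \<Longrightarrow> Cod C h = Dom C x \<Longrightarrow> x \<odot> h \<preceq> m"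
  shows "x \<preceq> m"
proof -
  obtain c where c: "short_exact C m c" using m mono_ses by blast
  note cs = ses_simps[OF c]
  have "null (c \<odot> x)"
  proof (rule generating_set_null[OF G])
    fix G h assume h: "G \<in> \<G>" "h \<in> Arr C" "Dom C h = G" "Cod C h = Dom C (c \<odot> x)"
    then have D: "Cod C h = Dom C x" using x cs by simp
    show "null (c \<odot> x \<odot> h)" using le[OF h(1-3) D] ses_le_iff[OF c, of "x \<odot> h"] h(2) D x cs by simp
  qed (use x cs in simp)
  then show ?thesis using ses_le_iff[OF c, of x] x cs by simp
qed

text \<open>Sieves embed the subobjects of an object into the power set of a small set of arrows, which
  makes chains of subobjects small.\<close>

definition sieve where
  "sieve G m = {h \<in> Hom C G (Cod C m). h \<preceq> m}"

lemma le_iff_sieve_subset: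
  assumes G: "generating_set C {G}" and m: "is_mono C m" and n: "is_mono C n" "Cod C n = Cod C m"
  shows "m \<preceq> n \<longleftrightarrow> sieve G m \<subseteq> sieve G n"
proof
  assume "m \<preceq> n"
  then show "sieve G m \<subseteq> sieve G n" using n le_trans[of _ m n] by (auto simp: sieve_def)
next
  assume s: "sieve G m \<subseteq> sieve G n"
  show "m \<preceq> n"
  proof (rule le_generating[OF G n(1)])
    fix G' h assume h: "G' \<in> {G}" "h \<in> Arr C" "Dom C h = G'" "Cod C h = Dom C m"
    have "m \<odot> h \<in> sieve G m" using h m by (simp add: sieve_def)
    then show "m \<odot> h \<preceq> n" using s by (auto simp: sieve_def)
  qed (use m n in simp_all)
qed

text \<open>Induced by the identity on the summand \<open>j\<close> and by zero on all
  others.\<close>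

lemma coproduct_projection:
  assumes S: "is_coproduct C I F S \<iota>" and j: "j \<in> I"
  obtains \<pi> where "\<pi> \<in> Arr C" "Dom C \<pi> = S" "Cod C \<pi> = F j" "\<pi> \<odot> \<iota> j = Ident C (F j)"
    "\<And>i. i \<in> I \<Longrightarrow> i \<noteq> j \<Longrightarrow> null (\<pi> \<odot> \<iota> i)"
proof -
  note s = coproduct_simps[OF S]
  have FO: "F i \<in> Obj C" if "i \<in> I" for i using s(2,3)[OF that] Dom_Cod_obj(1) by metis
  define g where "g i = (if i = j then Ident C (F j) else Zero C (F i) (F j))" for i
  have g: "g i \<in> Arr C" "Dom C (g i) = F i" "Cod C (g i) = F j" if "i \<in> I" for i
    using FO[OF that] FO[OF j] by (simp_all add: g_def)
  obtain h where h: "h \<in> Arr C" "Dom C h = S" "Cod C h = F j" "\<And>i. i \<in> I \<Longrightarrow> h \<odot> \<iota> i = g i"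
    using coproduct_desc[OF S FO[OF j] g] by blast
  have "h \<odot> \<iota> j = Ident C (F j)" using h(4)[OF j] by (simp add: g_def)
  moreover have "null (h \<odot> \<iota> i)" if "i \<in> I" "i \<noteq> j" for i
    unfolding h(4)[OF that(1)] using that FO j by (simp add: g_def)
  ultimately show ?thesis using that h(1-3) by blast
qed

text \<open>The subobject is the kernel of the endomorphism \<open>q\<close> that is zero on the
  summands in \<open>A\<close> and the identity on the others. An arrow \<open>t\<close> killing the
  summands in \<open>A\<close> satisfies \<open>t \<odot> q = t\<close>, which links this kernel to
  \<open>supported\<close>.\<close>

lemma support_subobject:
  assumes S: "is_coproduct C I F S \<iota>" and A: "A \<subseteq> I"
  obtains l where "is_mono C l" "Cod C l = S"
    "\<And>x. x \<in> Arr C \<Longrightarrow> Cod C x = S \<Longrightarrow> x \<preceq> l \<longleftrightarrow> supported S \<iota> A x"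
proof -
  note s = coproduct_simps[OF S]
  have FO: "F i \<in> Obj C" if "i \<in> I" for i using s(2,3)[OF that] Dom_Cod_obj(1) by metis
  define g where "g i = (if i \<in> A then Zero C (F i) S else \<iota> i)" for i
  have g: "g i \<in> Arr C" "Dom C (g i) = F i" "Cod C (g i) = S" if "i \<in> I" for i
    using FO[OF that] s(1) s(2-4)[OF that] by (simp_all add: g_def)
  obtain q where q: "q \<in> Arr C" "Dom C q = S" "Cod C q = S"
    "\<And>i. i \<in> I \<Longrightarrow> q \<odot> \<iota> i = g i"
    using coproduct_desc[OF S s(1) g] by blast
  obtain l where l: "is_mono C l" "Cod C l = Dom C q"
    "\<And>x. x \<in> Arr C \<Longrightarrow> Cod C x = Dom C q \<Longrightarrow> x \<preceq> l \<longleftrightarrow> null (q \<odot> x)"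
    using kernelE[OF q(1)] by blast
  have "null (q \<odot> x) \<longleftrightarrow> supported S \<iota> A x" if x: "x \<in> Arr C" "Cod C x = S" for x
  proof
    assume n: "null (q \<odot> x)"
    show "supported S \<iota> A x" unfolding supported_def
    proof (intro allI impI)
      fix t assume t: "t \<in> Arr C" "Dom C t = S" "\<forall>i\<in>A. null (t \<odot> \<iota> i)"
      have "t \<odot> q = t"
      proof (rule coproduct_eqI[OF S])
        fix i assume i: "i \<in> I"
        have "t \<odot> g i = t \<odot> \<iota> i"
        proof (cases "i \<in> A")
          case True
          then have "t \<odot> \<iota> i = Zero C (F i) (Cod C t)"
            using t s(2-4)[OF i] by (intro null_eq) simp_all
          then show ?thesis using True t s FO i by (simp add: g_def)
        qed (simp add: g_def)
        then show "t \<odot> q \<odot> \<iota> i = t \<odot> \<iota> i" using q(1-3) q(4)[OF i] t(1,2) s(2-4)[OF i] by simp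
      qed (use t q in simp_all)
      then have "t \<odot> x = t \<odot> (q \<odot> x)" using comp_subst[of t q t x] t(1,2) q(1-3) x by simp
      then show "null (t \<odot> x)" using n null_comp1[OF n, of t] t(1,2) q(1-3) x by simp
    qed
  next
    assume n: "supported S \<iota> A x"
    show "null (q \<odot> x)"
    proof (rule supportedD[OF n q(1,2)])
      fix i assume "i \<in> A"
      then show "null (q \<odot> \<iota> i)" using q(4)[of i] A s(1) FO by (auto simp: g_def)
    qed
  qed
  then show ?thesis using that l q(2) by simp
qed

text \<open>The test arrow \<open>t\<close> is replaced by its difference with
  \<open>t \<odot> (\<iota> j \<odot> \<pi>)\<close>. This kills the summand \<open>j\<close> as
  well, and it agrees with \<open>t\<close> on \<open>x\<close> because the coordinate
  \<open>\<pi> \<odot> x\<close> is null.\<close>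

lemma supported_remove:
  assumes S: "is_coproduct C I F S \<iota>" and j: "j \<in> I"
    and \<pi>: "\<pi> \<in> Arr C" "Dom C \<pi> = S" "Cod C \<pi> = F j" "\<pi> \<odot> \<iota> j = Ident C (F j)"
      "\<And>i. i \<in> I \<Longrightarrow> i \<noteq> j \<Longrightarrow> null (\<pi> \<odot> \<iota> i)"
    and x: "x \<in> Arr C" "Cod C x = S" "supported S \<iota> (insert j A) x" "A \<subseteq> I" "null (\<pi> \<odot> x)"
  shows "supported S \<iota> A x"
  unfolding supported_def
proof (intro allI impI)
  note s = coproduct_simps[OF S]
  note ij = s(2-4)[OF j]
  fix t assume t: "t \<in> Arr C" "Dom C t = S" "\<forall>i\<in>A. null (t \<odot> \<iota> i)"
  let ?u = "t \<odot> (\<iota> j \<odot> \<pi>)"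
  have u: "?u \<in> Arr C" "Dom C ?u = S" "Cod C ?u = Cod C t" using t \<pi>(1-3) ij by simp_all
  have "null ((t \<ominus> ?u) \<odot> x)"
  proof (rule supportedD[OF x(3)])
    fix i assume i: "i \<in> insert j A"
    then have iI: "i \<in> I" using j x(4) by blast
    note ii = s(2-4)[OF iI]
    have eq: "(t \<ominus> ?u) \<odot> \<iota> i = t \<odot> \<iota> i \<ominus> t \<odot> (\<iota> j \<odot> (\<pi> \<odot> \<iota> i))"
      using t u ii \<pi>(1-3) ij by (subst sub_comp) simp_all
    show "null ((t \<ominus> ?u) \<odot> \<iota> i)"
    proof (cases "i = j")
      case True
      then show ?thesis unfolding eq using t u ii \<pi>(4) ij by simp
    next
      case False
      then have n1: "null (t \<odot> \<iota> i)" using i t by blast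
      have "null (t \<odot> \<iota> j \<odot> (\<pi> \<odot> \<iota> i))"
        using \<pi>(5)[OF iI False] t ii \<pi>(1-3) ij by (rule_tac null_comp1) simp_all
      then have n2: "null (t \<odot> (\<iota> j \<odot> (\<pi> \<odot> \<iota> i)))" using t ii \<pi>(1-3) ij by simp
      show ?thesis unfolding eq using n1 n2 null_unique[OF n1 n2] t ii \<pi>(1-3) ij by simp
    qed
  qed (use t u in simp_all)
  then have "t \<odot> x = t \<odot> (\<iota> j \<odot> (\<pi> \<odot> x))" using t u x(1,2) \<pi>(1-3) ij by (simp add: sub_comp)
  moreover have "null (t \<odot> \<iota> j \<odot> (\<pi> \<odot> x))"
    using x(1,2,5) t \<pi>(1-3) ij by (rule_tac null_comp1) simp_all
  ultimately show "null (t \<odot> x)" using t x(1,2) \<pi>(1-3) ij by simp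
qed

lemma supported_empty:
  assumes "supported S \<iota> {} x" "S \<in> Obj C" "x \<in> Arr C" "Cod C x = S"
  shows "null x"
proof -
  have "null (Ident C S \<odot> x)" by (rule supportedD[OF assms(1)]) (use assms(2) in auto)
  then show ?thesis using assms by simp
qed

lemma supported_null:
  assumes S: "is_coproduct C I F S \<iota>" and A: "finite A" "A \<subseteq> I" and x: "x \<in> Arr C" "Cod C x = S"
    and \<pi>: "\<And>j. j \<in> I \<Longrightarrow> \<pi> j \<in> Arr C" "\<And>j. j \<in> I \<Longrightarrow> Dom C (\<pi> j) = S" "\<And>j. j \<in> I \<Longrightarrow> Cod C (\<pi> j) = F j"
      "\<And>j. j \<in> I \<Longrightarrow> \<pi> j \<odot> \<iota> j = Ident C (F j)"
      "\<And>i j. i \<in> I \<Longrightarrow> j \<in> I \<Longrightarrow> i \<noteq> j \<Longrightarrow> null (\<pi> j \<odot> \<iota> i)"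
    and sup: "supported S \<iota> A x" and n: "\<And>j. j \<in> I \<Longrightarrow> null (\<pi> j \<odot> x)"
  shows "null x"
  using A sup
proof (induction A)
  case empty
  then show ?case using supported_empty x coproduct_simps(1)[OF S] by blast
next
  case (insert j A)
  then have j: "j \<in> I" "A \<subseteq> I" by simp_all
  have "supported S \<iota> A x"
    by (rule supported_remove[OF S j(1) \<pi>(1-4)[OF j(1)] \<pi>(5)[OF _ j(1)] x insert.prems(2) j(2) n[OF j(1)]])
  then show ?case using insert.IH j by blast
qed

end

context grothendieck_category
begin

text \<open>The subobjects supported on finite subsets of \<open>I\<close> are directed and contain
  every \<open>\<iota> i\<close>, so they cover \<open>S\<close>; \<open>directed_cover\<close> then
  permits checking nullity on finitely supported elements.\<close>

lemma coproduct_finite_support: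
  fixes \<iota> :: "'x \<Rightarrow> 'm"
  assumes I: "is_small small I" and S: "is_coproduct C I F S \<iota>"
    and f: "f \<in> Arr C" "Cod C f = S" and g: "g \<in> Arr C" "Dom C g = Dom C f"
    and loc: "\<And>A x. finite A \<Longrightarrow> A \<subseteq> I \<Longrightarrow> x \<in> Arr C \<Longrightarrow> Cod C x = Dom C f \<Longrightarrow>
      supported S \<iota> A (f \<odot> x) \<Longrightarrow> null (g \<odot> x)"
  shows "null g"
proof -
  note s = coproduct_simps[OF S]
  let ?J = "{A. finite A \<and> A \<subseteq> I}"
  have "\<forall>A\<in>?J. \<exists>l. is_mono C l \<and> Cod C l = S \<and> (\<forall>x\<in>Arr C. Cod C x = S \<longrightarrow> (x \<preceq> l \<longleftrightarrow> supported S \<iota> A x))"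
  proof
    fix A assume "A \<in> ?J"
    then obtain l where "is_mono C l" "Cod C l = S"
      "\<And>x. x \<in> Arr C \<Longrightarrow> Cod C x = S \<Longrightarrow> x \<preceq> l \<longleftrightarrow> supported S \<iota> A x"
      using support_subobject[OF S, of A] by blast
    then show "\<exists>l. is_mono C l \<and> Cod C l = S \<and> (\<forall>x\<in>Arr C. Cod C x = S \<longrightarrow> (x \<preceq> l \<longleftrightarrow> supported S \<iota> A x))"
      by blast
  qed
  from bchoice[OF this] obtain l where l: "\<And>A. A \<in> ?J \<Longrightarrow> is_mono C (l A)" "\<And>A. A \<in> ?J \<Longrightarrow> Cod C (l A) = S"
    "\<And>A x. A \<in> ?J \<Longrightarrow> x \<in> Arr C \<Longrightarrow> Cod C x = S \<Longrightarrow> x \<preceq> l A \<longleftrightarrow> supported S \<iota> A x"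
    by blast
  have mon: "l A \<preceq> l B" if "A \<in> ?J" "B \<in> ?J" "A \<subseteq> B" for A B
  proof -
    have a: "l A \<in> Arr C" "Cod C (l A) = S" using l(1,2)[OF that(1)] by simp_all
    have "supported S \<iota> A (l A)" using l(3)[OF that(1) a] a by simp
    then have "supported S \<iota> B (l A)" using that(3) unfolding supported_def by blast
    then show ?thesis using l(3)[OF that(2) a] by simp
  qed
  show ?thesis
  proof (rule directed_cover[of ?J l S f g])
    show "is_small small ?J" by (rule is_small_subset[OF is_small_Pow[OF I]]) blast
    show "?J \<noteq> {}" by blast
    show "\<exists>D\<in>?J. l A \<preceq> l D \<and> l B \<preceq> l D" if "A \<in> ?J" "B \<in> ?J" for A B
      by (rule bexI[of _ "A \<union> B"]) (use mon[of A "A \<union> B"] mon[of B "A \<union> B"] that in auto)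
    show "null t" if t: "t \<in> Arr C" "Dom C t = S" "\<And>A. A \<in> ?J \<Longrightarrow> null (t \<odot> l A)" for t
    proof (rule coproduct_null[OF S t(1,2)])
      fix i assume i: "i \<in> I"
      then have J: "{i} \<in> ?J" by simp
      have "supported S \<iota> {i} (\<iota> i)" unfolding supported_def by simp
      then have "\<iota> i \<preceq> l {i}" using l(3)[OF J] s(2-4)[OF i] by simp
      then obtain h where h: "h \<in> Arr C" "Cod C h = Dom C (l {i})" "l {i} \<odot> h = \<iota> i"
        by (rule leE)
      have "null (t \<odot> l {i} \<odot> h)"
        using t(1,2) t(3)[OF J] h(1,2) l(1,2)[OF J] by (rule_tac null_comp2) simp_all
      then show "null (t \<odot> \<iota> i)" using h t(1,2) l(1,2)[OF J] by simp
    qed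
    show "null (g \<odot> x)" if "A \<in> ?J" "x \<in> Arr C" "Cod C x = Dom C f" "f \<odot> x \<preceq> l A" for A x
      by (rule loc[of A]) (use l(3)[OF that(1), of "f \<odot> x"] that f in simp_all)
  qed (use l f g in auto)
qed

text \<open>The join is the image of the coproduct of the subobjects. That the \<open>h i\<close>
  are jointly epimorphic expresses that it is no larger than necessary.\<close>

lemma joinE:
  fixes l :: "'x \<Rightarrow> 'm"
  assumes I: "is_small small I" and l: "\<And>i. i \<in> I \<Longrightarrow> l i \<in> Arr C" "\<And>i. i \<in> I \<Longrightarrow> Cod C (l i) = S"
    and S: "S \<in> Obj C"
  obtains m h where "is_mono C m" "Cod C m = S" "\<And>i. i \<in> I \<Longrightarrow> h i \<in> Arr C"
    "\<And>i. i \<in> I \<Longrightarrow> Dom C (h i) = Dom C (l i)" "\<And>i. i \<in> I \<Longrightarrow> Cod C (h i) = Dom C m"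
    "\<And>i. i \<in> I \<Longrightarrow> m \<odot> h i = l i"
    "\<And>t. t \<in> Arr C \<Longrightarrow> Dom C t = Dom C m \<Longrightarrow> (\<And>i. i \<in> I \<Longrightarrow> null (t \<odot> h i)) \<Longrightarrow> null t"
proof -
  have "(\<lambda>i. Dom C (l i)) ` I \<subseteq> Obj C" using l by auto
  then obtain T \<iota> where T: "is_coproduct C I (\<lambda>i. Dom C (l i)) T \<iota>"
    using coproduct_exists[OF I] by blast
  note s = coproduct_simps[OF T]
  obtain f where f: "f \<in> Arr C" "Dom C f = T" "Cod C f = S" "\<And>i. i \<in> I \<Longrightarrow> f \<odot> \<iota> i = l i"
    using coproduct_desc[OF T S, of l] l by metis
  obtain e m where e: "is_epi C e" "is_mono C m" "Cod C e = Dom C m" "Dom C e = Dom C f"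
    "Cod C m = Cod C f" "m \<odot> e = f"
    using image_factorization[OF f(1)] by blast
  have A: "e \<in> Arr C" "m \<in> Arr C" using e by simp_all
  show ?thesis
  proof (rule that[of m "\<lambda>i. e \<odot> \<iota> i"])
    show "m \<odot> (e \<odot> \<iota> i) = l i" if "i \<in> I" for i
      using comp_subst[OF e(6), of "\<iota> i"] f(1-3) f(4)[OF that] e A s(2-4)[OF that] by simp
    show "null t" if t: "t \<in> Arr C" "Dom C t = Dom C m" "\<And>i. i \<in> I \<Longrightarrow> null (t \<odot> (e \<odot> \<iota> i))" for t
    proof -
      have "null (t \<odot> e)"
      proof (rule coproduct_null[OF T])
        show "null (t \<odot> e \<odot> \<iota> i)" if "i \<in> I" for i
          using t(1,2) t(3)[OF that] e(3,4) A f(2) s(2-4)[OF that] by simp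
      qed (use t e A f in simp_all)
      then show ?thesis using epi_null[OF e(1), of t] t(1,2) e(3) by simp
    qed
  qed (use e A f(1-3) s in simp_all)
qed

text \<open>Zorn's lemma runs over sieves because arrows representing subobjects are only
  preordered. The join of a nonempty chain is again disjoint from \<open>n\<close>: pulled back to
  an element of the join, the chain still covers, and on each member the element is null.\<close>

lemma maximal_disj:
  assumes n: "n \<in> Arr C" "Cod C n = S" and l0: "is_mono C l0" "Cod C l0 = S" "disj l0 n"
  obtains l where "is_mono C l" "Cod C l = S" "l0 \<preceq> l" "disj l n"
    "\<And>l'. is_mono C l' \<Longrightarrow> Cod C l' = S \<Longrightarrow> l \<preceq> l' \<Longrightarrow> disj l' n \<Longrightarrow> l' \<preceq> l"
proof -
  obtain G where G: "generating_set C {G}" using ex_generator by blast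
  then have GO: "G \<in> Obj C" by (simp add: generating_set_def)
  have SO: "S \<in> Obj C" using n by auto
  define P where "P l \<longleftrightarrow> is_mono C l \<and> Cod C l = S \<and> l0 \<preceq> l \<and> disj l n" for l
  have P: "is_mono C l" "Cod C l = S" "l0 \<preceq> l" "disj l n" "l \<in> Arr C" if "P l" for l
    using that by (auto simp: P_def)
  have "\<exists>M\<in>sieve G ` Collect P. \<forall>X\<in>sieve G ` Collect P. M \<subseteq> X \<longrightarrow> X = M"
  proof (rule subset_Zorn)
    fix \<C> assume c: "subset.chain (sieve G ` Collect P) \<C>"
    show "\<exists>U\<in>sieve G ` Collect P. \<forall>X\<in>\<C>. X \<subseteq> U"
    proof (cases "\<C> = {}")
      case True
      have "P l0" using l0 by (simp add: P_def)
      then show ?thesis using True by blast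
    next
      case False
      have "\<forall>X\<in>\<C>. \<exists>l. P l \<and> sieve G l = X" using c by (auto simp: subset_chain_def)
      then obtain l where l: "\<And>X. X \<in> \<C> \<Longrightarrow> P (l X)" "\<And>X. X \<in> \<C> \<Longrightarrow> sieve G (l X) = X" by metis
      \<comment> \<open>Sieves are subsets of the small set \<open>Hom C G S\<close>, so any chain
        of them is small and has a join.\<close>
      have sm: "is_small small \<C>"
      proof (rule is_small_subset[OF is_small_Pow[OF small_Hom[OF GO SO]]])
        have "sieve G (l X) \<subseteq> Hom C G S" if "X \<in> \<C>" for X
          using P(2)[OF l(1)[OF that]] by (auto simp: sieve_def)
        then show "\<C> \<subseteq> Pow (Hom C G S)" using l(2) by blast
      qed
      obtain m h where m: "is_mono C m" "Cod C m = S" and h: "\<And>X. X \<in> \<C> \<Longrightarrow> h X \<in> Arr C"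
          "\<And>X. X \<in> \<C> \<Longrightarrow> Dom C (h X) = Dom C (l X)" "\<And>X. X \<in> \<C> \<Longrightarrow> Cod C (h X) = Dom C m"
          "\<And>X. X \<in> \<C> \<Longrightarrow> m \<odot> h X = l X"
        and cov: "\<And>t. t \<in> Arr C \<Longrightarrow> Dom C t = Dom C m \<Longrightarrow> (\<And>X. X \<in> \<C> \<Longrightarrow> null (t \<odot> h X)) \<Longrightarrow> null t"
        by (rule joinE[OF sm, of l S]) (use P(2,5)[OF l(1)] SO in blast)+
      have mA: "m \<in> Arr C" using m by simp
      have lm: "l X \<preceq> m" if "X \<in> \<C>" for X using leI[OF h(1) mA h(3) h(4)] that by blast
      have hm: "is_mono C (h X)" if "X \<in> \<C>" for X
        by (rule mono_factor[of m]) (use P(1)[OF l(1)[OF that]] h(1,3,4)[OF that] mA in simp_all)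
      have "disj m n" unfolding disj_def
      proof (intro allI impI)
        fix x assume x: "x \<preceq> m" "x \<preceq> n"
        obtain z where z: "z \<in> Arr C" "Dom C z = Dom C x" "Cod C z = Dom C m" "m \<odot> z = x"
          using x(1) by (rule leE)
        have xA: "x \<in> Arr C" using le_Arr[OF x(1) mA] .
        \<comment> \<open>The covering family consists of the inclusions \<open>h X\<close> into the
          join, and \<open>z\<close> is tested against itself: a part of \<open>z\<close> in
          \<open>h X\<close> gives a common element of \<open>l X\<close> and
          \<open>n\<close>.\<close>
        have "null z"
        proof (rule directed_cover[OF sm False hm h(3) _ cov z(1,3,1) refl])
          fix X Y assume XY: "X \<in> \<C>" "Y \<in> \<C>"
          then consider "X \<subseteq> Y" | "Y \<subseteq> X" using c by (auto simp: subset_chain_def)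
          then have "\<exists>Z\<in>\<C>. X \<subseteq> Z \<and> Y \<subseteq> Z" using XY by cases auto
          then obtain Z where Z: "Z \<in> \<C>" "X \<subseteq> Z" "Y \<subseteq> Z" by blast
          have *: "h W \<preceq> h Z" if W: "W \<in> \<C>" "W \<subseteq> Z" for W
          proof -
            have "l W \<preceq> l Z"
              using le_iff_sieve_subset[OF G P(1)[OF l(1)[OF W(1)]] P(1)[OF l(1)[OF Z(1)]]]
                P(2)[OF l(1)[OF W(1)]] P(2)[OF l(1)[OF Z(1)]] l(2)[OF W(1)] l(2)[OF Z(1)] W(2) by simp
            then obtain v where v: "v \<in> Arr C" "Dom C v = Dom C (l W)" "Cod C v = Dom C (l Z)" "l Z \<odot> v = l W"
              by (rule leE)
            have "h Z \<odot> v = h W"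
              by (rule mono_cancel[OF m(1)])
                (use v h(1-3)[OF W(1)] h(1-3)[OF Z(1)] h(4)[OF W(1)] mA comp_subst[OF h(4)[OF Z(1)], of v] in simp_all)
            then show ?thesis by (intro leI[of v]) (use v h[OF Z(1)] in simp_all)
          qed
          show "\<exists>Z\<in>\<C>. h X \<preceq> h Z \<and> h Y \<preceq> h Z" using * XY Z by blast
        next
          fix X w assume X: "X \<in> \<C>" and w: "w \<in> Arr C" "Cod C w = Dom C z" "z \<odot> w \<preceq> h X"
          have "m \<odot> (z \<odot> w) \<preceq> m \<odot> h X" by (rule comp_le[OF w(3)]) (use h[OF X] mA in simp_all)
          then have "x \<odot> w \<preceq> l X" using comp_subst[OF z(4), of w] w z mA h(4)[OF X] by simp
          moreover have "x \<odot> w \<preceq> n" using le_comp[OF x(2)] w z n by simp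
          ultimately have "null (x \<odot> w)" using disjD P(4)[OF l(1)[OF X]] by blast
          then have "null (m \<odot> (z \<odot> w))" using comp_subst[OF z(4), of w] w z mA by simp
          then show "null (z \<odot> w)" using mono_null[OF m(1), of "z \<odot> w"] w z by simp
        qed
        then show "null x" using null_comp1[of z m] z mA by simp
      qed
      moreover have "l0 \<preceq> m"
      proof -
        obtain X where X: "X \<in> \<C>" using False by blast
        show ?thesis using le_trans[OF P(3)[OF l(1)[OF X]] lm[OF X] mA] .
      qed
      ultimately have "P m" using m by (simp add: P_def)
      moreover have "X \<subseteq> sieve G m" if "X \<in> \<C>" for X
        using le_iff_sieve_subset[OF G P(1)[OF l(1)[OF that]] m(1)] P(2)[OF l(1)[OF that]] m(2)
          lm[OF that] l(2)[OF that] by simp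
      ultimately show ?thesis by blast
    qed
  qed
  then obtain M where M: "M \<in> sieve G ` Collect P" "\<And>X. X \<in> sieve G ` Collect P \<Longrightarrow> M \<subseteq> X \<Longrightarrow> X = M"
    by meson
  obtain l0' where l0': "P l0'" "M = sieve G l0'" using M(1) by blast
  then obtain l where l: "P l" "\<And>l'. P l' \<Longrightarrow> sieve G l \<subseteq> sieve G l' \<Longrightarrow> sieve G l' = sieve G l"
    using M(2)[OF imageI[OF CollectI]] by metis
  show ?thesis
  proof (rule that[of l])
    fix l' assume l': "is_mono C l'" "Cod C l' = S" "l \<preceq> l'" "disj l' n"
    then have "P l'" using le_trans[OF P(3)[OF l(1)] l'(3)] by (simp add: P_def)
    moreover have "sieve G l \<subseteq> sieve G l'" and "l' \<preceq> l \<longleftrightarrow> sieve G l' \<subseteq> sieve G l"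
      using le_iff_sieve_subset[OF G P(1)[OF l(1)] l'(1)] le_iff_sieve_subset[OF G l'(1) P(1)[OF l(1)]]
        P(2)[OF l(1)] l'(2,3) by simp_all
    ultimately show "l' \<preceq> l" using l(2) by blast
  qed (use P[OF l(1)] in blast)+
qed

end

context abelian_category
begin

section \<open>Noetherian objects\<close>

lemma noetherian_Obj: "noetherian C M \<Longrightarrow> M \<in> Obj C"
  by (simp add: noetherian_def)

lemma noetherian_chain:
  assumes "noetherian C M" "\<And>n. is_mono C (s n)" "\<And>n. Cod C (s n) = M" "\<And>n. s n \<preceq> s (Suc n)"
  obtains n where "\<And>k. k \<ge> n \<Longrightarrow> s k \<preceq> s n"
  using assms unfolding noetherian_def by blast

lemma noetherian_maximal:
  assumes M: "noetherian C M" and P: "\<And>m. P m \<Longrightarrow> is_mono C m" "\<And>m. P m \<Longrightarrow> Cod C m = M" and m0: "P m0"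
  obtains m where "P m" "\<And>m'. P m' \<Longrightarrow> m \<preceq> m' \<Longrightarrow> m' \<preceq> m"
proof (rule ccontr)
  assume "\<not> thesis"
  then have "\<And>m. P m \<Longrightarrow> \<exists>m'. P m' \<and> m \<preceq> m' \<and> \<not> m' \<preceq> m" using that by blast
  then obtain s where s: "\<And>n::nat. P (s n)" "\<And>n. s n \<preceq> s (Suc n) \<and> \<not> s (Suc n) \<preceq> s n"
    using dependent_nat_choice[of "\<lambda>_. P" "\<lambda>_ m m'. m \<preceq> m' \<and> \<not> m' \<preceq> m"] m0 by metis
  obtain n where "\<And>k. k \<ge> n \<Longrightarrow> s k \<preceq> s n"
    using noetherian_chain[OF M, of s] P s by blast
  then show False using s(2)[of n] by simp
qed

lemma noetherian_mono:
  assumes j: "is_mono C j" "noetherian C (Cod C j)"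
  shows "noetherian C (Dom C j)"
  unfolding noetherian_def
proof (intro conjI allI impI)
  have jA: "j \<in> Arr C" using j by simp
  then show "Dom C j \<in> Obj C" by simp
  fix s :: "nat \<Rightarrow> 'b"
  assume s: "\<forall>n. is_mono C (s n) \<and> Cod C (s n) = Dom C j \<and> s n \<preceq> s (Suc n)"
  then have sA: "s n \<in> Arr C" for n by simp
  obtain n where n: "\<And>k. k \<ge> n \<Longrightarrow> j \<odot> s k \<preceq> j \<odot> s n"
  proof (rule noetherian_chain[OF j(2), of "\<lambda>n. j \<odot> s n"])
    show "is_mono C (j \<odot> s n)" for n using s j by (intro mono_comp) simp_all
    show "Cod C (j \<odot> s n) = Cod C j" for n using s jA sA by simp
    show "j \<odot> s n \<preceq> j \<odot> s (Suc n)" for n using s jA sA by (intro comp_le) simp_all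
  qed blast
  have "s k \<preceq> s n" if k: "k \<ge> n" for k
  proof -
    obtain h where h: "h \<in> Arr C" "Dom C h = Dom C (j \<odot> s k)" "Cod C h = Dom C (j \<odot> s n)" "(j \<odot> s n) \<odot> h = j \<odot> s k"
      using n[OF k] by (rule leE)
    have "s n \<odot> h = s k"
      by (rule mono_cancel[OF j(1)]) (use h s sA jA in simp_all)
    then show ?thesis using h s sA jA by (intro leI[of h]) simp_all
  qed
  then show "\<exists>n. \<forall>k\<ge>n. s k \<preceq> s n" by blast
qed

text \<open>A chain in the quotient is recovered from its preimages, since every element of the
  quotient lifts on a cover.\<close>

lemma noetherian_epi:
  assumes q: "is_epi C q" "noetherian C (Dom C q)"
  shows "noetherian C (Cod C q)"
  unfolding noetherian_def
proof (intro conjI allI impI)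
  have qA: "q \<in> Arr C" using q by simp
  then show "Cod C q \<in> Obj C" by simp
  fix s :: "nat \<Rightarrow> 'b"
  assume s: "\<forall>n. is_mono C (s n) \<and> Cod C (s n) = Cod C q \<and> s n \<preceq> s (Suc n)"
  then have sA: "s n \<in> Arr C" for n by simp
  have "\<exists>k. is_mono C k \<and> Cod C k = Dom C q \<and>
      (\<forall>x\<in>Arr C. Cod C x = Dom C q \<longrightarrow> (x \<preceq> k \<longleftrightarrow> q \<odot> x \<preceq> s n))" for n
    using preimageE[of "s n" q] s qA by metis
  then obtain k where k: "\<And>n. is_mono C (k n)" "\<And>n. Cod C (k n) = Dom C q"
    "\<And>n x. x \<in> Arr C \<Longrightarrow> Cod C x = Dom C q \<Longrightarrow> x \<preceq> k n \<longleftrightarrow> q \<odot> x \<preceq> s n"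
    by metis
  have kA: "k n \<in> Arr C" for n using k(1)[of n] by simp
  have kk: "k n \<preceq> k m" if "s n \<preceq> s m" for n m
    using k(3)[OF kA k(2), of n n] k(3)[OF kA k(2), of n m] le_trans[OF _ that sA] kA by simp
  obtain n where n: "\<And>m. m \<ge> n \<Longrightarrow> k m \<preceq> k n"
    using noetherian_chain[OF q(2), of k] k(1,2) kk s by blast
  have "s m \<preceq> s n" if m: "m \<ge> n" for m
  proof -
    have smC: "Cod C (s m) = Cod C q" using s by simp
    obtain e h where e: "is_epi C e" "Cod C e = Dom C (s m)" "h \<in> Arr C" "Dom C h = Dom C e"
      "Cod C h = Dom C q" "s m \<odot> e = q \<odot> h"
      using epi_cover[OF q(1) sA smC] by blast
    have eA: "e \<in> Arr C" using e by simp
    have "q \<odot> h \<preceq> s m" using e eA sA comp_le_self[of "s m" e] by simp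
    then have "h \<preceq> k m" using k(3)[of h m] e by simp
    then have "h \<preceq> k n" using le_trans[OF _ n[OF m] kA] by blast
    then have "s m \<odot> e \<preceq> s n" using k(3)[of h n] e by simp
    then show ?thesis using le_epi[of "s n" e "s m"] s e sA by simp
  qed
  then show "\<exists>n. \<forall>k\<ge>n. s k \<preceq> s n" by blast
qed

section \<open>Injective objects\<close>

lemma injectiveE:
  assumes "injective_object C I" "is_mono C m" "f \<in> Arr C" "Dom C f = Dom C m" "Cod C f = I"
  obtains g where "g \<in> Arr C" "Dom C g = Cod C m" "Cod C g = I" "g \<odot> m = f"
proof -
  have "f \<in> Hom C (Dom C m) I" using assms by simp
  then have "\<exists>g\<in>Hom C (Cod C m) I. g \<odot> m = f"
    using assms(1,2) unfolding injective_object_def by blast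
  then show ?thesis using that by auto
qed

lemma injectiveI:
  assumes "I \<in> Obj C" "\<And>m f. is_mono C m \<Longrightarrow> f \<in> Arr C \<Longrightarrow> Dom C f = Dom C m \<Longrightarrow> Cod C f = I \<Longrightarrow>
    \<exists>g\<in>Arr C. Dom C g = Cod C m \<and> Cod C g = I \<and> g \<odot> m = f"
  shows "injective_object C I"
  unfolding injective_object_def
proof (intro conjI allI impI ballI)
  fix m f assume "is_mono C m" "f \<in> Hom C (Dom C m) I"
  then obtain g where "g \<in> Arr C" "Dom C g = Cod C m" "Cod C g = I" "g \<odot> m = f"
    using assms(2)[of m f] by auto
  then show "\<exists>g\<in>Hom C (Cod C m) I. g \<odot> m = f" by auto
qed (rule assms(1))

lemma injective_Obj: "injective_object C I \<Longrightarrow> I \<in> Obj C"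
  by (simp add: injective_object_def)

lemma injective_summand:
  assumes B: "is_biproduct C N L I i1 i2 p1 p2" and I: "injective_object C I"
  shows "injective_object C N"
proof (rule injectiveI)
  note b = biproduct_simps[OF B]
  show "N \<in> Obj C" by (rule b)
  fix m f assume m: "is_mono C m" and f: "f \<in> Arr C" "Dom C f = Dom C m" "Cod C f = N"
  obtain g where g: "g \<in> Arr C" "Dom C g = Cod C m" "Cod C g = I" "g \<odot> m = i1 \<odot> f"
    using injectiveE[OF I m, of "i1 \<odot> f"] f b by auto
  have "p1 \<odot> g \<odot> m = f" using g m f b biproduct_elem(1)[OF B f(1)] by simp
  then show "\<exists>g\<in>Arr C. Dom C g = Cod C m \<and> Cod C g = N \<and> g \<odot> m = f"
    using g b by (intro bexI[of _ "p1 \<odot> g"]) simp_all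
qed

text \<open>An extension problem along \<open>m\<close> is pushed out along \<open>f\<close> to a
  monomorphism out of \<open>E\<close>; a retraction of the latter solves it.\<close>

lemma injective_if_split:
  assumes E: "E \<in> Obj C" and split: "\<And>m. is_mono C m \<Longrightarrow> Dom C m = E \<Longrightarrow>
    \<exists>r\<in>Arr C. Dom C r = Cod C m \<and> Cod C r = E \<and> r \<odot> m = Ident C E"
  shows "injective_object C E"
proof (rule injectiveI[OF E])
  fix m f assume m: "is_mono C m" and f: "f \<in> Arr C" "Dom C f = Dom C m" "Cod C f = E"
  obtain m' f' where p: "is_mono C m'" "Dom C m' = Cod C f" "f' \<in> Arr C" "Dom C f' = Cod C m"
    "Cod C f' = Cod C m'" "m' \<odot> f = f' \<odot> m"
    using pushout[OF m f(1,2)] by metis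
  obtain r where r: "r \<in> Arr C" "Dom C r = Cod C m'" "Cod C r = E" "r \<odot> m' = Ident C E"
    using split[OF p(1)] p f by metis
  have "r \<odot> f' \<odot> m = r \<odot> (m' \<odot> f)" using p r m by simp
  also have "\<dots> = f" using comp_subst[OF r(4), of f] r p f by simp
  finally show "\<exists>g\<in>Arr C. Dom C g = Cod C m \<and> Cod C g = E \<and> g \<odot> m = f"
    using r p by (intro bexI[of _ "r \<odot> f'"]) simp_all
qed

text \<open>The image of \<open>n\<close> is essential in the quotient by \<open>l\<close>. If the
  image of \<open>x\<close> met it trivially, the preimage of that image would contain
  \<open>l\<close> and still be disjoint from \<open>n\<close>; maximality would push it into
  \<open>l\<close>, making \<open>x\<close> null.\<close>

lemma maximal_disj_essential:
  assumes n: "is_mono C n" and l: "is_mono C l" "Cod C l = Cod C n" "disj l n"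
    and max: "\<And>l'. is_mono C l' \<Longrightarrow> Cod C l' = Cod C n \<Longrightarrow> l \<preceq> l' \<Longrightarrow> disj l' n \<Longrightarrow> l' \<preceq> l"
    and c: "short_exact C l c" and x: "x \<in> Arr C" "Cod C x = Cod C c" "\<not> null x"
  obtains y w where "y \<in> Arr C" "Cod C y = Dom C x" "w \<in> Arr C" "Cod C w = Dom C n" "Dom C w = Dom C y"
    "x \<odot> y = c \<odot> (n \<odot> w)" "\<not> null (x \<odot> y)"
proof (rule ccontr)
  assume a: "\<not> thesis"
  note cs = ses_simps[OF c]
  have nA: "n \<in> Arr C" using n by simp
  obtain e m where e: "is_epi C e" "is_mono C m" "Cod C e = Dom C m" "Dom C e = Dom C x"
    "Cod C m = Cod C x" "m \<odot> e = x"
    using image_factorization[OF x(1)] by blast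
  have eA: "e \<in> Arr C" "m \<in> Arr C" using e by simp_all
  obtain l' where l': "is_mono C l'" "Cod C l' = Dom C c"
    "\<And>z. z \<in> Arr C \<Longrightarrow> Cod C z = Dom C c \<Longrightarrow> z \<preceq> l' \<longleftrightarrow> c \<odot> z \<preceq> m"
    using preimageE[OF e(2) cs(2)] e x by metis
  have l'A: "l' \<in> Arr C" using l' by simp
  have "disj l' n" unfolding disj_def
  proof (intro allI impI)
    fix z assume z: "z \<preceq> l'" "z \<preceq> n"
    have zA: "z \<in> Arr C" "Cod C z = Dom C c" using le_Arr[OF z(1) l'A] le_Cod[OF z(1) l'A] l' by simp_all
    obtain v where v: "v \<in> Arr C" "Dom C v = Dom C z" "Cod C v = Dom C n" "n \<odot> v = z"
      using z(2) by (rule leE)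
    have "c \<odot> z \<preceq> m" using l'(3) zA z by blast
    then obtain t where t: "t \<in> Arr C" "Dom C t = Dom C (c \<odot> z)" "Cod C t = Dom C m" "m \<odot> t = c \<odot> z"
      by (rule leE)
    \<comment> \<open>An element \<open>z\<close> in both \<open>l'\<close> and \<open>n\<close> has
      an image in the quotient that, after this cover, comes from both \<open>x\<close> and
      \<open>n\<close>; by assumption such an image is null, so \<open>z\<close> lies in
      \<open>l\<close>.\<close>
    obtain e' h' where e': "is_epi C e'" "Cod C e' = Dom C t" "h' \<in> Arr C" "Dom C h' = Dom C e'"
      "Cod C h' = Dom C e" "t \<odot> e' = e \<odot> h'"
      using epi_cover[OF e(1), of t] t e by metis
    have e'A: "e' \<in> Arr C" using e' by simp
    have tD: "Dom C t = Dom C z" using t(2) zA cs by simp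
    have eq: "c \<odot> (z \<odot> e') = x \<odot> h'"
    proof -
      have "c \<odot> (z \<odot> e') = m \<odot> (t \<odot> e')" using comp_subst[OF t(4), of e'] t(1,3) tD e' e'A eA zA cs by simp
      also have "\<dots> = x \<odot> h'" using comp_subst[OF e(6), of h'] e' eA e(3) by simp
      finally show ?thesis .
    qed
    have "z \<odot> e' = n \<odot> (v \<odot> e')" using comp_subst[OF v(4), of e'] v e' e'A tD nA by simp
    then have "x \<odot> h' = c \<odot> (n \<odot> (v \<odot> e'))" using eq by simp
    then have "null (x \<odot> h')" using a that[of h' "v \<odot> e'"] v e' e'A tD e by auto
    then have "null ((c \<odot> z) \<odot> e')" using eq zA cs e' e'A tD by simp
    then have "null (c \<odot> z)" using epi_null[OF e'(1), of "c \<odot> z"] zA cs e' tD by simp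
    then have "z \<preceq> l" using ses_le_iff[OF c, of z] zA by simp
    then show "null z" using disjD[OF l(3)] z by blast
  qed
  moreover have "l \<preceq> l'" using l'(3)[of l] cs le_null[OF e(2), of "c \<odot> l"] e x by simp
  moreover have "Cod C l' = Cod C n" using l' cs l by simp
  ultimately have l'l: "l' \<preceq> l" using max l' by blast
  \<comment> \<open>Now \<open>l'\<close> lies in \<open>l\<close>, so any lift of \<open>x\<close>
    to \<open>Dom C c\<close> is killed by \<open>c\<close>.\<close>
  obtain e' h' where e': "is_epi C e'" "Cod C e' = Dom C x" "h' \<in> Arr C" "Dom C h' = Dom C e'"
      "Cod C h' = Dom C c" "x \<odot> e' = c \<odot> h'"
    using epi_cover[OF cs(5), of x] x by metis
  have e'A: "e' \<in> Arr C" using e' by simp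
  have "x \<odot> e' = m \<odot> (e \<odot> e')" using comp_subst[OF e(6), of e'] e eA e' e'A by simp
  then have "x \<odot> e' \<preceq> m" using eA e e' e'A by simp
  then have "h' \<preceq> l'" using l'(3)[of h'] e' by simp
  then have "h' \<preceq> l" using le_trans l'l cs by blast
  then have "null (x \<odot> e')" using ses_le_iff[OF c, of h'] e' by simp
  then show False using epi_null[OF e'(1), of x] x e' by simp
qed

lemma zero_mono:
  assumes "is_zero C Z" "A \<in> Obj C"
  shows "is_mono C (Zero C Z A)"
  by (rule monoI) (use is_zero_null[OF assms(1)] is_zero_Obj[OF assms(1)] assms(2) in simp_all)

lemma disj_zero:
  assumes "is_zero C Z" "A \<in> Obj C"
  shows "disj (Zero C Z A) n"
  unfolding disj_def
proof (intro allI impI)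
  fix x assume "x \<preceq> Zero C Z A"
  then obtain h where h: "h \<in> Arr C" "Dom C h = Dom C x" "Cod C h = Dom C (Zero C Z A)" "Zero C Z A \<odot> h = x"
    by (rule leE)
  have "Z \<in> Obj C" using assms is_zero_Obj by blast
  then have "null (Zero C Z A \<odot> h)" using h assms by (rule_tac null_comp2) simp_all
  then show "null x" using h by simp
qed

end

context grothendieck_category
begin

text \<open>Dividing the codomain of a monomorphism \<open>e\<close> by a maximal subobject disjoint from \<open>e\<close> makes it an essential
  monomorphism \<open>c \<odot> e\<close>. If \<open>u\<close> extends the part of \<open>h : G \<rightarrow> Cod C c\<close> lying in \<open>c \<odot> e\<close>, then the difference \<open>h \<ominus> c \<odot> e \<odot> u\<close>
  meets \<open>c \<odot> e\<close> trivially and is therefore zero; so \<open>c \<odot> e\<close> is an isomorphism.\<close>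

lemma baer:
  assumes G: "generating_set C \<G>" and E: "E \<in> Obj C"
    and ext: "\<And>k f. Cod C k \<in> \<G> \<Longrightarrow> is_mono C k \<Longrightarrow> f \<in> Arr C \<Longrightarrow> Dom C f = Dom C k \<Longrightarrow> Cod C f = E \<Longrightarrow>
      \<exists>u\<in>Arr C. Dom C u = Cod C k \<and> Cod C u = E \<and> u \<odot> k = f"
  shows "injective_object C E"
proof (rule injective_if_split[OF E])
  fix e assume e: "is_mono C e" "Dom C e = E"
  have eA: "e \<in> Arr C" using e by simp
  obtain Z where Z: "is_zero C Z" using ex_zero by blast
  have ZO: "Z \<in> Obj C" using Z is_zero_Obj by blast
  obtain l where l: "is_mono C l" "Cod C l = Cod C e" "disj l e"
    "\<And>l'. is_mono C l' \<Longrightarrow> Cod C l' = Cod C e \<Longrightarrow> l \<preceq> l' \<Longrightarrow> disj l' e \<Longrightarrow> l' \<preceq> l"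
  proof (rule maximal_disj[of e "Cod C e" "Zero C Z (Cod C e)"])
    show "is_mono C (Zero C Z (Cod C e))" "disj (Zero C Z (Cod C e)) e"
      using zero_mono disj_zero Z eA by simp_all
  qed (use eA ZO in \<open>simp_all\<close>)
  obtain c where c: "short_exact C l c" using l mono_ses by blast
  note cs = ses_simps[OF c]
  have cD: "Dom C c = Cod C e" using cs l by simp
  let ?i = "c \<odot> e"
  have iA: "?i \<in> Arr C" "Dom C ?i = E" "Cod C ?i = Cod C c" using cs cD e eA by simp_all
  have i_mono: "is_mono C ?i"
  proof (rule monoI[OF iA(1)])
    fix x assume x: "x \<in> Arr C" "Cod C x = Dom C ?i" "null (?i \<odot> x)"
    then have "e \<odot> x \<preceq> l" using ses_le_iff[OF c, of "e \<odot> x"] cs cD e eA iA by simp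
    then have "null (e \<odot> x)" using disjD[OF l(3)] eA x iA e by simp
    then show "null x" using mono_null[OF e(1), of x] x iA e by simp
  qed
  have "Ident C (Cod C c) \<preceq> ?i"
  proof (rule le_generating[OF G i_mono])
    fix G' h assume h: "G' \<in> \<G>" "h \<in> Arr C" "Dom C h = G'" "Cod C h = Dom C (Ident C (Cod C c))"
    then have hC: "Cod C h = Cod C c" using cs by simp
    obtain k where k: "is_mono C k" "Cod C k = Dom C h"
      "\<And>x. x \<in> Arr C \<Longrightarrow> Cod C x = Dom C h \<Longrightarrow> x \<preceq> k \<longleftrightarrow> h \<odot> x \<preceq> ?i"
      using preimageE[OF i_mono h(2)] hC iA by metis
    have kA: "k \<in> Arr C" using k by simp
    have "h \<odot> k \<preceq> ?i" using k(3)[of k] k kA by simp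
    then obtain f where f: "f \<in> Arr C" "Dom C f = Dom C (h \<odot> k)" "Cod C f = Dom C ?i" "?i \<odot> f = h \<odot> k"
      by (rule leE)
    have fD: "Dom C f = Dom C k" "Cod C f = E" using f h k kA iA by simp_all
    obtain u where u: "u \<in> Arr C" "Dom C u = Cod C k" "Cod C u = E" "u \<odot> k = f"
      using ext[of k f] h k f(1) fD by metis
    let ?d = "h \<ominus> ?i \<odot> u"
    have dA: "?d \<in> Arr C" "Dom C ?d = Dom C h" "Cod C ?d = Cod C c" using h hC iA u k by simp_all
    have "null ?d"
    proof (rule ccontr)
      assume "\<not> null ?d"
      then obtain y w where y: "y \<in> Arr C" "Cod C y = Dom C ?d" "w \<in> Arr C" "Cod C w = Dom C e" "Dom C w = Dom C y"
        "?d \<odot> y = c \<odot> (e \<odot> w)" "\<not> null (?d \<odot> y)"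
        using maximal_disj_essential[OF e(1) l c dA(1,3)] by blast
      have yC: "Cod C y = Dom C h" using y dA by simp
      have dy: "?d \<odot> y = h \<odot> y \<ominus> ?i \<odot> (u \<odot> y)"
        using sub_comp[of h "?i \<odot> u" y] assoc[of y u ?i] h hC iA u k y(1) yC by simp
      obtain t where t: "short_exact C ?i t" using i_mono mono_ses by blast
      note ts = ses_simps[OF t]
      have tD: "Dom C t = Cod C c" using ts iA by simp
      have n1: "null (t \<odot> (?i \<odot> x))" if "x \<in> Arr C" "Cod C x = E" for x
        using ses_le_iff[OF t, of "?i \<odot> x"] comp_le_self[of ?i x] that iA tD by (simp del: assoc)
      have "?d \<odot> y = ?i \<odot> w" using y(6) y(3,4) cs cD eA by simp
      then have "null (t \<odot> (?d \<odot> y))" using n1[of w] y e by simp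
      then have n2: "null (t \<odot> (h \<odot> y) \<ominus> t \<odot> (?i \<odot> (u \<odot> y)))"
        using dy comp_sub[of "h \<odot> y" "?i \<odot> (u \<odot> y)" t] h hC iA u k y(1) yC ts(2) tD by (simp del: assoc)
      have "t \<odot> (h \<odot> y) = t \<odot> (?i \<odot> (u \<odot> y))"
        using n2 h hC iA u k y(1) yC ts(2) tD by (simp del: assoc)
      then have "null (t \<odot> (h \<odot> y))" using n1[of "u \<odot> y"] u k y(1) yC by simp
      \<comment> \<open>So \<open>y\<close> belongs to the part \<open>k\<close> on which
        \<open>u\<close> was prescribed, and there the difference vanishes; this contradicts the
        choice of \<open>y\<close>.\<close>
      then have "h \<odot> y \<preceq> ?i" using ses_le_iff[OF t, of "h \<odot> y"] h hC y(1) yC tD by simp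
      then have "y \<preceq> k" using k(3)[of y] y(1) yC by simp
      then obtain v where v: "v \<in> Arr C" "Dom C v = Dom C y" "Cod C v = Dom C k" "k \<odot> v = y" by (rule leE)
      have "h \<odot> y = (h \<odot> k) \<odot> v" using v h k kA by simp
      also have "\<dots> = ?i \<odot> (f \<odot> v)" unfolding f(4)[symmetric]
        by (rule assoc) (use v f(1) fD iA in simp_all)
      also have "f \<odot> v = u \<odot> y" using comp_subst[OF u(4), of v] v u kA by simp
      finally have "null (?d \<odot> y)" unfolding dy using h hC iA u k y(1) yC by (simp del: assoc)
      then show False using y by blast
    qed
    then have "h = ?i \<odot> u" using h hC iA u k by simp
    then show "Ident C (Cod C c) \<odot> h \<preceq> ?i" using comp_le_self[OF iA(1) u(1)] u(3) iA(2) h hC cs by simp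
  qed (use cs iA in simp_all)
  then obtain s where s: "s \<in> Arr C" "Cod C s = E" "Dom C s = Cod C c" "?i \<odot> s = Ident C (Cod C c)"
    using iA cs by (auto elim: leE)
  have "s \<odot> ?i = Ident C E"
    by (rule mono_cancel[OF i_mono]) (use s iA comp_subst[OF s(4), of ?i] E cs in \<open>simp_all del: assoc\<close>)
  then have "s \<odot> c \<odot> e = Ident C E" using s cs cD eA by simp
  then show "\<exists>r\<in>Arr C. Dom C r = Cod C e \<and> Cod C r = E \<and> r \<odot> e = Ident C E"
    using s cs cD by (intro bexI[of _ "s \<odot> c"]) simp_all
qed

text \<open>One monomorphism is chosen for each sieve; equal sieves mean mutually contained
  subobjects, and there are only a small number of sieves.\<close>

lemma small_subobject_representatives:
  assumes S: "S \<in> Obj C"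
  obtains R where "is_small small R" "\<And>r. r \<in> R \<Longrightarrow> is_mono C r" "\<And>r. r \<in> R \<Longrightarrow> Cod C r = S"
    "\<And>m. is_mono C m \<Longrightarrow> Cod C m = S \<Longrightarrow> \<exists>r\<in>R. m \<preceq> r \<and> r \<preceq> m"
proof -
  obtain G where G: "generating_set C {G}" using ex_generator by blast
  then have GO: "G \<in> Obj C" by (simp add: generating_set_def)
  let ?M = "{m. is_mono C m \<and> Cod C m = S}"
  let ?R = "inv_into ?M (sieve G) ` (sieve G ` ?M)"
  have R: "inv_into ?M (sieve G) X \<in> ?M" if "X \<in> sieve G ` ?M" for X using inv_into_into[OF that] .
  show ?thesis
  proof (rule that[of ?R])
    have "is_small small (sieve G ` ?M)"
      by (rule is_small_subset[OF is_small_Pow[OF small_Hom[OF GO S]]]) (auto simp: sieve_def)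
    then show "is_small small ?R" by (rule is_small_lepoll) (rule image_lepoll)
    show "is_mono C r" "Cod C r = S" if "r \<in> ?R" for r using R that by blast+
    fix m assume m: "is_mono C m" "Cod C m = S"
    let ?r = "inv_into ?M (sieve G) (sieve G m)"
    have r: "?r \<in> ?M" "sieve G ?r = sieve G m" using R[of "sieve G m"] f_inv_into_f[of "sieve G m" "sieve G" ?M] m by auto
    have "m \<preceq> ?r" "?r \<preceq> m" using le_iff_sieve_subset[OF G, of m ?r] le_iff_sieve_subset[OF G, of ?r m] r m by auto
    then show "\<exists>r\<in>?R. m \<preceq> r \<and> r \<preceq> m" using m by blast
  qed
qed

text \<open>Exactness of coproducts, derived from finite support: if \<open>a\<close> kills
  \<open>x\<close>, then every coordinate of \<open>x\<close> is null because \<open>m j\<close> is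
  monic, and a finitely supported element with null coordinates is null.\<close>

lemma coproduct_map_mono:
  fixes \<iota> :: "'x \<Rightarrow> 'm"
  assumes J: "is_small small J" and S: "is_coproduct C J F S \<iota>" and T: "is_coproduct C J F' T \<kappa>"
    and m: "\<And>j. j \<in> J \<Longrightarrow> is_mono C (m j)" "\<And>j. j \<in> J \<Longrightarrow> Dom C (m j) = F j" "\<And>j. j \<in> J \<Longrightarrow> Cod C (m j) = F' j"
    and a: "a \<in> Arr C" "Dom C a = S" "Cod C a = T" "\<And>j. j \<in> J \<Longrightarrow> a \<odot> \<iota> j = \<kappa> j \<odot> m j"
  shows "is_mono C a"
proof (rule monoI[OF a(1)])
  note s = coproduct_simps[OF S] and t = coproduct_simps[OF T]
  have mA: "m j \<in> Arr C" if "j \<in> J" for j using m(1)[OF that] by simp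
  fix x assume x: "x \<in> Arr C" "Cod C x = Dom C a" "null (a \<odot> x)"
  have xS: "Cod C x = S" using x a by simp
  have "\<forall>j\<in>J. \<exists>\<pi>. \<pi> \<in> Arr C \<and> Dom C \<pi> = S \<and> Cod C \<pi> = F j \<and> \<pi> \<odot> \<iota> j = Ident C (F j) \<and>
      (\<forall>i\<in>J. i \<noteq> j \<longrightarrow> null (\<pi> \<odot> \<iota> i))"
  proof
    fix j assume "j \<in> J"
    then obtain \<pi> where "\<pi> \<in> Arr C" "Dom C \<pi> = S" "Cod C \<pi> = F j" "\<pi> \<odot> \<iota> j = Ident C (F j)"
      "\<And>i. i \<in> J \<Longrightarrow> i \<noteq> j \<Longrightarrow> null (\<pi> \<odot> \<iota> i)"
      using coproduct_projection[OF S] by blast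
    then show "\<exists>\<pi>. \<pi> \<in> Arr C \<and> Dom C \<pi> = S \<and> Cod C \<pi> = F j \<and> \<pi> \<odot> \<iota> j = Ident C (F j) \<and>
      (\<forall>i\<in>J. i \<noteq> j \<longrightarrow> null (\<pi> \<odot> \<iota> i))" by blast
  qed
  from bchoice[OF this] obtain \<pi> where \<pi>: "\<And>j. j \<in> J \<Longrightarrow> \<pi> j \<in> Arr C" "\<And>j. j \<in> J \<Longrightarrow> Dom C (\<pi> j) = S"
    "\<And>j. j \<in> J \<Longrightarrow> Cod C (\<pi> j) = F j" "\<And>j. j \<in> J \<Longrightarrow> \<pi> j \<odot> \<iota> j = Ident C (F j)"
    "\<And>i j. i \<in> J \<Longrightarrow> j \<in> J \<Longrightarrow> i \<noteq> j \<Longrightarrow> null (\<pi> j \<odot> \<iota> i)"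
    by blast
  have \<pi>x: "null (\<pi> j \<odot> x)" if j: "j \<in> J" for j
  proof -
    obtain \<rho> where \<rho>: "\<rho> \<in> Arr C" "Dom C \<rho> = T" "Cod C \<rho> = F' j" "\<rho> \<odot> \<kappa> j = Ident C (F' j)"
      "\<And>i. i \<in> J \<Longrightarrow> i \<noteq> j \<Longrightarrow> null (\<rho> \<odot> \<kappa> i)"
      using coproduct_projection[OF T j] by blast
    \<comment> \<open>Compatibility with projections, checked on each summand: off the index
      \<open>j\<close> both sides are null.\<close>
    have "\<rho> \<odot> a = m j \<odot> \<pi> j"
    proof (rule coproduct_eqI[OF S])
      fix i assume i: "i \<in> J"
      note tt = t(2-4)[OF i] s(2-4)[OF i] m(2,3)[OF i] mA[OF i]
      have l: "\<rho> \<odot> a \<odot> \<iota> i = (\<rho> \<odot> \<kappa> i) \<odot> m i"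
        using a(1-3) a(4)[OF i] \<rho>(1-3) tt by simp
      have r: "m j \<odot> \<pi> j \<odot> \<iota> i = m j \<odot> (\<pi> j \<odot> \<iota> i)"
        by (rule assoc) (use \<pi>(1-3)[OF j] tt m(2,3)[OF j] mA[OF j] in simp_all)
      show "\<rho> \<odot> a \<odot> \<iota> i = m j \<odot> \<pi> j \<odot> \<iota> i"
      proof (cases "i = j")
        case True
        then show ?thesis unfolding l r using \<rho>(4) \<pi>(4)[OF j] mA[OF j] m(2,3)[OF j] by simp
      next
        case False
        have "null ((\<rho> \<odot> \<kappa> i) \<odot> m i)"
          using \<rho>(5)[OF i False] \<rho>(1-3) tt by (rule_tac null_comp2) simp_all
        moreover have "null (m j \<odot> (\<pi> j \<odot> \<iota> i))"
          using \<pi>(5)[OF i j False] \<pi>(1-3)[OF j] tt m(2,3)[OF j] mA[OF j] by (rule_tac null_comp1) simp_all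
        ultimately show ?thesis unfolding l r
          by (rule null_unique) (use \<rho>(1-3) \<pi>(1-3)[OF j] tt m(2,3)[OF j] mA[OF j] in simp_all)
      qed
    qed (use \<rho>(1-3) a(1-3) m(2,3)[OF j] mA[OF j] \<pi>(1-3)[OF j] in simp_all)
    then have "\<rho> \<odot> (a \<odot> x) = m j \<odot> (\<pi> j \<odot> x)"
      using comp_subst[of \<rho> a "m j \<odot> \<pi> j" x] \<rho>(1-3) a(1-3) m(2,3)[OF j] mA[OF j] \<pi>(1-3)[OF j] x(1) xS by simp
    moreover have "null (\<rho> \<odot> (a \<odot> x))" using x \<rho>(1-3) a(1-3) by (rule_tac null_comp1) simp_all
    ultimately show ?thesis
      using mono_null[OF m(1)[OF j], of "\<pi> j \<odot> x"] m(2)[OF j] \<pi>(1-3)[OF j] x(1) xS by simp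
  qed
  show "null x"
  proof (rule coproduct_finite_support[OF J S x(1) xS x(1) refl])
    fix A y assume A: "finite A" "A \<subseteq> J" and y: "y \<in> Arr C" "Cod C y = Dom C x" "supported S \<iota> A (x \<odot> y)"
    have xy: "x \<odot> y \<in> Arr C" "Cod C (x \<odot> y) = S" using x(1) xS y by simp_all
    show "null (x \<odot> y)"
    proof (rule supported_null[OF S A xy \<pi>(1-4) \<pi>(5) y(3)])
      fix j assume j: "j \<in> J"
      have "null (\<pi> j \<odot> x \<odot> y)"
        using \<pi>x[OF j] y(1,2) x(1) xS \<pi>(1-3)[OF j] by (rule_tac null_comp2) simp_all
      then show "null (\<pi> j \<odot> (x \<odot> y))" using y(1,2) x(1) xS \<pi>(1-3)[OF j] by simp
    qed
  qed
qed

text \<open>A single pushout solves all extension problems into \<open>M\<close> at once: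
  \<open>a\<close> is the coproduct of the inclusions of subobjects into generators,
  \<open>b\<close> combines the arrows to be extended, and pushing out the monic \<open>a\<close>
  along \<open>b\<close> gives \<open>t\<close>.\<close>

lemma extension_step:
  assumes G: "is_small small \<G>" "\<G> \<subseteq> Obj C" and M: "M \<in> Obj C"
  obtains t where "is_mono C t" "Dom C t = M"
    "\<And>k f. Cod C k \<in> \<G> \<Longrightarrow> is_mono C k \<Longrightarrow> f \<in> Arr C \<Longrightarrow> Dom C f = Dom C k \<Longrightarrow> Cod C f = M \<Longrightarrow>
      \<exists>u\<in>Arr C. Dom C u = Cod C k \<and> Cod C u = Cod C t \<and> u \<odot> k = t \<odot> f"
proof -
  have "\<forall>G\<in>\<G>. \<exists>R. is_small small R \<and> (\<forall>r\<in>R. is_mono C r \<and> Cod C r = G) \<and>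
      (\<forall>m. is_mono C m \<longrightarrow> Cod C m = G \<longrightarrow> (\<exists>r\<in>R. m \<preceq> r \<and> r \<preceq> m))"
  proof
    fix G assume "G \<in> \<G>"
    then have "G \<in> Obj C" using G by blast
    then show "\<exists>R. is_small small R \<and> (\<forall>r\<in>R. is_mono C r \<and> Cod C r = G) \<and>
      (\<forall>m. is_mono C m \<longrightarrow> Cod C m = G \<longrightarrow> (\<exists>r\<in>R. m \<preceq> r \<and> r \<preceq> m))"
      using small_subobject_representatives[of G] by metis
  qed
  from bchoice[OF this] obtain R where R: "\<And>G. G \<in> \<G> \<Longrightarrow> is_small small (R G)"
    "\<And>G r. G \<in> \<G> \<Longrightarrow> r \<in> R G \<Longrightarrow> is_mono C r" "\<And>G r. G \<in> \<G> \<Longrightarrow> r \<in> R G \<Longrightarrow> Cod C r = G"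
    "\<And>G m. G \<in> \<G> \<Longrightarrow> is_mono C m \<Longrightarrow> Cod C m = G \<Longrightarrow> \<exists>r\<in>R G. m \<preceq> r \<and> r \<preceq> m"
    by blast
  \<comment> \<open>An index is a generator, a representative of a subobject of it, and an arrow
    from that subobject to \<open>M\<close>. Using representatives keeps the index set
    small.\<close>
  define J where "J = Sigma \<G> (\<lambda>G. Sigma (R G) (\<lambda>r. Hom C (Dom C r) M))"
  have J: "is_small small J" unfolding J_def
    using G R by (intro is_small_Sigma small_Hom M) auto
  define k where "k j = fst (snd j)" for j :: "'o \<times> 'm \<times> 'm"
  define f where "f j = snd (snd j)" for j :: "'o \<times> 'm \<times> 'm"
  have k: "is_mono C (k j)" "Cod C (k j) = fst j" "fst j \<in> Obj C" and f: "f j \<in> Arr C" "Dom C (f j) = Dom C (k j)" "Cod C (f j) = M"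
    if "j \<in> J" for j
    using that R(2,3) G unfolding J_def k_def f_def by auto
  have kA: "k j \<in> Arr C" if "j \<in> J" for j using k(1)[OF that] by simp
  have "(\<lambda>j. Dom C (k j)) ` J \<subseteq> Obj C" "fst ` J \<subseteq> Obj C" using kA k(3) by auto
  then obtain S \<iota> T \<kappa> where S: "is_coproduct C J (\<lambda>j. Dom C (k j)) S \<iota>" and T: "is_coproduct C J fst T \<kappa>"
    using coproduct_exists[OF J] by metis
  note s = coproduct_simps[OF S] and t = coproduct_simps[OF T]
  define g where "g j = \<kappa> j \<odot> k j" for j
  have g: "g j \<in> Arr C" "Dom C (g j) = Dom C (k j)" "Cod C (g j) = T" if "j \<in> J" for j
    using t(2-4)[OF that] k(2)[OF that] kA[OF that] by (simp_all add: g_def)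
  obtain a where a: "a \<in> Arr C" "Dom C a = S" "Cod C a = T" "\<And>j. j \<in> J \<Longrightarrow> a \<odot> \<iota> j = g j"
    using coproduct_desc[OF S t(1) g] by blast
  obtain b where b: "b \<in> Arr C" "Dom C b = S" "Cod C b = M" "\<And>j. j \<in> J \<Longrightarrow> b \<odot> \<iota> j = f j"
    using coproduct_desc[OF S M f] by blast
  have "is_mono C a"
    by (rule coproduct_map_mono[OF J S T k(1) refl k(2) a(1-3)]) (simp_all add: a(4) g_def)
  then obtain m b' where m: "is_mono C m" "Dom C m = Cod C b" "b' \<in> Arr C" "Dom C b' = Cod C a"
    "Cod C b' = Cod C m" "m \<odot> b = b' \<odot> a"
    using pushout[of a b] a(2) b(1,2) by metis
  have mA: "m \<in> Arr C" using m by simp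
  show ?thesis
  proof (rule that[of m])
    fix k' f' assume k': "Cod C k' \<in> \<G>" "is_mono C k'" and f': "f' \<in> Arr C" "Dom C f' = Dom C k'" "Cod C f' = M"
    have k'A: "k' \<in> Arr C" using k' by simp
    obtain r where r: "r \<in> R (Cod C k')" "k' \<preceq> r" "r \<preceq> k'" using R(4)[OF k'(1) k'(2) refl] by blast
    have rm: "is_mono C r" "Cod C r = Cod C k'" using R(2,3)[OF k'(1) r(1)] by simp_all
    have rA: "r \<in> Arr C" using rm by simp
    obtain v where v: "v \<in> Arr C" "Dom C v = Dom C k'" "Cod C v = Dom C r" "r \<odot> v = k'" using r(2) by (rule leE)
    obtain w where w: "w \<in> Arr C" "Dom C w = Dom C r" "Cod C w = Dom C k'" "k' \<odot> w = r" using r(3) by (rule leE)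
    \<comment> \<open>The subobject \<open>k'\<close> and its representative \<open>r\<close> are
      isomorphic through \<open>w\<close> and \<open>v\<close>; the problem \<open>f'\<close> on
      \<open>k'\<close> is solved as \<open>f' \<odot> w\<close> on \<open>r\<close> and transported
      back.\<close>
    have wv: "w \<odot> v = Ident C (Dom C k')"
      by (rule mono_cancel[OF k'(2)]) (use v w k'A comp_subst[OF w(4), of v] in simp_all)
    let ?j = "(Cod C k', r, f' \<odot> w)"
    have j: "?j \<in> J" using k'(1) r(1) w f' by (simp add: J_def)
    have fj: "f ?j = f' \<odot> w" "k ?j = r" by (simp_all add: f_def k_def)
    note tt = t(2-4)[OF j] s(2-4)[OF j]
    have "b' \<odot> \<kappa> ?j \<odot> r = b' \<odot> (a \<odot> \<iota> ?j)"
      unfolding a(4)[OF j] g_def fj using tt m a(1-3) rA rm by simp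
    also have "\<dots> = m \<odot> (b \<odot> \<iota> ?j)"
      using comp_subst[OF m(6)[symmetric], of "\<iota> ?j"] tt m(1-5) mA a(1-3) b(1-3) by simp
    also have "\<dots> = m \<odot> (f' \<odot> w)" unfolding b(4)[OF j] fj ..
    finally have eq: "b' \<odot> \<kappa> ?j \<odot> r = m \<odot> (f' \<odot> w)" .
    have "b' \<odot> \<kappa> ?j \<odot> k' = b' \<odot> \<kappa> ?j \<odot> (r \<odot> v)" using v by simp
    also have "\<dots> = m \<odot> (f' \<odot> w) \<odot> v"
      by (rule comp_subst[OF eq]) (use tt m a(1-3) rA rm v in simp_all)
    also have "\<dots> = m \<odot> f'" using wv m mA b(1-3) f' w v by simp
    finally show "\<exists>u\<in>Arr C. Dom C u = Cod C k' \<and> Cod C u = Cod C m \<and> u \<odot> k' = m \<odot> f'"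
      using tt m a(1-3) by (intro bexI[of _ "b' \<odot> \<kappa> ?j"]) simp_all
  qed (use m b in simp_all)
qed

text \<open>\<open>E\<close> is the cokernel of \<open>d\<close>, where \<open>d \<odot> \<iota> n = \<iota> n \<ominus> \<iota> (Suc n) \<odot> t n\<close>. If \<open>\<iota> n \<odot> x = d \<odot> y\<close>,
  then the coordinates of \<open>y\<close> vanish below \<open>n\<close>, equal \<open>x\<close> at \<open>n\<close> and are carried to each other by
  the \<open>t k\<close> from there on, so finite support of \<open>y\<close> forces \<open>x\<close> to be zero.\<close>

lemma sequence_limit:
  fixes t :: "nat \<Rightarrow> 'm"
  assumes t: "\<And>n. is_mono C (t n)" "\<And>n. Dom C (t (Suc n)) = Cod C (t n)"
  obtains E u where "E \<in> Obj C" "\<And>n. is_mono C (u n)" "\<And>n. Dom C (u n) = Dom C (t n)"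
    "\<And>n. Cod C (u n) = E" "\<And>n. u (Suc n) \<odot> t n = u n"
    "\<And>g. g \<in> Arr C \<Longrightarrow> Dom C g = E \<Longrightarrow> (\<And>n. null (g \<odot> u n)) \<Longrightarrow> null g"
proof -
  have tA: "t n \<in> Arr C" for n using t(1)[of n] by simp
  define M where "M n = Dom C (t n)" for n
  have tM: "Dom C (t n) = M n" "Cod C (t n) = M (Suc n)" and MO: "M n \<in> Obj C" for n
    using t(2)[of n] tA[of n] by (simp_all add: M_def)
  have "range M \<subseteq> Obj C" using MO by auto
  then obtain S \<iota> where S: "is_coproduct C (UNIV::nat set) M S \<iota>"
    using coproduct_exists[OF is_small_nat] by blast
  note s = coproduct_simps(1)[OF S] coproduct_simps(2-4)[OF S UNIV_I]
  define g where "g n = \<iota> n \<ominus> \<iota> (Suc n) \<odot> t n" for n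
  have g: "g n \<in> Arr C" "Dom C (g n) = M n" "Cod C (g n) = S" for n
    using s tA tM by (simp_all add: g_def)
  obtain d where d: "d \<in> Arr C" "Dom C d = S" "Cod C d = S" "\<And>n. d \<odot> \<iota> n = g n"
    using coproduct_desc[OF S s(1) g] by (metis UNIV_I)
  obtain q where q: "is_cokernel C q d" using ex_cokernel[OF d(1)] by blast
  note q' = cokernel_simps[OF q] cokernel_epi[OF q]
  have qD: "Dom C q = S" using q' d by simp
  have step: "q \<odot> \<iota> (Suc n) \<odot> t n = q \<odot> \<iota> n" for n
  proof -
    have "null (q \<odot> d \<odot> \<iota> n)" using q' d(1-3) s by (rule_tac null_comp2) simp_all
    then have "null (q \<odot> g n)" using q' d s by simp
    then have "q \<odot> \<iota> n = q \<odot> (\<iota> (Suc n) \<odot> t n)" using q'(1) qD s tA tM by (simp add: g_def comp_sub)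
    then show ?thesis using q'(1) qD s tA tM by simp
  qed
  have "\<forall>j. \<exists>\<pi>. \<pi> \<in> Arr C \<and> Dom C \<pi> = S \<and> Cod C \<pi> = M j \<and> \<pi> \<odot> \<iota> j = Ident C (M j) \<and>
      (\<forall>i. i \<noteq> j \<longrightarrow> null (\<pi> \<odot> \<iota> i))"
  proof
    fix j
    obtain \<pi> where "\<pi> \<in> Arr C" "Dom C \<pi> = S" "Cod C \<pi> = M j" "\<pi> \<odot> \<iota> j = Ident C (M j)"
      "\<And>i. i \<in> UNIV \<Longrightarrow> i \<noteq> j \<Longrightarrow> null (\<pi> \<odot> \<iota> i)"
      using coproduct_projection[OF S, of j] by blast
    then show "\<exists>\<pi>. \<pi> \<in> Arr C \<and> Dom C \<pi> = S \<and> Cod C \<pi> = M j \<and> \<pi> \<odot> \<iota> j = Ident C (M j) \<and>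
      (\<forall>i. i \<noteq> j \<longrightarrow> null (\<pi> \<odot> \<iota> i))" by blast
  qed
  from choice[OF this] obtain \<pi> where \<pi>: "\<And>j. \<pi> j \<in> Arr C" "\<And>j. Dom C (\<pi> j) = S"
    "\<And>j. Cod C (\<pi> j) = M j" "\<And>j. \<pi> j \<odot> \<iota> j = Ident C (M j)"
    "\<And>i j. i \<noteq> j \<Longrightarrow> null (\<pi> j \<odot> \<iota> i)"
    by blast
  have \<pi>0: "\<pi> j \<odot> \<iota> i = Zero C (M i) (M j)" if "i \<noteq> j" for i j
    by (rule null_eq[OF \<pi>(5)[OF that]]) (use \<pi>(1-3) s in simp_all)
  have \<pi>d0: "\<pi> 0 \<odot> d = \<pi> 0"
  proof (rule coproduct_eqI[OF S])
    fix i
    have "\<pi> 0 \<odot> d \<odot> \<iota> i = \<pi> 0 \<odot> \<iota> i \<ominus> (\<pi> 0 \<odot> \<iota> (Suc i)) \<odot> t i"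
      using \<pi>(1-3) d s tA tM by (simp add: g_def comp_sub)
    also have "\<dots> = \<pi> 0 \<odot> \<iota> i" using \<pi>0[of "Suc i" 0] \<pi>(1-3) s tA tM MO by simp
    finally show "\<pi> 0 \<odot> d \<odot> \<iota> i = \<pi> 0 \<odot> \<iota> i" .
  qed (use \<pi>(1-3) d in simp_all)
  have \<pi>dS: "\<pi> (Suc k) \<odot> d = \<pi> (Suc k) \<ominus> t k \<odot> \<pi> k" for k
  proof (rule coproduct_eqI[OF S])
    fix i
    have l: "\<pi> (Suc k) \<odot> d \<odot> \<iota> i = \<pi> (Suc k) \<odot> \<iota> i \<ominus> (\<pi> (Suc k) \<odot> \<iota> (Suc i)) \<odot> t i"
      using \<pi>(1-3) d s tA tM by (simp add: g_def comp_sub)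
    have r: "(\<pi> (Suc k) \<ominus> t k \<odot> \<pi> k) \<odot> \<iota> i = \<pi> (Suc k) \<odot> \<iota> i \<ominus> t k \<odot> (\<pi> k \<odot> \<iota> i)"
      using sub_comp[of "\<pi> (Suc k)" "t k \<odot> \<pi> k" "\<iota> i"] \<pi>(1-3) s tA tM by simp
    have "(\<pi> (Suc k) \<odot> \<iota> (Suc i)) \<odot> t i = t k \<odot> (\<pi> k \<odot> \<iota> i)"
    proof (cases "i = k")
      case True
      then show ?thesis using \<pi>(4) tA tM by simp
    next
      case False
      then show ?thesis using \<pi>0[of "Suc i" "Suc k"] \<pi>0[of i k] tA tM MO by simp
    qed
    then show "\<pi> (Suc k) \<odot> d \<odot> \<iota> i = (\<pi> (Suc k) \<ominus> t k \<odot> \<pi> k) \<odot> \<iota> i" unfolding l r by simp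
  qed (use \<pi>(1-3) d tA tM in simp_all)
  have mono: "is_mono C (q \<odot> \<iota> n)" for n
  proof (rule monoI)
    show "q \<odot> \<iota> n \<in> Arr C" using q' qD s by simp
    fix x assume x: "x \<in> Arr C" "Cod C x = Dom C (q \<odot> \<iota> n)" "null (q \<odot> \<iota> n \<odot> x)"
    have xM: "Cod C x = M n" using x(2) q' qD s by simp
    have qx: "null (q \<odot> (\<iota> n \<odot> x))" using x(1,3) xM q' qD s by simp
    \<comment> \<open>The image \<open>m\<close> of \<open>d\<close> contains everything killed by
      \<open>q\<close>: the cokernel \<open>c\<close> of \<open>m\<close> kills \<open>d\<close>,
      hence factors through \<open>q\<close>. So \<open>\<iota> n \<odot> x\<close> lies in the
      image of \<open>d\<close>, and a cover turns it into some \<open>d \<odot> y\<close>.\<close>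
    obtain e m where e: "is_epi C e" "is_mono C m" "Cod C e = Dom C m" "Dom C e = S"
      "Cod C m = S" "m \<odot> e = d"
      using image_factorization[OF d(1)] d by metis
    have eA: "e \<in> Arr C" "m \<in> Arr C" using e by simp_all
    obtain c where c: "short_exact C m c" using e mono_ses by blast
    note cs = ses_simps[OF c]
    have "null ((c \<odot> m) \<odot> e)" using cs e eA by (rule_tac null_comp2) simp_all
    then have "null (c \<odot> d)" using cs e eA by simp
    then obtain h where h: "h \<in> Arr C" "Dom C h = Cod C q" "Cod C h = Cod C c" "h \<odot> q = c"
      using cokernel_desc[OF q, of c] cs e d by metis
    have "null (h \<odot> (q \<odot> (\<iota> n \<odot> x)))" using h qx x(1) xM q'(1) qD s by (rule_tac null_comp1) simp_all
    then have "null (c \<odot> (\<iota> n \<odot> x))"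
      using comp_subst[OF h(4), of "\<iota> n \<odot> x"] h x(1) xM q'(1) qD s by simp
    then have "\<iota> n \<odot> x \<preceq> m" using ses_le_iff[OF c, of "\<iota> n \<odot> x"] cs e x(1) xM s by simp
    then obtain z where z: "z \<in> Arr C" "Dom C z = Dom C (\<iota> n \<odot> x)" "Cod C z = Dom C m" "m \<odot> z = \<iota> n \<odot> x"
      by (rule leE)
    have zD: "Dom C z = Dom C x" using z(2) x(1) xM s by simp
    obtain e' y where e': "is_epi C e'" "Cod C e' = Dom C z" "y \<in> Arr C" "Dom C y = Dom C e'"
      "Cod C y = Dom C e" "z \<odot> e' = e \<odot> y"
      using epi_cover[OF e(1), of z] z e by metis
    have e'A: "e' \<in> Arr C" using e' by simp
    have "\<iota> n \<odot> (x \<odot> e') = m \<odot> (z \<odot> e')"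
      using comp_subst[OF z(4), of e'] z(1,3) zD e'A e' x(1) xM s eA by simp
    also have "\<dots> = d \<odot> y" using comp_subst[OF e(6), of y] e' e eA by simp
    finally have key: "\<iota> n \<odot> (x \<odot> e') = d \<odot> y" .
    have yS: "Cod C y = S" using e' e by simp
    have xe: "x \<odot> e' \<in> Arr C" "Dom C (x \<odot> e') = Dom C y" "Cod C (x \<odot> e') = M n"
      using x(1) xM e'A e' zD by simp_all
    have "null (x \<odot> e')"
    proof (rule coproduct_finite_support[OF is_small_nat S e'(3) yS xe(1,2)])
      fix A w assume A: "finite A" and w: "w \<in> Arr C" "Cod C w = Dom C y" "supported S \<iota> A (y \<odot> w)"
      let ?X = "x \<odot> e' \<odot> w" and ?Y = "y \<odot> w"
      have X: "?X \<in> Arr C" "Dom C ?X = Dom C w" "Cod C ?X = M n" using xe w by (simp_all del: assoc)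
      have Y: "?Y \<in> Arr C" "Dom C ?Y = Dom C w" "Cod C ?Y = S" using e'(3) yS w by simp_all
      have eq: "\<iota> n \<odot> ?X = d \<odot> ?Y"
      proof -
        have "\<iota> n \<odot> ?X = \<iota> n \<odot> (x \<odot> e') \<odot> w" by (rule assoc[symmetric]) (use s w xe in simp_all)
        also have "\<dots> = d \<odot> ?Y" unfolding key by (rule assoc) (use d w e'(3) yS in simp_all)
        finally show ?thesis .
      qed
      have Y0: "\<pi> 0 \<odot> ?Y = (\<pi> 0 \<odot> \<iota> n) \<odot> ?X"
      proof -
        have "(\<pi> 0 \<odot> \<iota> n) \<odot> ?X = \<pi> 0 \<odot> (d \<odot> ?Y)" unfolding eq[symmetric]
          by (rule assoc) (use \<pi>(1-3) s X in simp_all)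
        also have "\<dots> = \<pi> 0 \<odot> ?Y" by (rule comp_subst[OF \<pi>d0]) (use \<pi>(1-3) d(1-3) Y in simp_all)
        finally show ?thesis by simp
      qed
      have YS: "(\<pi> (Suc k) \<odot> \<iota> n) \<odot> ?X = \<pi> (Suc k) \<odot> ?Y \<ominus> t k \<odot> (\<pi> k \<odot> ?Y)" for k
      proof -
        have "(\<pi> (Suc k) \<odot> \<iota> n) \<odot> ?X = \<pi> (Suc k) \<odot> (d \<odot> ?Y)" unfolding eq[symmetric]
          by (rule assoc) (use \<pi>(1-3) s X in simp_all)
        also have "\<dots> = (\<pi> (Suc k) \<ominus> t k \<odot> \<pi> k) \<odot> ?Y"
          by (rule comp_subst[OF \<pi>dS]) (use \<pi>(1-3) d(1-3) Y in simp_all)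
        also have "\<dots> = \<pi> (Suc k) \<odot> ?Y \<ominus> (t k \<odot> \<pi> k) \<odot> ?Y"
          by (rule sub_comp) (use \<pi>(1-3) tA tM Y in simp_all)
        also have "(t k \<odot> \<pi> k) \<odot> ?Y = t k \<odot> (\<pi> k \<odot> ?Y)"
          by (rule assoc) (use \<pi>(1-3) tA tM Y in simp_all)
        finally show ?thesis .
      qed
      have \<pi>Y: "\<pi> k \<odot> ?Y \<in> Arr C" "Dom C (\<pi> k \<odot> ?Y) = Dom C w" "Cod C (\<pi> k \<odot> ?Y) = M k" for k
        using \<pi>(1-3) Y by (simp_all del: assoc)
      have XZ: "(\<pi> k \<odot> \<iota> n) \<odot> ?X = Zero C (Dom C w) (M k)" if "k \<noteq> n" for k
        using \<pi>0[of n k] that X MO by (simp del: assoc)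
      have XI: "(\<pi> n \<odot> \<iota> n) \<odot> ?X = ?X" using \<pi>(4) X by (simp del: assoc)
      have tY: "t k \<odot> (\<pi> k \<odot> ?Y) \<in> Arr C" "Dom C (t k \<odot> (\<pi> k \<odot> ?Y)) = Dom C w" "Cod C (t k \<odot> (\<pi> k \<odot> ?Y)) = M (Suc k)" for k
        using tA tM \<pi>Y by (simp_all del: assoc)
      have low: "null (\<pi> k \<odot> ?Y)" if "k < n" for k
        using that
      proof (induction k)
        case 0
        then show ?case unfolding Y0 using XZ[of 0] w(1) MO by (simp del: assoc)
      next
        case (Suc k)
        then have n1: "null (\<pi> k \<odot> ?Y)" by simp
        then have n2: "null (t k \<odot> (\<pi> k \<odot> ?Y))" using tA tM \<pi>Y by (rule_tac null_comp1) (simp_all del: assoc)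
        have "null (\<pi> (Suc k) \<odot> ?Y \<ominus> t k \<odot> (\<pi> k \<odot> ?Y))"
          unfolding YS[symmetric] using XZ[of "Suc k"] Suc w(1) MO by (simp del: assoc)
        then show ?case using n2 \<pi>Y tY by (simp del: assoc)
      qed
      have at: "\<pi> n \<odot> ?Y = ?X"
      proof (cases n)
        case 0
        then show ?thesis using Y0 XI by simp
      next
        case (Suc k)
        have n1: "null (\<pi> k \<odot> ?Y)" using low Suc by simp
        then have "null (t k \<odot> (\<pi> k \<odot> ?Y))" using tA tM \<pi>Y by (rule_tac null_comp1) (simp_all del: assoc)
        then have "t k \<odot> (\<pi> k \<odot> ?Y) = Zero C (Dom C w) (M (Suc k))" by (rule null_eq) (use tY in simp_all)
        then show ?thesis using YS[of k] XI Suc \<pi>Y by (simp del: assoc)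
      qed
      \<comment> \<open>Above \<open>n\<close> the coordinate \<open>Suc k\<close> equals
        \<open>t k\<close> applied to the coordinate \<open>k\<close>; as \<open>t k\<close> is
        monic, vanishing propagates downwards.\<close>
      have up: "null (\<pi> k \<odot> ?Y)" if "null (\<pi> (Suc k) \<odot> ?Y)" "k \<ge> n" for k
      proof -
        have "null (\<pi> (Suc k) \<odot> ?Y \<ominus> t k \<odot> (\<pi> k \<odot> ?Y))"
          unfolding YS[symmetric] using XZ[of "Suc k"] that w(1) MO by (simp del: assoc)
        then have "null (t k \<odot> (\<pi> k \<odot> ?Y))" using that(1) \<pi>Y tY by (simp del: assoc)
        then show ?thesis using mono_null[OF t(1)[of k], of "\<pi> k \<odot> ?Y"] \<pi>Y tM by simp
      qed
      have down: "null (\<pi> (n + k) \<odot> ?Y) \<Longrightarrow> null (\<pi> n \<odot> ?Y)" for k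
      proof (induction k)
        case (Suc k)
        then show ?case using up[of "n + k"] by (simp del: assoc)
      qed (simp del: assoc)
      \<comment> \<open>The bound on the support puts the coordinate \<open>n + k\<close> outside
        it, so descent reaches the coordinate \<open>n\<close>, which is \<open>?X\<close>.\<close>
      obtain k where k: "A \<subseteq> {..<k}" using A finite_nat_iff_bounded by blast
      have "null (\<pi> (n + k) \<odot> ?Y)"
        by (rule supportedD[OF w(3) \<pi>(1,2) \<pi>(5)]) (use k in auto)
      then have "null (\<pi> n \<odot> ?Y)" by (rule down)
      then show "null (x \<odot> e' \<odot> w)" unfolding at .
    qed
    then show "null x" using epi_null[OF e'(1), of x] x(1) zD e'(2) by simp
  qed
  show ?thesis
  proof (rule that[of "Cod C q" "\<lambda>n. q \<odot> \<iota> n"])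
    show "is_mono C (q \<odot> \<iota> n)" for n by (rule mono)
    show "q \<odot> \<iota> (Suc n) \<odot> t n = q \<odot> \<iota> n" for n by (rule step)
    fix g assume g: "g \<in> Arr C" "Dom C g = Cod C q" "\<And>n. null (g \<odot> (q \<odot> \<iota> n))"
    have "null (g \<odot> q)"
      by (rule coproduct_null[OF S]) (use g q'(1) qD s in simp_all)
    then show "null g" using epi_null[OF q'(5), of g] g by simp
  qed (use q'(1) qD s tM in simp_all)
qed

end

context locally_noetherian_grothendieck_category
begin

text \<open>By Baer's criterion only arrows from subobjects of noetherian generators matter. The
  preimages of the stages \<open>u n\<close> in such a source form an ascending chain that becomes
  stationary and covers the source, so the arrow already lands in one stage and extends in the
  next.\<close>

lemma enough_injectives:
  assumes A: "A \<in> Obj C"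
  obtains m where "is_mono C m" "Dom C m = A" "injective_object C (Cod C m)"
proof -
  obtain \<G> where G: "is_small small \<G>" "generating_set C \<G>" "\<And>G. G \<in> \<G> \<Longrightarrow> noetherian C G"
    using ex_noetherian_generators by blast
  have GO: "\<G> \<subseteq> Obj C" using G(2) by (simp add: generating_set_def)
  define ext where "ext t \<longleftrightarrow> is_mono C t \<and>
    (\<forall>k f. Cod C k \<in> \<G> \<longrightarrow> is_mono C k \<longrightarrow> f \<in> Arr C \<longrightarrow> Dom C f = Dom C k \<longrightarrow> Cod C f = Dom C t \<longrightarrow>
      (\<exists>u\<in>Arr C. Dom C u = Cod C k \<and> Cod C u = Cod C t \<and> u \<odot> k = t \<odot> f))" for t
  have ex: "\<exists>t. ext t \<and> Dom C t = M" if M: "M \<in> Obj C" for M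
  proof -
    obtain t where "is_mono C t" "Dom C t = M"
      "\<And>k f. Cod C k \<in> \<G> \<Longrightarrow> is_mono C k \<Longrightarrow> f \<in> Arr C \<Longrightarrow> Dom C f = Dom C k \<Longrightarrow> Cod C f = M \<Longrightarrow>
        \<exists>u\<in>Arr C. Dom C u = Cod C k \<and> Cod C u = Cod C t \<and> u \<odot> k = t \<odot> f"
      using extension_step[OF G(1) GO M] by blast
    then show ?thesis unfolding ext_def by blast
  qed
  \<comment> \<open>The clause for \<open>n = 0\<close> fixes the first stage as \<open>A\<close>
    within the dependent choice.\<close>
  have "\<exists>t. \<forall>n::nat. (ext (t n) \<and> (n = 0 \<longrightarrow> Dom C (t n) = A)) \<and> Dom C (t (Suc n)) = Cod C (t n)"
  proof (rule dependent_nat_choice)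
    show "\<exists>t. ext t \<and> ((0::nat) = 0 \<longrightarrow> Dom C t = A)" using ex[OF A] by blast
    fix t and n :: nat assume "ext t \<and> (n = 0 \<longrightarrow> Dom C t = A)"
    then have "Cod C t \<in> Obj C" unfolding ext_def by simp
    then show "\<exists>t'. (ext t' \<and> (Suc n = 0 \<longrightarrow> Dom C t' = A)) \<and> Dom C t' = Cod C t" using ex by blast
  qed
  then obtain t where t: "\<And>n::nat. ext (t n)" "Dom C (t 0) = A" "\<And>n. Dom C (t (Suc n)) = Cod C (t n)"
    by blast
  have tm: "is_mono C (t n)" for n using t(1)[of n] unfolding ext_def by blast
  obtain E u where u: "E \<in> Obj C" "\<And>n. is_mono C (u n)" "\<And>n. Dom C (u n) = Dom C (t n)"
    "\<And>n. Cod C (u n) = E" "\<And>n. u (Suc n) \<odot> t n = u n"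
    "\<And>g. g \<in> Arr C \<Longrightarrow> Dom C g = E \<Longrightarrow> (\<And>n. null (g \<odot> u n)) \<Longrightarrow> null g"
    by (rule sequence_limit[of t]) (use tm t(3) in blast)+
  have uA: "u n \<in> Arr C" and tA: "t n \<in> Arr C" for n using u(2)[of n] tm[of n] by simp_all
  have u_mono: "u m \<preceq> u n" if "m \<le> n" for m n
    using that
  proof (induction rule: dec_induct)
    case (step n)
    have "u n \<preceq> u (Suc n)" by (rule leI[of "t n"]) (use uA tA u(3-5) t(3) in simp_all)
    then show ?case using le_trans step uA by blast
  qed (use uA in simp)
  have "injective_object C E"
  proof (rule baer[OF G(2) u(1)])
    fix k f assume k: "Cod C k \<in> \<G>" "is_mono C k" and f: "f \<in> Arr C" "Dom C f = Dom C k" "Cod C f = E"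
    have kA: "k \<in> Arr C" using k by simp
    have N: "noetherian C (Dom C f)" using noetherian_mono[OF k(2) G(3)[OF k(1)]] f by simp
    have "\<forall>n. \<exists>p. is_mono C p \<and> Cod C p = Dom C f \<and>
      (\<forall>x\<in>Arr C. Cod C x = Dom C f \<longrightarrow> (x \<preceq> p \<longleftrightarrow> f \<odot> x \<preceq> u n))"
    proof
      fix n
      have "Cod C f = Cod C (u n)" using f u(4) by simp
      then obtain p where "is_mono C p" "Cod C p = Dom C f"
        "\<And>x. x \<in> Arr C \<Longrightarrow> Cod C x = Dom C f \<Longrightarrow> x \<preceq> p \<longleftrightarrow> f \<odot> x \<preceq> u n"
        using preimageE[OF u(2) f(1)] by metis
      then show "\<exists>p. is_mono C p \<and> Cod C p = Dom C f \<and>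
          (\<forall>x\<in>Arr C. Cod C x = Dom C f \<longrightarrow> (x \<preceq> p \<longleftrightarrow> f \<odot> x \<preceq> u n))" by blast
    qed
    from choice[OF this] obtain p where p: "\<And>n. is_mono C (p n)" "\<And>n. Cod C (p n) = Dom C f"
      "\<And>n x. x \<in> Arr C \<Longrightarrow> Cod C x = Dom C f \<Longrightarrow> x \<preceq> p n \<longleftrightarrow> f \<odot> x \<preceq> u n" by blast
    have pA: "p n \<in> Arr C" for n using p(1)[of n] by simp
    have p_mono: "p m \<preceq> p n" if "m \<le> n" for m n
      using p(3)[OF pA p(2), of m m] p(3)[OF pA p(2), of m n] le_trans[OF _ u_mono[OF that] uA] pA by simp
    obtain n where n: "\<And>m. m \<ge> n \<Longrightarrow> p m \<preceq> p n"
      using noetherian_chain[of _ p, OF N p(1,2) p_mono[OF le_SucI[OF order_refl]]] by blast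
    obtain c where c: "short_exact C (p n) c" using p(1) mono_ses by blast
    note cs = ses_simps[OF c]
    have cD: "Dom C c = Dom C f" using cs p(2) by simp
    \<comment> \<open>The stages cover \<open>E\<close>, so their preimages cover the source of
      \<open>f\<close>; as all of these lie in \<open>p n\<close>, the cokernel of
      \<open>p n\<close> vanishes.\<close>
    have "null c"
    proof (rule directed_cover[OF is_small_nat _ u(2,4) _ u(6) f(1,3) cs(2) cD])
      show "\<exists>k\<in>UNIV. u i \<preceq> u k \<and> u j \<preceq> u k" for i j
        using u_mono[of i "max i j"] u_mono[of j "max i j"] by auto
      fix i x assume x: "x \<in> Arr C" "Cod C x = Dom C f" "f \<odot> x \<preceq> u i"
      then have "x \<preceq> p i" using p(3) by blast
      moreover have "p i \<preceq> p n" using n p_mono by (cases "i \<ge> n") auto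
      ultimately have "x \<preceq> p n" using le_trans pA by blast
      then show "null (c \<odot> x)" using ses_le_iff[OF c, of x] x cD by simp
    qed simp_all
    then have "Ident C (Dom C f) \<preceq> p n" using ses_le_iff[OF c, of "Ident C (Dom C f)"] f cD cs kA by simp
    then have "f \<preceq> u n" using p(3)[of "Ident C (Dom C f)" n] f kA by simp
    then obtain f' where f': "f' \<in> Arr C" "Dom C f' = Dom C f" "Cod C f' = Dom C (u n)" "u n \<odot> f' = f"
      by (rule leE)
    have f'C: "Cod C f' = Dom C (t n)" "Dom C f' = Dom C k" using f' u(3) f by simp_all
    have "\<exists>v\<in>Arr C. Dom C v = Cod C k \<and> Cod C v = Cod C (t n) \<and> v \<odot> k = t n \<odot> f'"
      using t(1)[of n] k f'(1) f'C unfolding ext_def by blast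
    then obtain v where v: "v \<in> Arr C" "Dom C v = Cod C k" "Cod C v = Cod C (t n)" "v \<odot> k = t n \<odot> f'"
      by blast
    have "u (Suc n) \<odot> v \<odot> k = u (Suc n) \<odot> (t n \<odot> f')" using v uA u(3) t(3) kA by simp
    also have "\<dots> = f" using comp_subst[OF u(5), of f'] f' f'C uA tA u(3) t(3) by simp
    finally show "\<exists>g\<in>Arr C. Dom C g = Cod C k \<and> Cod C g = E \<and> g \<odot> k = f"
      using v uA u(3,4) t(3) by (intro bexI[of _ "u (Suc n) \<odot> v"]) simp_all
  qed
  then show ?thesis using that[of "u 0"] u(2-4) t(2) by simp
qed

end

context grothendieck_category
begin

text \<open>The summand produced here is an injective hull of \<open>h\<close>: a maximal subobject containing
  \<open>h\<close> that is disjoint from a maximal complement of \<open>h\<close>.\<close>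

lemma essential_summand:
  assumes I: "injective_object C I" and h: "is_mono C h" "Cod C h = I"
  obtains N L i1 i2 p1 p2 h' where "is_biproduct C N L I i1 i2 p1 p2"
    "is_mono C h'" "Dom C h' = Dom C h" "Cod C h' = N" "i1 \<odot> h' = h"
    "\<And>x. x \<in> Arr C \<Longrightarrow> Cod C x = N \<Longrightarrow> \<not> null x \<Longrightarrow>
      \<exists>y w. y \<in> Arr C \<and> Cod C y = Dom C x \<and> w \<in> Arr C \<and> Cod C w = Dom C h \<and> Dom C w = Dom C y \<and>
        x \<odot> y = h' \<odot> w \<and> \<not> null (x \<odot> y)"
proof -
  have hA: "h \<in> Arr C" using h by simp
  have IO: "I \<in> Obj C" using I injective_Obj by blast
  obtain Z where Z: "is_zero C Z" using ex_zero by blast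
  have ZO: "Z \<in> Obj C" using Z is_zero_Obj by blast
  obtain l where l: "is_mono C l" "Cod C l = I" "disj l h"
    "\<And>l'. is_mono C l' \<Longrightarrow> Cod C l' = I \<Longrightarrow> l \<preceq> l' \<Longrightarrow> disj l' h \<Longrightarrow> l' \<preceq> l"
  proof (rule maximal_disj[of h I "Zero C Z I"])
    show "is_mono C (Zero C Z I)" "disj (Zero C Z I) h"
      using zero_mono disj_zero Z IO by simp_all
  qed (use hA h IO ZO in simp_all)
  have lA: "l \<in> Arr C" using l by simp
  have dhl: "disj h l" using l(3) unfolding disj_def by blast
  obtain n where n: "is_mono C n" "Cod C n = I" "h \<preceq> n" "disj n l"
    "\<And>n'. is_mono C n' \<Longrightarrow> Cod C n' = I \<Longrightarrow> n \<preceq> n' \<Longrightarrow> disj n' l \<Longrightarrow> n' \<preceq> n"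
    using maximal_disj[OF lA l(2) h(1,2) dhl] by blast
  have nA: "n \<in> Arr C" using n by simp
  obtain c where c: "short_exact C l c" using l mono_ses by blast
  note cs = ses_simps[OF c]
  have cD: "Dom C c = I" using cs l by simp
  have lC: "Cod C l = Cod C h" using l h by simp
  have ess: "\<exists>y w. y \<in> Arr C \<and> Cod C y = Dom C x \<and> w \<in> Arr C \<and> Cod C w = Dom C h \<and> Dom C w = Dom C y \<and>
      x \<odot> y = c \<odot> (h \<odot> w) \<and> \<not> null (x \<odot> y)"
    if x: "x \<in> Arr C" "Cod C x = Cod C c" "\<not> null x" for x
  proof -
    obtain y w where "y \<in> Arr C" "Cod C y = Dom C x" "w \<in> Arr C" "Cod C w = Dom C h" "Dom C w = Dom C y"
      "x \<odot> y = c \<odot> (h \<odot> w)" "\<not> null (x \<odot> y)"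
      by (rule maximal_disj_essential[OF h(1) l(1) lC l(3) _ c x]) (use l(4) h(2) in auto)
    then show ?thesis by blast
  qed
  have ker: "x \<preceq> l \<longleftrightarrow> null (c \<odot> x)" if "x \<in> Arr C" "Cod C x = I" for x
    using ses_le_iff[OF c that(1)] that cD by simp
  have cn: "is_mono C (c \<odot> n)"
  proof (rule monoI)
    show "c \<odot> n \<in> Arr C" using cs cD n nA by simp
    fix x assume x: "x \<in> Arr C" "Cod C x = Dom C (c \<odot> n)" "null (c \<odot> n \<odot> x)"
    have xC: "Cod C x = Dom C n" using x(2) cs cD n nA by simp
    have "n \<odot> x \<preceq> l" using ker[of "n \<odot> x"] x(1,3) xC cs cD n nA by simp
    then have "null (n \<odot> x)" using disjD[OF n(4)] nA x(1) xC by simp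
    then show "null x" using mono_null[OF n(1) x(1) xC] by simp
  qed
  have cnA: "c \<odot> n \<in> Arr C" "Dom C (c \<odot> n) = Dom C n" "Cod C (c \<odot> n) = Cod C c" using cs cD n nA by simp_all
  \<comment> \<open>Injectivity extends \<open>n\<close> from the quotient by \<open>l\<close> back
    to \<open>I\<close>. Since \<open>h\<close> is essential in that quotient, \<open>g\<close> is
    monic and disjoint from \<open>l\<close>, and maximality of \<open>n\<close> leaves no room
    beyond \<open>n\<close>.\<close>
  obtain g where g: "g \<in> Arr C" "Dom C g = Cod C c" "Cod C g = I" "g \<odot> (c \<odot> n) = n"
    using injectiveE[OF I cn nA] n cnA by metis
  obtain h' where h': "h' \<in> Arr C" "Dom C h' = Dom C h" "Cod C h' = Dom C n" "n \<odot> h' = h"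
    using n(3) by (rule leE)
  have gch: "g \<odot> (c \<odot> (h \<odot> w)) = h \<odot> w" if w: "w \<in> Arr C" "Cod C w = Dom C h" for w
  proof -
    have hw: "h \<odot> w = n \<odot> (h' \<odot> w)" using comp_subst[OF h'(4), of w] h' w nA by simp
    have "g \<odot> (c \<odot> (h \<odot> w)) = g \<odot> ((c \<odot> n) \<odot> (h' \<odot> w))" unfolding hw using h'(1-3) w nA cs(2) cD n(2) by simp
    also have "\<dots> = n \<odot> (h' \<odot> w)" by (rule comp_subst[OF g(4)]) (use h' w cnA g in simp_all)
    finally show ?thesis unfolding hw .
  qed
  have gm: "is_mono C g"
  proof (rule monoI[OF g(1)])
    fix x assume x: "x \<in> Arr C" "Cod C x = Dom C g" "null (g \<odot> x)"
    show "null x"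
    proof (rule ccontr)
      assume "\<not> null x"
      then obtain y w where y: "y \<in> Arr C" "Cod C y = Dom C x" "w \<in> Arr C" "Cod C w = Dom C h" "Dom C w = Dom C y"
        "x \<odot> y = c \<odot> (h \<odot> w)" "\<not> null (x \<odot> y)"
        using ess[of x] x(1,2) g(2) by auto
      have "null ((g \<odot> x) \<odot> y)" using x y(1,2) g by (rule_tac null_comp2) simp_all
      then have "null (g \<odot> (x \<odot> y))" using x y(1,2) g by simp
      then have "null (h \<odot> w)" unfolding y(6) gch[OF y(3,4)] .
      then have "null (c \<odot> (h \<odot> w))" using cs cD h hA y by (rule_tac null_comp1) simp_all
      then show False using y by simp
    qed
  qed
  have "disj g l" unfolding disj_def
  proof (intro allI impI)
    fix x assume x: "x \<preceq> g" "x \<preceq> l"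
    obtain z where z: "z \<in> Arr C" "Dom C z = Dom C x" "Cod C z = Dom C g" "g \<odot> z = x" using x(1) by (rule leE)
    show "null x"
    proof (rule ccontr)
      assume "\<not> null x"
      then have "\<not> null z" using mono_null[OF gm, of z] z by simp
      then obtain y w where y: "y \<in> Arr C" "Cod C y = Dom C z" "w \<in> Arr C" "Cod C w = Dom C h" "Dom C w = Dom C y"
        "z \<odot> y = c \<odot> (h \<odot> w)" "\<not> null (z \<odot> y)"
        using ess[of z] z(1,3) g(2) by auto
      have "x \<odot> y = g \<odot> (z \<odot> y)" using comp_subst[OF z(4), of y] z g y by simp
      then have xy: "x \<odot> y = h \<odot> w" by (simp only: y(6) gch[OF y(3,4)])
      have "x \<odot> y \<preceq> l" using le_comp[OF x(2)] y z lA by simp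
      then have "null (h \<odot> w)" unfolding xy using disjD[OF l(3)] y hA by simp
      then have "null (c \<odot> (h \<odot> w))" using cs cD h hA y by (rule_tac null_comp1) simp_all
      then show False using y by simp
    qed
  qed
  moreover have "n \<preceq> g" by (rule leI[of "c \<odot> n"]) (use cnA g in simp_all)
  ultimately have "g \<preceq> n" using n(5) gm g by blast
  then obtain b where b: "b \<in> Arr C" "Dom C b = Dom C g" "Cod C b = Dom C n" "n \<odot> b = g" by (rule leE)
  have nbc: "n \<odot> (b \<odot> (c \<odot> n)) = n"
    using comp_subst[OF b(4), of "c \<odot> n"] b(1-3) g(1,2,4) cnA nA by (simp del: assoc)
  \<comment> \<open>The projection onto \<open>n\<close>: it is the identity on \<open>n\<close>,
    and its kernel is \<open>l\<close> because \<open>b\<close> is monic.\<close>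
  let ?p1 = "b \<odot> c"
  have p1: "?p1 \<in> Arr C" "Dom C ?p1 = I" "Cod C ?p1 = Dom C n" using b g cs cD by simp_all
  have p1n: "?p1 \<odot> n = Ident C (Dom C n)"
    by (rule mono_cancel[OF n(1)]) (use nbc b(1-3) g(1,2) cs cD n(2) nA in simp_all)
  have p1_null: "x \<preceq> l" if x: "x \<in> Arr C" "Cod C x = I" "null (?p1 \<odot> x)" for x
  proof -
    have bm: "is_mono C b" by (rule mono_factor[of n]) (use b gm nA in simp_all)
    have "null (b \<odot> (c \<odot> x))" using x b(1,2) g cs cD by simp
    then have "null (c \<odot> x)" using mono_null[OF bm, of "c \<odot> x"] x b(2) g cs cD by simp
    then show ?thesis using ker x by simp
  qed
  have p1l: "null (?p1 \<odot> l)"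
  proof -
    have "null (b \<odot> (c \<odot> l))" using cs b(1,2) g by (rule_tac null_comp1) simp_all
    then show ?thesis using cs b(1,2) g by simp
  qed
  \<comment> \<open>The idempotent complementary to \<open>n \<odot> ?p1\<close> is killed by
    \<open>?p1\<close>, hence factors through \<open>l\<close>; the factor is the second
    projection.\<close>
  let ?q = "Ident C I \<ominus> n \<odot> ?p1"
  have nA': "Cod C n = I" by (rule n(2))
  have q: "?q \<in> Arr C" "Dom C ?q = I" "Cod C ?q = I" using p1 nA n(2) IO by simp_all
  have "?p1 \<odot> ?q = ?p1 \<ominus> ?p1 \<odot> (n \<odot> ?p1)"
    using comp_sub[of "Ident C I" "n \<odot> ?p1" ?p1] p1 nA n(2) IO by (simp del: assoc)
  also have "?p1 \<odot> (n \<odot> ?p1) = ?p1" using comp_subst[OF p1n p1(1)] p1 nA n(2) by (simp del: assoc)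
  finally have "null (?p1 \<odot> ?q)" using p1 by (simp del: assoc)
  then have "?q \<preceq> l" using p1_null[OF q(1) q(3)] by simp
  then obtain p2 where p2: "p2 \<in> Arr C" "Dom C p2 = I" "Cod C p2 = Dom C l" "l \<odot> p2 = ?q"
    using q by (auto elim: leE)
  have qn: "null (?q \<odot> n)"
  proof -
    have "?q \<odot> n = Ident C I \<odot> n \<ominus> n \<odot> ?p1 \<odot> n"
      using sub_comp[of "Ident C I" "n \<odot> ?p1" n] p1 nA n(2) IO by (simp del: assoc)
    also have "n \<odot> ?p1 \<odot> n = n \<odot> (?p1 \<odot> n)" by (rule assoc) (use p1 nA n(2) in simp_all)
    finally show ?thesis using p1n nA n(2) by (simp del: assoc)
  qed
  have ql: "?q \<odot> l = l"
  proof -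
    have "?q \<odot> l = Ident C I \<odot> l \<ominus> n \<odot> ?p1 \<odot> l"
      using sub_comp[of "Ident C I" "n \<odot> ?p1" l] p1 nA n(2) IO lA l(2) by (simp del: assoc)
    also have "n \<odot> ?p1 \<odot> l = n \<odot> (?p1 \<odot> l)" by (rule assoc) (use p1 nA n(2) lA l(2) in simp_all)
    also have "?p1 \<odot> l = Zero C (Dom C l) (Dom C n)"
      by (rule null_eq[OF p1l]) (use p1 lA l(2) in \<open>simp_all del: assoc\<close>)
    finally show ?thesis using nA n(2) lA l(2) by simp
  qed
  have p2l: "p2 \<odot> l = Ident C (Dom C l)"
    by (rule mono_cancel[OF l(1)]) (use comp_subst[OF p2(4), of l] ql p2(1-3) lA l(2) in simp_all)
  have p2n: "null (p2 \<odot> n)"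
    using mono_null[OF l(1), of "p2 \<odot> n"] comp_subst[OF p2(4), of n] qn p2(1-3) lA l(2) nA n(2) by simp
  have "is_biproduct C (Dom C n) (Dom C l) I n l ?p1 p2"
    unfolding is_biproduct_def
  proof (intro conjI)
    show "?p1 \<odot> l = Zero C (Dom C l) (Dom C n)"
      by (rule null_eq[OF p1l]) (use p1 lA l(2) in \<open>simp_all del: assoc\<close>)
    show "p2 \<odot> n = Zero C (Dom C n) (Dom C l)"
      by (rule null_eq[OF p2n]) (use p2 nA n(2) in simp_all)
    have "?q \<boxplus> n \<odot> ?p1 = Ident C I" by (rule sub_add) (use p1 nA n(2) IO in simp_all)
    then have "l \<odot> p2 \<boxplus> n \<odot> ?p1 = Ident C I" using p2 by simp
    moreover have "l \<odot> p2 \<boxplus> n \<odot> ?p1 = n \<odot> ?p1 \<boxplus> l \<odot> p2"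
    proof -
      interpret H: comm_group "Hom_group C I I" using Hom_comm_group[OF IO IO] .
      show ?thesis using H.m_comm[of "l \<odot> p2" "n \<odot> ?p1"] p1 p2(1-3) lA l(2) nA n(2)
        by (simp add: Hom_group_def del: assoc)
    qed
    ultimately show "n \<odot> ?p1 \<boxplus> l \<odot> p2 = Ident C I" by simp
  qed (use p1 p1n p2 p2l lA l(2) nA n(2) IO in \<open>simp_all del: assoc\<close>)
  moreover have "is_mono C h'" by (rule mono_factor[of n]) (use h h' nA in simp_all)
  moreover have "\<exists>y w. y \<in> Arr C \<and> Cod C y = Dom C x \<and> w \<in> Arr C \<and> Cod C w = Dom C h \<and> Dom C w = Dom C y \<and>
        x \<odot> y = h' \<odot> w \<and> \<not> null (x \<odot> y)" if x: "x \<in> Arr C" "Cod C x = Dom C n" "\<not> null x" for x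
  proof -
    have "\<not> null (c \<odot> n \<odot> x)" using mono_null[OF cn, of x] x cnA by simp
    then obtain y w where y: "y \<in> Arr C" "Cod C y = Dom C x" "w \<in> Arr C" "Cod C w = Dom C h" "Dom C w = Dom C y"
        "(c \<odot> n \<odot> x) \<odot> y = c \<odot> (h \<odot> w)" "\<not> null ((c \<odot> n \<odot> x) \<odot> y)"
      using ess[of "c \<odot> n \<odot> x"] x cnA by (auto simp del: assoc)
    have xy: "x \<odot> y = h' \<odot> w"
    proof (rule mono_cancel[OF cn])
      have "c \<odot> n \<odot> (x \<odot> y) = (c \<odot> n \<odot> x) \<odot> y" by (rule assoc[symmetric]) (use x y cnA in simp_all)
      also have "\<dots> = c \<odot> (h \<odot> w)" by (rule y(6))
      also have "h \<odot> w = n \<odot> (h' \<odot> w)" using comp_subst[OF h'(4), of w] h' y nA by simp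
      also have "c \<odot> (n \<odot> (h' \<odot> w)) = c \<odot> n \<odot> (h' \<odot> w)" by (rule assoc[symmetric]) (use h' y nA cs cD n in simp_all)
      finally show "c \<odot> n \<odot> (x \<odot> y) = c \<odot> n \<odot> (h' \<odot> w)" .
    qed (use x y(1-5) h' cnA in simp_all)
    have "\<not> null (x \<odot> y)"
    proof
      assume "null (x \<odot> y)"
      then have "null (c \<odot> n \<odot> (x \<odot> y))" using x y(1,2) cnA by (rule_tac null_comp1) simp_all
      moreover have "c \<odot> n \<odot> (x \<odot> y) = (c \<odot> n \<odot> x) \<odot> y" by (rule assoc[symmetric]) (use x y cnA in simp_all)
      ultimately show False using y(7) by simp
    qed
    then show ?thesis using xy y by blast
  qed
  ultimately show ?thesis using that h' by blast
qed

end

section \<open>Monoform objects and atoms\<close>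

context abelian_category
begin

lemma embeds_iff: "embeds C X Y \<longleftrightarrow> (\<exists>f. is_mono C f \<and> Dom C f = X \<and> Cod C f = Y)"
  unfolding embeds_def by auto

lemma embedsI: "is_mono C f \<Longrightarrow> embeds C (Dom C f) (Cod C f)"
  unfolding embeds_iff by blast

lemma embeds_refl: "X \<in> Obj C \<Longrightarrow> embeds C X X"
  using embedsI[of "Ident C X"] by simp

lemma embeds_trans:
  assumes "embeds C X Y" "embeds C Y Z" shows "embeds C X Z"
proof -
  obtain f g where "is_mono C f" "Dom C f = X" "Cod C f = Y" "is_mono C g" "Dom C g = Y" "Cod C g = Z"
    using assms unfolding embeds_iff by auto
  then show ?thesis using embedsI[of "g \<odot> f"] mono_comp[of f g] by simp
qed

lemma embeds_Obj: "embeds C X Y \<Longrightarrow> X \<in> Obj C \<and> Y \<in> Obj C"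
  unfolding embeds_iff by auto

lemma isomorphic_embeds: "isomorphic C A B \<Longrightarrow> embeds C A B"
  by (erule isomorphicE) (use embedsI in auto)

lemma common_nonzero_subobject_sym:
  "common_nonzero_subobject C A B \<Longrightarrow> common_nonzero_subobject C B A"
  unfolding common_nonzero_subobject_def by blast

lemma common_nonzero_subobject_embeds:
  "common_nonzero_subobject C A B \<Longrightarrow> embeds C A A' \<Longrightarrow> embeds C B B' \<Longrightarrow> common_nonzero_subobject C A' B'"
  unfolding common_nonzero_subobject_def using embeds_trans by blast

text \<open>The common subobject is the image of the shared element \<open>z\<close>, which lies in
  both subobjects because they can be tested on the epi part of \<open>z\<close>.\<close>

lemma common_nonzero_subobjectI:
  assumes a: "is_mono C a" and b: "is_mono C b" "Cod C b = Cod C a"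
    and z: "z \<preceq> a" "z \<preceq> b" "\<not> null z"
  shows "common_nonzero_subobject C (Dom C a) (Dom C b)"
proof -
  have aA: "a \<in> Arr C" "b \<in> Arr C" using a b by simp_all
  have zA: "z \<in> Arr C" "Cod C z = Cod C a" using le_Arr[OF z(1)] le_Cod[OF z(1)] aA by simp_all
  obtain e m where e: "is_epi C e" "is_mono C m" "Cod C e = Dom C m" "Dom C e = Dom C z"
    "Cod C m = Cod C z" "m \<odot> e = z"
    using image_factorization[OF zA(1)] by blast
  have eA: "e \<in> Arr C" "m \<in> Arr C" using e by simp_all
  have *: "embeds C (Dom C m) (Dom C d)" if d: "is_mono C d" "Cod C d = Cod C a" "z \<preceq> d" for d
  proof -
    have "m \<preceq> d" by (rule le_epi[OF d(1) e(1)]) (use d e eA zA in simp_all)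
    then obtain u where u: "u \<in> Arr C" "Dom C u = Dom C m" "Cod C u = Dom C d" "d \<odot> u = m" by (rule leE)
    have "is_mono C u" by (rule mono_factor[of d]) (use u d e in simp_all)
    then show ?thesis using u embedsI[of u] by simp
  qed
  have "\<not> null m" using z(3) e eA null_comp2[of m e] by auto
  then have "\<not> is_zero C (Dom C m)" using zero_Dom_iff e by blast
  moreover have "Dom C m \<in> Obj C" using eA by simp
  ultimately show ?thesis
    unfolding common_nonzero_subobject_def using *[OF a refl z(1)] *[OF b z(2)] by blast
qed

text \<open>Any two nonzero subobjects meet. The version for arbitrary nonzero arrows applies to
  elements directly; it holds vacuously for a zero object, so nonvanishing is assumed separately
  where it matters.\<close>

definition uniform where
  "uniform M \<longleftrightarrow> (\<forall>x z. x \<in> Arr C \<longrightarrow> Cod C x = M \<longrightarrow> \<not> null x \<longrightarrow> z \<in> Arr C \<longrightarrow> Cod C z = M \<longrightarrow> \<not> null z \<longrightarrow>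
    (\<exists>y w. y \<in> Arr C \<and> w \<in> Arr C \<and> Cod C y = Dom C x \<and> Cod C w = Dom C z \<and> Dom C y = Dom C w \<and>
      x \<odot> y = z \<odot> w \<and> \<not> null (x \<odot> y)))"

lemma uniformE:
  assumes "uniform M" "x \<in> Arr C" "Cod C x = M" "\<not> null x" "z \<in> Arr C" "Cod C z = M" "\<not> null z"
  obtains y w where "y \<in> Arr C" "w \<in> Arr C" "Cod C y = Dom C x" "Cod C w = Dom C z" "Dom C y = Dom C w"
    "x \<odot> y = z \<odot> w" "\<not> null (x \<odot> y)"
  using assms unfolding uniform_def by blast

text \<open>A nonzero element common to the images of \<open>x\<close> and \<open>z\<close> is
  lifted to both sources by two successive covers, and covers do not kill it.\<close>

lemma uniform_if_mono_meet:
  assumes "\<And>m n. is_mono C m \<Longrightarrow> is_mono C n \<Longrightarrow> Cod C m = M \<Longrightarrow> Cod C n = M \<Longrightarrow> \<not> null m \<Longrightarrow> \<not> null n \<Longrightarrow>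
    \<not> disj m n"
  shows "uniform M"
  unfolding uniform_def
proof (intro allI impI)
  fix x z assume x: "x \<in> Arr C" "Cod C x = M" "\<not> null x" and z: "z \<in> Arr C" "Cod C z = M" "\<not> null z"
  obtain e m where e: "is_epi C e" "is_mono C m" "Cod C e = Dom C m" "Dom C e = Dom C x"
    "Cod C m = Cod C x" "m \<odot> e = x"
    using image_factorization[OF x(1)] by blast
  obtain f n where f: "is_epi C f" "is_mono C n" "Cod C f = Dom C n" "Dom C f = Dom C z"
    "Cod C n = Cod C z" "n \<odot> f = z"
    using image_factorization[OF z(1)] by blast
  have A: "e \<in> Arr C" "m \<in> Arr C" "f \<in> Arr C" "n \<in> Arr C" using e f by simp_all
  have "\<not> null m" "\<not> null n" using x(3) z(3) e f A null_comp2[of m e] null_comp2[of n f] by auto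
  then have "\<not> disj m n" using assms[of m n] e f x z by simp
  then obtain s where s: "s \<preceq> m" "s \<preceq> n" "\<not> null s" unfolding disj_def by blast
  obtain a where a: "a \<in> Arr C" "Dom C a = Dom C s" "Cod C a = Dom C m" "m \<odot> a = s" using s(1) by (rule leE)
  obtain b where b: "b \<in> Arr C" "Dom C b = Dom C s" "Cod C b = Dom C n" "n \<odot> b = s" using s(2) by (rule leE)
  have sA: "s \<in> Arr C" using le_Arr s A by blast
  obtain p y where p: "is_epi C p" "Cod C p = Dom C a" "y \<in> Arr C" "Dom C y = Dom C p"
      "Cod C y = Dom C e" "a \<odot> p = e \<odot> y"
    using epi_cover[OF e(1), of a] a e by metis
  have pA: "p \<in> Arr C" using p by simp
  have bp: "b \<odot> p \<in> Arr C" "Cod C (b \<odot> p) = Cod C f" "Dom C (b \<odot> p) = Dom C p" using b p a f pA by simp_all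
  obtain q w where q: "is_epi C q" "Cod C q = Dom C p" "w \<in> Arr C" "Dom C w = Dom C q"
      "Cod C w = Dom C f" "b \<odot> p \<odot> q = f \<odot> w"
    using epi_cover[OF f(1) bp(1,2)] bp by metis
  have qA: "q \<in> Arr C" using q by simp
  have eq1: "x \<odot> (y \<odot> q) = s \<odot> (p \<odot> q)"
  proof -
    have "x \<odot> (y \<odot> q) = m \<odot> (e \<odot> (y \<odot> q))" using comp_subst[OF e(6), of "y \<odot> q"] e A p q qA by simp
    also have "e \<odot> (y \<odot> q) = a \<odot> (p \<odot> q)" using comp_subst[OF p(6)[symmetric], of q] p(1-5) e A q(1-5) qA pA a by simp
    also have "m \<odot> (a \<odot> (p \<odot> q)) = s \<odot> (p \<odot> q)"
      by (rule comp_subst[OF a(4)]) (use a p q pA qA A in simp_all)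
    finally show ?thesis .
  qed
  have eq2: "z \<odot> w = s \<odot> (p \<odot> q)"
  proof -
    have "z \<odot> w = n \<odot> (f \<odot> w)" using comp_subst[OF f(6), of w] f A q by simp
    also have "f \<odot> w = b \<odot> (p \<odot> q)" using q(6) b a p q(1-5) qA pA by simp
    also have "n \<odot> (b \<odot> (p \<odot> q)) = s \<odot> (p \<odot> q)"
      by (rule comp_subst[OF b(4)]) (use a b p q pA qA A in simp_all)
    finally show ?thesis .
  qed
  have "\<not> null (s \<odot> (p \<odot> q))"
  proof
    assume "null (s \<odot> (p \<odot> q))"
    then have "null s" using epi_null[OF epi_comp[OF q(1) p(1)], of s] p q pA qA sA a by simp
    then show False using s by blast
  qed
  then show "\<exists>y w. y \<in> Arr C \<and> w \<in> Arr C \<and> Cod C y = Dom C x \<and> Cod C w = Dom C z \<and> Dom C y = Dom C w \<and>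
      x \<odot> y = z \<odot> w \<and> \<not> null (x \<odot> y)"
    using eq1 eq2 p q pA qA e f by (intro exI[of _ "y \<odot> q"] exI[of _ w]) simp_all
qed

lemma uniform_common:
  assumes u: "uniform M" and A: "embeds C A M" "\<not> is_zero C A" and B: "embeds C B M" "\<not> is_zero C B"
  shows "common_nonzero_subobject C A B"
proof -
  obtain a b where a: "is_mono C a" "Dom C a = A" "Cod C a = M" and b: "is_mono C b" "Dom C b = B" "Cod C b = M"
    using A B unfolding embeds_iff by auto
  have ab: "a \<in> Arr C" "b \<in> Arr C" "\<not> null a" "\<not> null b" using a b A B zero_Dom_iff by auto
  obtain y w where y: "y \<in> Arr C" "w \<in> Arr C" "Cod C y = Dom C a" "Cod C w = Dom C b" "Dom C y = Dom C w"
    "a \<odot> y = b \<odot> w" "\<not> null (a \<odot> y)"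
    by (rule uniformE[OF u ab(1) a(3) ab(3) ab(2) b(3) ab(4)])
  have "a \<odot> y \<preceq> a" using y(1-5) ab by simp
  moreover have "a \<odot> y \<preceq> b" using y ab by simp
  ultimately show ?thesis using common_nonzero_subobjectI[OF a(1) b(1)] a b y by simp
qed

lemma monoformD:
  assumes "monoform C H"
  shows "H \<in> Obj C" "\<not> is_zero C H"
    "is_mono C n \<Longrightarrow> Cod C n = H \<Longrightarrow> \<not> is_zero C (Dom C n) \<Longrightarrow> is_cokernel C c n \<Longrightarrow>
      \<not> common_nonzero_subobject C H (Cod C c)"
  using assms unfolding monoform_def by blast+

text \<open>If \<open>m\<close> and \<open>n\<close> were disjoint, \<open>Dom C m\<close> would
  embed both in \<open>H\<close> and in the quotient of \<open>H\<close> by \<open>n\<close>, which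
  monoformness forbids.\<close>

lemma monoform_uniform:
  assumes H: "monoform C H"
  shows "uniform H"
proof (rule uniform_if_mono_meet)
  fix m n assume m: "is_mono C m" "is_mono C n" "Cod C m = H" "Cod C n = H" "\<not> null m" "\<not> null n"
  have mA: "m \<in> Arr C" "n \<in> Arr C" using m by simp_all
  show "\<not> disj m n"
  proof
    assume d: "disj m n"
    obtain c where c: "short_exact C n c" using m mono_ses by blast
    note cs = ses_simps[OF c]
    have "is_mono C (c \<odot> m)"
    proof (rule monoI)
      fix x assume x: "x \<in> Arr C" "Cod C x = Dom C (c \<odot> m)" "null (c \<odot> m \<odot> x)"
      have xC: "Cod C x = Dom C m" using x cs m mA by simp
      have "m \<odot> x \<preceq> n" using ses_le_iff[OF c, of "m \<odot> x"] x(1,3) xC cs m mA by simp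
      then have "null (m \<odot> x)" using disjD[OF d] x(1) xC mA by simp
      then show "null x" using mono_null[OF m(1) x(1) xC] by simp
    qed (use cs m mA in simp)
    then have "embeds C (Dom C m) (Cod C c)" using embedsI[of "c \<odot> m"] cs m mA by simp
    moreover have "embeds C (Dom C m) H" using embedsI[OF m(1)] m by simp
    moreover have "\<not> is_zero C (Dom C m)" using zero_Dom_iff m by blast
    moreover have "Dom C m \<in> Obj C" using mA by simp
    ultimately have "common_nonzero_subobject C H (Cod C c)" unfolding common_nonzero_subobject_def by blast
    moreover have "is_cokernel C c n" using c by (simp add: short_exact_def)
    ultimately show False using monoformD(3)[OF H m(2) m(4)] zero_Dom_iff m by blast
  qed
qed

text \<open>For a chain of subobjects \<open>n\<close> inside \<open>i\<close>, the quotient of the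
  smaller object embeds in the quotient of the larger one. An element \<open>y\<close> killed
  downstairs satisfies \<open>i \<odot> y \<preceq> i \<odot> n\<close>, and cancelling
  \<open>i\<close> puts it in \<open>n\<close>.\<close>

lemma quotient_embeds:
  assumes n: "is_mono C n" and i: "is_mono C i" "Dom C i = Cod C n"
    and c: "is_cokernel C c n" and d: "is_cokernel C d (i \<odot> n)"
  shows "embeds C (Cod C c) (Cod C d)"
proof -
  have A: "n \<in> Arr C" "i \<in> Arr C" using n i by simp_all
  note cs = cokernel_simps[OF c] cokernel_epi[OF c] and ds = cokernel_simps[OF d] cokernel_epi[OF d]
  have inm: "is_mono C (i \<odot> n)" using mono_comp[OF n i] .
  then obtain d' where d': "short_exact C (i \<odot> n) d'" using mono_ses by blast
  have inA: "Cod C (i \<odot> n) = Cod C i" using A i by simp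
  have ker: "x \<preceq> i \<odot> n" if x: "x \<in> Arr C" "Cod C x = Cod C i" "null (d \<odot> x)" for x
  proof -
    note ds' = ses_simps[OF d']
    obtain h where h: "h \<in> Arr C" "Dom C h = Cod C d" "Cod C h = Cod C d'" "h \<odot> d = d'"
      using cokernel_desc[OF d, of d'] ds' by metis
    have "null (h \<odot> (d \<odot> x))" using x h ds inA by (rule_tac null_comp1) simp_all
    then have "null (d' \<odot> x)" using comp_subst[OF h(4), of x] x h ds inA by simp
    then show ?thesis using ses_le_iff[OF d', of x] x ds' inA by simp
  qed
  have "null (d \<odot> i \<odot> n)" using ds A i by simp
  then obtain j where j: "j \<in> Arr C" "Dom C j = Cod C c" "Cod C j = Cod C (d \<odot> i)" "j \<odot> c = d \<odot> i"
    using cokernel_desc[OF c, of "d \<odot> i"] ds A i by auto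
  have "is_mono C j"
  proof (rule monoI[OF j(1)])
    fix x assume x: "x \<in> Arr C" "Cod C x = Dom C j" "null (j \<odot> x)"
    obtain e y where e: "is_epi C e" "Cod C e = Dom C x" "y \<in> Arr C" "Dom C y = Dom C e"
      "Cod C y = Dom C c" "x \<odot> e = c \<odot> y"
      using epi_cover[OF cs(5), of x] x j by metis
    have eA: "e \<in> Arr C" using e by simp
    have yn: "Cod C y = Cod C n" using e cs by simp
    have "null (j \<odot> x \<odot> e)" using x e eA j(1) by (rule_tac null_comp2) simp_all
    then have "null (j \<odot> (c \<odot> y))" using x e eA j(1) by simp
    then have "null (d \<odot> (i \<odot> y))" using comp_subst[OF j(4), of y] j(1-3) e yn cs ds A i by simp
    then have "i \<odot> y \<preceq> i \<odot> n" using ker[of "i \<odot> y"] e yn A i by simp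
    then obtain v where v: "v \<in> Arr C" "Dom C v = Dom C (i \<odot> y)" "Cod C v = Dom C (i \<odot> n)" "i \<odot> n \<odot> v = i \<odot> y"
      by (rule leE)
    have vD: "Dom C v = Dom C y" "Cod C v = Dom C n" using v(2,3) e yn A i by simp_all
    have "n \<odot> v = y"
      by (rule mono_cancel[OF i(1)]) (use v(1,4) vD e yn A i in simp_all)
    moreover have "null ((c \<odot> n) \<odot> v)" using cs v(1) vD by (rule_tac null_comp2) simp_all
    ultimately have "null (c \<odot> y)" using cs v(1) vD by simp
    then show "null x" using epi_null[OF e(1), of x] x e by simp
  qed
  then show ?thesis using embedsI[of j] j ds A i by simp
qed

text \<open>A subobject shared by \<open>K\<close> and a quotient of \<open>K\<close> is also shared
  by \<open>H\<close> and the quotient of \<open>H\<close> by the same subobject.\<close>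

lemma monoform_sub:
  assumes H: "monoform C H" and K: "embeds C K H" "\<not> is_zero C K"
  shows "monoform C K"
  unfolding monoform_def
proof (intro conjI allI impI)
  show "K \<in> Obj C" using embeds_Obj[OF K(1)] by blast
  show "\<not> is_zero C K" by (rule K)
  fix n c assume n: "is_mono C n \<and> Cod C n = K \<and> \<not> is_zero C (Dom C n) \<and> is_cokernel C c n"
  obtain i where i: "is_mono C i" "Dom C i = K" "Cod C i = H" using K(1) unfolding embeds_iff by blast
  have A: "n \<in> Arr C" "i \<in> Arr C" using n i by simp_all
  have inA: "i \<odot> n \<in> Arr C" "Dom C (i \<odot> n) = Dom C n" "Cod C (i \<odot> n) = H" using n i A by simp_all
  obtain d where d: "is_cokernel C d (i \<odot> n)" using ex_cokernel[OF inA(1)] by blast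
  have "is_mono C (i \<odot> n)" using mono_comp n i by blast
  then have "\<not> common_nonzero_subobject C H (Cod C d)"
    using monoformD(3)[OF H _ inA(3) _ d] inA n by simp
  moreover have "embeds C (Cod C c) (Cod C d)" using quotient_embeds[OF _ i(1) _ _ d] n i by simp
  ultimately show "\<not> common_nonzero_subobject C K (Cod C c)"
    using common_nonzero_subobject_embeds K(1) by blast
qed

text \<open>For transitivity, the two shared subobjects both embed in the middle object, whose
  uniformity provides a nonzero subobject common to them.\<close>

lemma equiv_atom_equiv: "equiv {H. monoform C H} (atom_equiv C)"
proof (rule equivI)
  show "atom_equiv C \<subseteq> {H. monoform C H} \<times> {H. monoform C H}" by (auto simp: atom_equiv_def)
  show "refl_on {H. monoform C H} (atom_equiv C)"
    unfolding refl_on_def atom_equiv_def common_nonzero_subobject_def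
    using monoformD(1,2) embeds_refl by blast
  show "sym (atom_equiv C)"
    unfolding sym_def atom_equiv_def using common_nonzero_subobject_sym by blast
  show "trans (atom_equiv C)"
  proof (rule transI)
    fix H1 H2 H3 assume a: "(H1, H2) \<in> atom_equiv C" "(H2, H3) \<in> atom_equiv C"
    obtain X where X: "\<not> is_zero C X" "embeds C X H1" "embeds C X H2"
      using a(1) unfolding atom_equiv_def common_nonzero_subobject_def by blast
    obtain Y where Y: "\<not> is_zero C Y" "embeds C Y H2" "embeds C Y H3"
      using a(2) unfolding atom_equiv_def common_nonzero_subobject_def by blast
    have "monoform C H2" using a(1) unfolding atom_equiv_def by blast
    then have "common_nonzero_subobject C X Y"
      using uniform_common[OF monoform_uniform X(3,1) Y(2,1)] by blast
    then have "common_nonzero_subobject C H1 H3" using common_nonzero_subobject_embeds X(2) Y(3) by blast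
    then show "(H1, H3) \<in> atom_equiv C" using a unfolding atom_equiv_def by blast
  qed
qed

section \<open>Representatives of an atom\<close>

lemma ASpec_monoform: "\<alpha> \<in> ASpec C \<Longrightarrow> H \<in> \<alpha> \<Longrightarrow> monoform C H"
  unfolding ASpec_def using in_quotient_imp_subset[OF equiv_atom_equiv] by blast

lemma ASpec_common: "\<alpha> \<in> ASpec C \<Longrightarrow> H \<in> \<alpha> \<Longrightarrow> H' \<in> \<alpha> \<Longrightarrow> common_nonzero_subobject C H H'"
  unfolding ASpec_def using in_quotient_imp_in_rel[OF equiv_atom_equiv, of \<alpha> H H'] by (auto simp: atom_equiv_def)

lemma ASpec_closed:
  "\<alpha> \<in> ASpec C \<Longrightarrow> H \<in> \<alpha> \<Longrightarrow> monoform C H' \<Longrightarrow> common_nonzero_subobject C H H' \<Longrightarrow> H' \<in> \<alpha>"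
  using in_quotient_imp_closed[OF equiv_atom_equiv, of \<alpha> H H'] ASpec_monoform[of \<alpha> H]
  unfolding ASpec_def by (auto simp: atom_equiv_def)

lemma ASpec_nonempty: "\<alpha> \<in> ASpec C \<Longrightarrow> \<exists>H. H \<in> \<alpha>"
  unfolding ASpec_def using in_quotient_imp_non_empty[OF equiv_atom_equiv] by blast

lemma ASpec_eq: "\<alpha> \<in> ASpec C \<Longrightarrow> \<beta> \<in> ASpec C \<Longrightarrow> H \<in> \<alpha> \<Longrightarrow> H \<in> \<beta> \<Longrightarrow> \<alpha> = \<beta>"
  unfolding ASpec_def using quotient_disj[OF equiv_atom_equiv, of \<alpha> \<beta>] by blast

lemma ASpec_sub: "\<alpha> \<in> ASpec C \<Longrightarrow> H \<in> \<alpha> \<Longrightarrow> embeds C K H \<Longrightarrow> \<not> is_zero C K \<Longrightarrow> K \<in> \<alpha>"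
proof (rule ASpec_closed)
  assume a: "\<alpha> \<in> ASpec C" "H \<in> \<alpha>" "embeds C K H" "\<not> is_zero C K"
  show "monoform C K" using monoform_sub ASpec_monoform a by blast
  show "common_nonzero_subobject C H K"
    unfolding common_nonzero_subobject_def using a embeds_Obj[OF a(3)] embeds_refl by blast
qed

lemma monoform_atom:
  assumes "monoform C H" obtains \<alpha> where "\<alpha> \<in> ASpec C" "H \<in> \<alpha>"
proof -
  have "atom_equiv C `` {H} \<in> ASpec C" unfolding ASpec_def using assms by (intro quotientI) simp
  moreover have "H \<in> atom_equiv C `` {H}" using equiv_class_self[OF equiv_atom_equiv] assms by simp
  ultimately show ?thesis using that by blast
qed

text \<open>The restriction \<open>t\<close> of \<open>q\<close> to the preimage is epi because a
  cover of \<open>m\<close> lifted along \<open>q\<close> lands in the preimage and hence factors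
  through \<open>t\<close>.\<close>

lemma preimage_epi:
  assumes m: "is_mono C m" and q: "is_epi C q" "Cod C q = Cod C m"
  obtains k t where "is_mono C k" "Cod C k = Dom C q" "is_epi C t" "Dom C t = Dom C k" "Cod C t = Dom C m"
    "m \<odot> t = q \<odot> k"
proof -
  have A: "m \<in> Arr C" "q \<in> Arr C" using m q by simp_all
  obtain k where k: "is_mono C k" "Cod C k = Dom C q"
    "\<And>x. x \<in> Arr C \<Longrightarrow> Cod C x = Dom C q \<Longrightarrow> x \<preceq> k \<longleftrightarrow> q \<odot> x \<preceq> m"
    using preimageE[OF m A(2) q(2)] by blast
  have kA: "k \<in> Arr C" using k by simp
  have "q \<odot> k \<preceq> m" using k(3)[of k] k kA by simp
  then obtain t where t: "t \<in> Arr C" "Dom C t = Dom C (q \<odot> k)" "Cod C t = Dom C m" "m \<odot> t = q \<odot> k" by (rule leE)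
  have tD: "Dom C t = Dom C k" using t k kA A by simp
  obtain e h where e: "is_epi C e" "Cod C e = Dom C m" "h \<in> Arr C" "Dom C h = Dom C e"
      "Cod C h = Dom C q" "m \<odot> e = q \<odot> h"
    using epi_cover[OF q(1) A(1)] q by metis
  have eA: "e \<in> Arr C" using e by simp
  have "q \<odot> h \<preceq> m" using comp_le_self[OF A(1) eA] e by simp
  then have "h \<preceq> k" using k(3)[of h] e by simp
  then obtain v where v: "v \<in> Arr C" "Dom C v = Dom C h" "Cod C v = Dom C k" "k \<odot> v = h" by (rule leE)
  have tv: "t \<odot> v = e"
  proof (rule mono_cancel[OF m])
    have "m \<odot> (t \<odot> v) = q \<odot> k \<odot> v" by (rule comp_subst[OF t(4)]) (use t tD v A in simp_all)
    also have "\<dots> = q \<odot> h" using v k kA A by simp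
    finally show "m \<odot> (t \<odot> v) = m \<odot> e" using e by simp
  qed (use t tD v e eA in simp_all)
  have "is_epi C t" by (rule epi_factor[of t v]) (use tv e t(1) tD v in simp_all)
  then show ?thesis using that k t tD by blast
qed

text \<open>Pushing \<open>e\<close> out along \<open>m\<close> turns a quotient of a subobject into
  a subobject of a quotient; the parallel arrow \<open>f'\<close> is epi since the two pushout
  arrows are jointly epi.\<close>

lemma subquotientI:
  assumes m: "is_mono C m" and e: "is_epi C e" "Dom C e = Dom C m"
  shows "subquotient C (Cod C e) (Cod C m)"
proof -
  have A: "m \<in> Arr C" "e \<in> Arr C" using m e by simp_all
  obtain m' f' where p: "is_mono C m'" "Dom C m' = Cod C e" "f' \<in> Arr C" "Dom C f' = Cod C m"
    "Cod C f' = Cod C m'" "m' \<odot> e = f' \<odot> m"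
    "\<And>t. t \<in> Arr C \<Longrightarrow> Dom C t = Cod C m' \<Longrightarrow> null (t \<odot> m') \<Longrightarrow> null (t \<odot> f') \<Longrightarrow> null t"
    using pushout[OF m A(2) e(2)] by metis
  have m'A: "m' \<in> Arr C" using p by simp
  have "is_epi C f'"
  proof (rule epiI[OF p(3)])
    fix t assume t: "t \<in> Arr C" "Dom C t = Cod C f'" "null (t \<odot> f')"
    have "null (t \<odot> f' \<odot> m)" using t p(3,4) A by (rule_tac null_comp2) simp_all
    then have "null (t \<odot> (m' \<odot> e))" unfolding p(6) using t p(3,4) A by simp
    then have "null (t \<odot> m')" using epi_null[OF e(1), of "t \<odot> m'"] t p(2,5) m'A A by simp
    then show "null t" using p t by simp
  qed
  then show ?thesis unfolding subquotient_def using p embedsI[OF p(1)]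
    by (intro exI[of _ "Cod C m'"] bexI[of _ f']) simp_all
qed

lemma subquotientE:
  assumes "subquotient C X M"
  obtains m e where "is_mono C m" "Cod C m = M" "is_epi C e" "Dom C e = Dom C m" "Cod C e = X"
proof -
  obtain q i where q: "is_epi C q" "Dom C q = M" "is_mono C i" "Dom C i = X" "Cod C i = Cod C q"
    using assms unfolding subquotient_def embeds_iff by auto
  show ?thesis
    by (rule preimage_epi[OF q(3,1) q(5)[symmetric]]) (use that q in blast)
qed

text \<open>Written as quotients of subobjects, the epi of one subquotient and the mono of the other
  are interchanged by taking a preimage.\<close>

lemma subquotient_trans:
  assumes "subquotient C X N" "subquotient C N M"
  shows "subquotient C X M"
proof -
  obtain m e where m: "is_mono C m" "Cod C m = N" "is_epi C e" "Dom C e = Dom C m" "Cod C e = X"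
    using assms(1) by (rule subquotientE)
  obtain n f where n: "is_mono C n" "Cod C n = M" "is_epi C f" "Dom C f = Dom C n" "Cod C f = N"
    using assms(2) by (rule subquotientE)
  have fm: "Cod C f = Cod C m" using m n by simp
  obtain k t where k: "is_mono C k" "Cod C k = Dom C f" "is_epi C t" "Dom C t = Dom C k" "Cod C t = Dom C m"
    using preimage_epi[OF m(1) n(3) fm] by blast
  have A: "k \<in> Arr C" "t \<in> Arr C" "n \<in> Arr C" "e \<in> Arr C" using k m n by simp_all
  show ?thesis
    using subquotientI[OF mono_comp[OF k(1) n(1)] epi_comp[OF k(3) m(3)]] k m n A by simp
qed

lemma subquotient_embeds: "embeds C X M \<Longrightarrow> subquotient C X M"
proof -
  assume "embeds C X M"
  then obtain m where m: "is_mono C m" "Dom C m = X" "Cod C m = M" unfolding embeds_iff by blast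
  then have "m \<in> Arr C" by simp
  then show ?thesis using subquotientI[OF m(1), of "Ident C X"] m by auto
qed

lemma subquotient_epi: "is_epi C e \<Longrightarrow> subquotient C (Cod C e) (Dom C e)"
  using subquotientI[of "Ident C (Dom C e)" e] by simp

section \<open>Atom supports\<close>

lemma ASuppI: "\<alpha> \<in> ASpec C \<Longrightarrow> H \<in> \<alpha> \<Longrightarrow> subquotient C H M \<Longrightarrow> \<alpha> \<in> ASupp C M"
  unfolding ASupp_def by blast

lemma ASuppE:
  assumes "\<alpha> \<in> ASupp C M"
  obtains H m e where "\<alpha> \<in> ASpec C" "H \<in> \<alpha>" "is_mono C m" "Cod C m = M" "is_epi C e" "Dom C e = Dom C m" "Cod C e = H"
  using assms subquotientE unfolding ASupp_def by blast

lemma ASupp_subset_ASpec: "ASupp C M \<subseteq> ASpec C"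
  unfolding ASupp_def by blast

lemma ASupp_mono: "subquotient C N M \<Longrightarrow> ASupp C N \<subseteq> ASupp C M"
  unfolding ASupp_def using subquotient_trans by blast

lemma ASupp_atom: "\<alpha> \<in> ASpec C \<Longrightarrow> H \<in> \<alpha> \<Longrightarrow> \<alpha> \<in> ASupp C H"
  using ASuppI subquotient_embeds embeds_refl monoformD(1) ASpec_monoform by blast

lemma ASupp_isomorphic: "isomorphic C A B \<Longrightarrow> ASupp C B \<subseteq> ASupp C A"
  using ASupp_mono subquotient_embeds isomorphic_embeds isomorphic_sym by blast

lemma ASupp_zero: "is_zero C Z \<Longrightarrow> ASupp C Z = {}"
proof (rule ccontr)
  assume Z: "is_zero C Z" and "ASupp C Z \<noteq> {}"
  then obtain \<alpha> where "\<alpha> \<in> ASupp C Z" by blast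
  then obtain H m e where a: "\<alpha> \<in> ASpec C" "H \<in> \<alpha>" "is_mono C m" "Cod C m = Z" "is_epi C e" "Dom C e = Dom C m" "Cod C e = H"
    by (rule ASuppE)
  have "null m" using is_zero_null[OF Z] a by simp
  then have "is_zero C (Dom C e)" using zero_Dom_iff a by simp
  then have "null e" using is_zero_null a by simp
  then have "is_zero C H" using zero_Cod_iff a by blast
  then show False using monoformD(2) ASpec_monoform a by blast
qed

text \<open>The image of \<open>e \<odot> k\<close> is a nonzero subobject of \<open>H\<close>, so
  it represents the same atom, and it is a quotient of \<open>Dom C k\<close>.\<close>

lemma ASupp_restrict:
  assumes \<alpha>: "\<alpha> \<in> ASpec C" "H \<in> \<alpha>" and e: "is_epi C e" "Cod C e = H"
    and k: "k \<in> Arr C" "Cod C k = Dom C e" "\<not> null (e \<odot> k)" and L: "embeds C (Dom C k) L"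
  shows "\<alpha> \<in> ASupp C L"
proof -
  have A: "e \<in> Arr C" using e by simp
  have ek: "e \<odot> k \<in> Arr C" "Dom C (e \<odot> k) = Dom C k" "Cod C (e \<odot> k) = H" using e k A by simp_all
  obtain p m where p: "is_epi C p" "is_mono C m" "Cod C p = Dom C m" "Dom C p = Dom C (e \<odot> k)"
    "Cod C m = Cod C (e \<odot> k)" "m \<odot> p = e \<odot> k"
    using image_factorization[OF ek(1)] by blast
  have pA: "p \<in> Arr C" "m \<in> Arr C" using p by simp_all
  have "\<not> null m" using k(3) p pA null_comp2[of m p] by auto
  then have "Dom C m \<in> \<alpha>" using ASpec_sub[OF \<alpha>, of "Dom C m"] embedsI[OF p(2)] zero_Dom_iff[OF p(2)] p ek by simp
  moreover have "subquotient C (Dom C m) L"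
    using subquotient_trans[OF subquotient_epi[OF p(1)] subquotient_embeds[of _ L]] p ek L by simp
  ultimately show ?thesis using ASuppI \<alpha> by blast
qed

text \<open>Let \<open>H\<close> be a quotient of a subobject \<open>m\<close> of the middle term,
  and let \<open>k\<close> be the part of \<open>m\<close> inside \<open>f\<close>. If
  \<open>e\<close> is nonzero on \<open>k\<close>, the atom comes from the left term; otherwise
  \<open>e\<close> factors through the image of \<open>m\<close> on the right.\<close>

lemma ASupp_ses:
  assumes s: "short_exact C f g"
  shows "ASupp C (Cod C f) \<subseteq> ASupp C (Dom C f) \<union> ASupp C (Cod C g)"
proof
  note fs = ses_simps[OF s]
  fix \<alpha> assume "\<alpha> \<in> ASupp C (Cod C f)"
  then obtain H m e where a: "\<alpha> \<in> ASpec C" "H \<in> \<alpha>" "is_mono C m" "Cod C m = Cod C f" "is_epi C e" "Dom C e = Dom C m" "Cod C e = H"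
    by (rule ASuppE)
  have A: "m \<in> Arr C" "e \<in> Arr C" using a by simp_all
  obtain k where k: "is_mono C k" "Cod C k = Dom C m"
    "\<And>x. x \<in> Arr C \<Longrightarrow> Cod C x = Dom C m \<Longrightarrow> x \<preceq> k \<longleftrightarrow> m \<odot> x \<preceq> f"
    using preimageE[OF fs(4) A(1) a(4)] by blast
  have kA: "k \<in> Arr C" using k by simp
  show "\<alpha> \<in> ASupp C (Dom C f) \<union> ASupp C (Cod C g)"
  proof (cases "null (e \<odot> k)")
    case False
    have "m \<odot> k \<preceq> f" using k(3)[of k] k kA by simp
    then obtain u where u: "u \<in> Arr C" "Dom C u = Dom C (m \<odot> k)" "Cod C u = Dom C f" "f \<odot> u = m \<odot> k" by (rule leE)
    have "is_mono C u" by (rule mono_factor[of f]) (use u fs mono_comp[OF k(1) a(3)] k in simp_all)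
    then have "embeds C (Dom C k) (Dom C f)" using embedsI[of u] u k kA A by simp
    then show ?thesis using ASupp_restrict[OF a(1,2,5,7) kA] k a False by simp
  next
    case True
    have gm: "g \<odot> m \<in> Arr C" "Dom C (g \<odot> m) = Dom C m" "Cod C (g \<odot> m) = Cod C g" using fs a A by simp_all
    obtain p n where p: "is_epi C p" "is_mono C n" "Cod C p = Dom C n" "Dom C p = Dom C (g \<odot> m)"
      "Cod C n = Cod C (g \<odot> m)" "n \<odot> p = g \<odot> m"
      using image_factorization[OF gm(1)] by blast
    have pA: "p \<in> Arr C" "n \<in> Arr C" using p by simp_all
    obtain l where l: "short_exact C l p" using p epi_ses by blast
    note ls = ses_simps[OF l]
    have lC: "Cod C l = Dom C m" using ls p gm by simp
    have "null (n \<odot> (p \<odot> l))" using ls p pA by (rule_tac null_comp1) simp_all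
    then have "null (g \<odot> (m \<odot> l))" using comp_subst[OF p(6), of l] p(3-5) pA ls lC gm fs(2,3) A a by simp
    then have "m \<odot> l \<preceq> f" using ses_le_iff[OF s, of "m \<odot> l"] fs A a lC ls by simp
    then have "l \<preceq> k" using k(3)[of l] lC ls by simp
    then obtain v where v: "v \<in> Arr C" "Dom C v = Dom C l" "Cod C v = Dom C k" "k \<odot> v = l" by (rule leE)
    have "null (e \<odot> k \<odot> v)" using True v k kA a A by (rule_tac null_comp2) simp_all
    then have "null (e \<odot> l)" using v k kA a A by simp
    then obtain t where t: "t \<in> Arr C" "Dom C t = Cod C p" "Cod C t = Cod C e" "t \<odot> p = e"
      using ses_desc[OF l, of e] lC a A by metis
    have "is_epi C t" by (rule epi_factor[of t p]) (use t pA a in simp_all)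
    then have "subquotient C H (Cod C g)" using subquotientI[OF p(2), of t] t p gm a by simp
    then show ?thesis using ASuppI a by blast
  qed
qed

text \<open>If \<open>k\<close> is maximal such that the quotient of \<open>M\<close> by \<open>k\<close> shares a nonzero subobject with \<open>M\<close>, then that
  common subobject is monoform.\<close>

lemma noetherian_monoform_sub:
  assumes M: "noetherian C M" "\<not> is_zero C M"
  obtains X where "monoform C X" "embeds C X M"
proof -
  have MO: "M \<in> Obj C" using M noetherian_Obj by blast
  define P where "P k \<longleftrightarrow> is_mono C k \<and> Cod C k = M \<and> (\<exists>c. short_exact C k c \<and> common_nonzero_subobject C M (Cod C c))" for k
  have Pm: "is_mono C k" "Cod C k = M" if "P k" for k using that by (auto simp: P_def)
  obtain z where z: "short_exact C z (Ident C M)" using epi_ses[OF epi_Ident[OF MO]] by blast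
  have "common_nonzero_subobject C M M"
    unfolding common_nonzero_subobject_def using MO M embeds_refl by blast
  then have "P z" using z ses_simps[OF z] MO by (auto simp: P_def)
  then obtain k where k: "P k" "\<And>k'. P k' \<Longrightarrow> k \<preceq> k' \<Longrightarrow> k' \<preceq> k"
    using noetherian_maximal[of M P z, OF M(1) Pm] by blast
  obtain c X where c: "short_exact C k c" and X: "X \<in> Obj C" "\<not> is_zero C X" "embeds C X M" "embeds C X (Cod C c)"
    using k(1) unfolding P_def common_nonzero_subobject_def by blast
  note cs = ses_simps[OF c]
  have kC: "Cod C k = M" using Pm k by blast
  obtain i where i: "is_mono C i" "Dom C i = X" "Cod C i = Cod C c" using X(4) unfolding embeds_iff by blast
  have "monoform C X"
    unfolding monoform_def
  proof (intro conjI allI impI notI)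
    \<comment> \<open>Dividing further by a nonzero \<open>n\<close> would give a quotient
      \<open>Cod C d\<close> of \<open>M\<close> that still shares a subobject with
      \<open>M\<close>. Its kernel \<open>k'\<close> contains \<open>k\<close>, so maximality
      returns it to \<open>k\<close>, which forces \<open>n\<close> to be null.\<close>
    fix n c' assume n: "is_mono C n \<and> Cod C n = X \<and> \<not> is_zero C (Dom C n) \<and> is_cokernel C c' n"
      and com: "common_nonzero_subobject C X (Cod C c')"
    have A: "n \<in> Arr C" "i \<in> Arr C" using n i by simp_all
    have inm: "is_mono C (i \<odot> n)" using mono_comp n i by blast
    then obtain d where d: "short_exact C (i \<odot> n) d" using mono_ses by blast
    note ds = ses_simps[OF d]
    have dD: "Dom C d = Cod C c" using ds i n A by simp
    have "embeds C (Cod C c') (Cod C d)"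
      using quotient_embeds[OF _ i(1) _ _ , of n c' d] n i d by (simp add: short_exact_def)
    then have com': "common_nonzero_subobject C M (Cod C d)"
      using common_nonzero_subobject_embeds[OF com X(3)] by blast
    have dc: "is_epi C (d \<odot> c)" "d \<odot> c \<in> Arr C" "Dom C (d \<odot> c) = M" "Cod C (d \<odot> c) = Cod C d"
      using epi_comp[OF cs(5) ds(5) dD] cs ds dD kC by simp_all
    obtain k' where k': "short_exact C k' (d \<odot> c)" using dc epi_ses by blast
    note ks = ses_simps[OF k']
    have "P k'" using k' ks dc com' by (auto simp: P_def)
    moreover have "k \<preceq> k'"
    proof -
      have "null (d \<odot> (c \<odot> k))" using cs ds dD by (rule_tac null_comp1) simp_all
      then show ?thesis using ses_le_iff[OF k', of k] cs ds dD dc kC by simp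
    qed
    ultimately have k'k: "k' \<preceq> k" using k(2) by blast
    have inC: "i \<odot> n \<in> Arr C" "Cod C (i \<odot> n) = Cod C c" using A i n by simp_all
    obtain e y where e: "is_epi C e" "Cod C e = Dom C (i \<odot> n)" "y \<in> Arr C" "Dom C y = Dom C e"
      "Cod C y = Dom C c" "i \<odot> n \<odot> e = c \<odot> y"
      using epi_cover[OF cs(5) inC] by blast
    have eA: "e \<in> Arr C" using e by simp
    have "null (d \<odot> (i \<odot> n) \<odot> e)" using ds inC e eA by (rule_tac null_comp2) simp_all
    then have "null (d \<odot> (c \<odot> y))" using assoc[of e "i \<odot> n" d] ds(1-3) inC e eA by (simp del: assoc)
    then have "y \<preceq> k'" using ses_le_iff[OF k', of y] cs ds dD dc kC e by simp
    then have "y \<preceq> k" using le_trans k'k cs by blast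
    then have "null (i \<odot> n \<odot> e)" unfolding e(6) using ses_le_iff[OF c, of y] e by simp
    then have "null (i \<odot> n)" using epi_null[OF e(1), of "i \<odot> n"] inC e by simp
    then have "is_zero C (Dom C (i \<odot> n))" using zero_Dom_iff[OF inm] by simp
    then show False using n A i by simp
  qed (use X in blast)+
  then show ?thesis using that X by blast
qed

end

context grothendieck_category
begin

text \<open>For finitely supported subobjects the coordinates are split off one at a time as
  extensions. The general case reduces to this because a nonzero quotient is already nonzero on a
  finitely supported part.\<close>

lemma ASupp_coproduct:
  fixes \<iota> :: "'x \<Rightarrow> 'm"
  assumes I: "is_small small I" and S: "is_coproduct C I F S \<iota>" and F: "\<And>i. i \<in> I \<Longrightarrow> ASupp C (F i) \<subseteq> \<Phi>"
  shows "ASupp C S \<subseteq> \<Phi>"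
proof -
  note s = coproduct_simps[OF S]
  have fin: "ASupp C (Dom C l) \<subseteq> \<Phi>"
    if "finite A" "A \<subseteq> I" "is_mono C l" "Cod C l = S" "supported S \<iota> A l" for A l
    using that
  proof (induction A arbitrary: l)
    case empty
    then have "null l" using supported_empty[of S \<iota> l] s(1) by simp
    then show ?case using ASupp_zero zero_Dom_iff empty by blast
  next
    case (insert j A)
    have j: "j \<in> I" using insert by simp
    have lA: "l \<in> Arr C" using insert by simp
    obtain \<pi> where \<pi>: "\<pi> \<in> Arr C" "Dom C \<pi> = S" "Cod C \<pi> = F j" "\<pi> \<odot> \<iota> j = Ident C (F j)"
      "\<And>i. i \<in> I \<Longrightarrow> i \<noteq> j \<Longrightarrow> null (\<pi> \<odot> \<iota> i)"
      using coproduct_projection[OF S j] by blast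
    have pl: "\<pi> \<odot> l \<in> Arr C" "Dom C (\<pi> \<odot> l) = Dom C l" "Cod C (\<pi> \<odot> l) = F j" using \<pi> lA insert by simp_all
    \<comment> \<open>The subobject \<open>l\<close> is an extension of a part of
      \<open>F j\<close>, its image under \<open>\<pi>\<close>, by the kernel of
      \<open>\<pi>\<close> on it, which is supported on \<open>A\<close>.\<close>
    obtain p n where p: "is_epi C p" "is_mono C n" "Cod C p = Dom C n" "Dom C p = Dom C (\<pi> \<odot> l)"
      "Cod C n = Cod C (\<pi> \<odot> l)" "n \<odot> p = \<pi> \<odot> l"
      using image_factorization[OF pl(1)] by blast
    have pA: "p \<in> Arr C" "n \<in> Arr C" using p by simp_all
    obtain k where k: "short_exact C k p" using p epi_ses by blast
    note ks = ses_simps[OF k]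
    have kC: "Cod C k = Dom C l" using ks p pl by simp
    have lk: "is_mono C (l \<odot> k)" "l \<odot> k \<in> Arr C" "Cod C (l \<odot> k) = S" "Dom C (l \<odot> k) = Dom C k"
      using mono_comp[OF ks(4) insert.prems(2)] kC lA ks insert.prems by simp_all
    have n1: "null (\<pi> \<odot> (l \<odot> k))"
    proof -
      have "null (n \<odot> (p \<odot> k))" using ks p pA by (rule_tac null_comp1) simp_all
      then show ?thesis using comp_subst[OF p(6), of k] ks p(3-5) pA pl kC \<pi>(1,2) lA insert.prems by simp
    qed
    have sup: "supported S \<iota> (insert j A) (l \<odot> k)" unfolding supported_def
    proof (intro allI impI)
      fix t assume t: "t \<in> Arr C" "Dom C t = S" "\<forall>i\<in>insert j A. null (t \<odot> \<iota> i)"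
      then have "null (t \<odot> l)" using supportedD[OF insert.prems(4) t(1,2)] by blast
      then have "null (t \<odot> l \<odot> k)" using t lA ks kC insert.prems by (rule_tac null_comp2) simp_all
      then show "null (t \<odot> (l \<odot> k))" using t lA ks kC insert.prems by simp
    qed
    have "supported S \<iota> A (l \<odot> k)"
      by (rule supported_remove[OF S j \<pi>]) (use insert.prems(1) sup n1 lk in simp_all)
    then have "ASupp C (Dom C (l \<odot> k)) \<subseteq> \<Phi>" using insert.IH[OF _ lk(1,3)] insert.prems(1) by blast
    moreover have "ASupp C (Dom C n) \<subseteq> \<Phi>"
      using ASupp_mono[OF subquotient_embeds[OF embedsI[OF p(2)]]] F[OF j] p pl by auto
    ultimately show ?case using ASupp_ses[OF k] lk kC p by auto
  qed
  show ?thesis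
  proof
    fix \<alpha> assume "\<alpha> \<in> ASupp C S"
    then obtain H m e where a: "\<alpha> \<in> ASpec C" "H \<in> \<alpha>" "is_mono C m" "Cod C m = S" "is_epi C e" "Dom C e = Dom C m" "Cod C e = H"
      by (rule ASuppE)
    have A: "m \<in> Arr C" "e \<in> Arr C" using a by simp_all
    have "\<not> is_zero C H" using monoformD(2) ASpec_monoform a by blast
    then have "\<not> null e" using zero_Cod_iff a by blast
    then obtain B x where B: "finite B" "B \<subseteq> I" and x: "x \<in> Arr C" "Cod C x = Dom C m"
      "supported S \<iota> B (m \<odot> x)" "\<not> null (e \<odot> x)"
      using coproduct_finite_support[OF I S A(1) a(4) A(2) a(6)] by blast
    obtain l where l: "is_mono C l" "Cod C l = S"
      "\<And>x. x \<in> Arr C \<Longrightarrow> Cod C x = S \<Longrightarrow> x \<preceq> l \<longleftrightarrow> supported S \<iota> B x"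
      using support_subobject[OF S B(2)] by blast
    have ml: "Cod C m = Cod C l" using a l by simp
    obtain k where k: "is_mono C k" "Cod C k = Dom C m"
      "\<And>x. x \<in> Arr C \<Longrightarrow> Cod C x = Dom C m \<Longrightarrow> x \<preceq> k \<longleftrightarrow> m \<odot> x \<preceq> l"
      using preimageE[OF l(1) A(1) ml] by blast
    have kA: "k \<in> Arr C" "l \<in> Arr C" using k l by simp_all
    have "x \<preceq> k" using k(3)[OF x(1,2)] l(3)[of "m \<odot> x"] x a A by simp
    then obtain v where v: "v \<in> Arr C" "Dom C v = Dom C x" "Cod C v = Dom C k" "k \<odot> v = x" by (rule leE)
    have "\<not> null (e \<odot> k)"
    proof
      assume "null (e \<odot> k)"
      then have "null (e \<odot> k \<odot> v)" using v k kA a A by (rule_tac null_comp2) simp_all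
      then have "null (e \<odot> x)" using v k kA a A by simp
      then show False using x by blast
    qed
    moreover have "m \<odot> k \<preceq> l" using k(3)[of k] k kA by simp
    then obtain u where u: "u \<in> Arr C" "Dom C u = Dom C (m \<odot> k)" "Cod C u = Dom C l" "l \<odot> u = m \<odot> k" by (rule leE)
    have "is_mono C u" by (rule mono_factor[of l]) (use u kA mono_comp[OF k(1) a(3)] k in simp_all)
    then have "embeds C (Dom C k) (Dom C l)" using embedsI[of u] u k kA A by simp
    ultimately have "\<alpha> \<in> ASupp C (Dom C l)" using ASupp_restrict[OF a(1,2,5,7) kA(1)] k a by simp
    moreover have "supported S \<iota> B l" using l(3)[of l] l kA by simp
    ultimately show "\<alpha> \<in> \<Phi>" using fin[OF B l(1,2)] by blast
  qed
qed

end

context abelian_category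
begin

section \<open>Open sets of atoms and Serre subcategories\<close>

text \<open>For intersections, a nonzero subobject common to two representatives of an atom is again
  a representative, and its support lies in both given ones.\<close>

lemma istopology_aspec_open: "istopology (aspec_open C)"
  unfolding istopology_def
proof (intro conjI allI impI)
  fix \<Phi> \<Psi> assume o: "aspec_open C \<Phi>" "aspec_open C \<Psi>"
  show "aspec_open C (\<Phi> \<inter> \<Psi>)"
    unfolding aspec_open_def
  proof (intro conjI ballI)
    show "\<Phi> \<inter> \<Psi> \<subseteq> ASpec C" using o unfolding aspec_open_def by blast
    fix \<alpha> assume \<alpha>: "\<alpha> \<in> \<Phi> \<inter> \<Psi>"
    then have a: "\<alpha> \<in> ASpec C" using o unfolding aspec_open_def by blast
    have "\<exists>H\<in>\<alpha>. ASupp C H \<subseteq> \<Phi>" "\<exists>H\<in>\<alpha>. ASupp C H \<subseteq> \<Psi>"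
      using o \<alpha> by (simp_all add: aspec_open_def)
    then obtain H H' where H: "H \<in> \<alpha>" "ASupp C H \<subseteq> \<Phi>" "H' \<in> \<alpha>" "ASupp C H' \<subseteq> \<Psi>"
      by blast
    obtain K where K: "\<not> is_zero C K" "embeds C K H" "embeds C K H'"
      using ASpec_common[OF a H(1,3)] unfolding common_nonzero_subobject_def by blast
    have "K \<in> \<alpha>" using ASpec_sub a H K by blast
    then show "\<exists>H\<in>\<alpha>. ASupp C H \<subseteq> \<Phi> \<inter> \<Psi>"
      using ASupp_mono[OF subquotient_embeds[OF K(2)]] ASupp_mono[OF subquotient_embeds[OF K(3)]] H by blast
  qed
next
  fix \<K> assume "\<forall>K\<in>\<K>. aspec_open C K"
  then show "aspec_open C (\<Union>\<K>)" unfolding aspec_open_def by (meson Union_iff Union_least Union_upper order_trans)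
qed

lemma aspec_open_Union: "(\<And>U. U \<in> \<K> \<Longrightarrow> aspec_open C U) \<Longrightarrow> aspec_open C (\<Union>\<K>)"
  using istopology_aspec_open unfolding istopology_def by blast

lemma aspec_open_ASupp: "aspec_open C (ASupp C M)"
  unfolding aspec_open_def
proof (intro conjI ballI)
  fix \<alpha> assume "\<alpha> \<in> ASupp C M"
  then obtain H where "H \<in> \<alpha>" "subquotient C H M" unfolding ASupp_def by blast
  then show "\<exists>H\<in>\<alpha>. ASupp C H \<subseteq> ASupp C M" using ASupp_mono by blast
qed (rule ASupp_subset_ASpec)

lemma aspec_open_ASpec: "aspec_open C (ASpec C)"
  unfolding aspec_open_def using ASpec_nonempty ASupp_subset_ASpec by blast

lemma noetherian_zero:
  assumes Z: "is_zero C Z" shows "noetherian C Z"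
  unfolding noetherian_def
proof (intro conjI allI impI)
  show "Z \<in> Obj C" using Z is_zero_Obj by blast
  fix s :: "nat \<Rightarrow> 'b" assume s: "\<forall>n. is_mono C (s n) \<and> Cod C (s n) = Z \<and> s n \<preceq> s (Suc n)"
  then have "s k \<preceq> s n" for k n
    using le_null[of "s n" "s k"] is_zero_null[OF Z, of "s k"] by simp
  then show "\<exists>n. \<forall>k\<ge>n. s k \<preceq> s n" by blast
qed

text \<open>Noetherian induction on quotients: in a minimal quotient of \<open>M\<close> outside \<open>\<Y>\<close>, a monoform
  subobject can be shrunk to lie in \<open>\<Y>\<close>.\<close>

lemma noetherian_mem_if_ASupp_subset:
  assumes zero: "\<And>Z. is_zero C Z \<Longrightarrow> Z \<in> \<Y>"
    and subq: "\<And>A B. A \<in> \<Y> \<Longrightarrow> subquotient C B A \<Longrightarrow> B \<in> \<Y>"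
    and ext: "\<And>f g. short_exact C f g \<Longrightarrow> noetherian C (Cod C f) \<Longrightarrow> Dom C f \<in> \<Y> \<Longrightarrow> Cod C g \<in> \<Y> \<Longrightarrow> Cod C f \<in> \<Y>"
    and M: "noetherian C M" "ASupp C M \<subseteq> (\<Union>N\<in>\<Y>. ASupp C N)"
  shows "M \<in> \<Y>"
proof (rule ccontr)
  assume nM: "M \<notin> \<Y>"
  have MO: "M \<in> Obj C" using M noetherian_Obj by blast
  define P where "P k \<longleftrightarrow> is_mono C k \<and> Cod C k = M \<and> (\<exists>q. short_exact C k q \<and> Cod C q \<notin> \<Y>)" for k
  have Pm: "is_mono C k" "Cod C k = M" if "P k" for k using that by (auto simp: P_def)
  obtain z where z: "short_exact C z (Ident C M)" using epi_ses[OF epi_Ident[OF MO]] by blast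
  have "P z" using z ses_simps[OF z] MO nM by (auto simp: P_def)
  then obtain k where k: "P k" "\<And>k'. P k' \<Longrightarrow> k \<preceq> k' \<Longrightarrow> k' \<preceq> k"
    using noetherian_maximal[of M P z, OF M(1) Pm] by blast
  obtain q where q: "short_exact C k q" "Cod C q \<notin> \<Y>" using k(1) unfolding P_def by blast
  note qs = ses_simps[OF q(1)]
  have qD: "Dom C q = M" using qs Pm(2)[OF k(1)] by simp
  let ?Q = "Cod C q"
  have nQ: "noetherian C ?Q" using noetherian_epi[OF qs(5)] M qD by simp
  have "\<not> is_zero C ?Q" using zero q by blast
  then obtain X where X: "monoform C X" "embeds C X ?Q" using noetherian_monoform_sub nQ by blast
  obtain \<alpha> where \<alpha>: "\<alpha> \<in> ASpec C" "X \<in> \<alpha>" using X monoform_atom by blast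
  have "\<alpha> \<in> ASupp C ?Q" using ASuppI[OF \<alpha>] subquotient_embeds X by blast
  then have "\<alpha> \<in> ASupp C M" using ASupp_mono[OF subquotient_epi[OF qs(5)]] qD by blast
  then obtain N H where N: "N \<in> \<Y>" "H \<in> \<alpha>" "subquotient C H N" using M(2) unfolding ASupp_def by blast
  \<comment> \<open>\<open>W\<close> still sits inside the quotient \<open>?Q\<close>, but as a
    subobject of \<open>H\<close> it is a subquotient of \<open>N\<close> and hence belongs to
    \<open>\<Y>\<close>.\<close>
  obtain W where W: "\<not> is_zero C W" "embeds C W X" "embeds C W H"
    using ASpec_common[OF \<alpha> N(2)] unfolding common_nonzero_subobject_def by blast
  have WY: "W \<in> \<Y>" using subq[OF N(1)] subquotient_trans[OF subquotient_embeds[OF W(3)] N(3)] .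
  obtain w where w: "is_mono C w" "Dom C w = W" "Cod C w = ?Q"
    using embeds_trans[OF W(2) X(2)] unfolding embeds_iff by blast
  have wA: "w \<in> Arr C" using w by simp
  obtain r where r: "short_exact C w r" using w mono_ses by blast
  note rs = ses_simps[OF r]
  have rD: "Dom C r = ?Q" using rs w by simp
  \<comment> \<open>Otherwise \<open>?Q\<close> would be an extension of two objects of
    \<open>\<Y>\<close>.\<close>
  have "Cod C r \<notin> \<Y>" using ext[OF r] w nQ WY q by auto
  moreover have rq: "is_epi C (r \<odot> q)" "r \<odot> q \<in> Arr C" "Dom C (r \<odot> q) = M" "Cod C (r \<odot> q) = Cod C r"
    using epi_comp[OF qs(5) rs(5) rD] qs rs rD qD by simp_all
  moreover obtain k' where k': "short_exact C k' (r \<odot> q)" using rq epi_ses by blast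
  note ks = ses_simps[OF k']
  ultimately have "P k'" using k' ks by (auto simp: P_def)
  moreover have "k \<preceq> k'"
  proof -
    have "null (r \<odot> (q \<odot> k))" using qs rs rD by (rule_tac null_comp1) simp_all
    then show ?thesis using ses_le_iff[OF k', of k] qs rs rD rq qD by simp
  qed
  ultimately have k'k: "k' \<preceq> k" using k(2) by blast
  \<comment> \<open>A lift of \<open>w\<close> to \<open>M\<close> lies in \<open>k'\<close>, hence
    in \<open>k\<close>, so its image in \<open>?Q\<close> is null; but \<open>W\<close> is
    nonzero.\<close>
  obtain e y where e: "is_epi C e" "Cod C e = Dom C w" "y \<in> Arr C" "Dom C y = Dom C e"
    "Cod C y = Dom C q" "w \<odot> e = q \<odot> y"
    using epi_cover[OF qs(5) wA] w by metis
  have eA: "e \<in> Arr C" using e by simp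
  have "null (r \<odot> w \<odot> e)" using rs w wA e eA by (rule_tac null_comp2) simp_all
  then have "null (r \<odot> (q \<odot> y))" using rs rD w wA e eA by simp
  then have "y \<preceq> k'" using ses_le_iff[OF k', of y] qs rs rD rq qD e by simp
  then have "y \<preceq> k" using le_trans k'k qs by blast
  then have "null (w \<odot> e)" unfolding e(6) using ses_le_iff[OF q(1), of y] e by simp
  then have "null w" using epi_null[OF e(1), of w] wA e by simp
  then show False using zero_Dom_iff[OF w(1)] w W by simp
qed

lemma serre_subcategory_ASupp: "serre_subcategory C {M \<in> Obj C. ASupp C M \<subseteq> \<Phi>}"
  unfolding serre_subcategory_def subcategory_def
proof (intro conjI ballI allI impI)
  show "Z \<in> {M \<in> Obj C. ASupp C M \<subseteq> \<Phi>}" if "is_zero C Z" for Z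
    using ASupp_zero that is_zero_Obj by simp
  show "B \<in> {M \<in> Obj C. ASupp C M \<subseteq> \<Phi>}" if "A \<in> {M \<in> Obj C. ASupp C M \<subseteq> \<Phi>}" "isomorphic C A B" for A B
    using that ASupp_isomorphic[OF that(2)] embeds_Obj[OF isomorphic_embeds[OF that(2)]] by blast
  show "Dom C f \<in> {M \<in> Obj C. ASupp C M \<subseteq> \<Phi>}" if "is_mono C f \<and> Cod C f \<in> {M \<in> Obj C. ASupp C M \<subseteq> \<Phi>}" for f
    using that ASupp_mono[OF subquotient_embeds[OF embedsI[of f]]] by auto
  show "Cod C f \<in> {M \<in> Obj C. ASupp C M \<subseteq> \<Phi>}" if "is_epi C f \<and> Dom C f \<in> {M \<in> Obj C. ASupp C M \<subseteq> \<Phi>}" for f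
    using that ASupp_mono[OF subquotient_epi[of f]] by auto
  show "Cod C f \<in> {M \<in> Obj C. ASupp C M \<subseteq> \<Phi>}"
    if "short_exact C f g \<and> Dom C f \<in> {M \<in> Obj C. ASupp C M \<subseteq> \<Phi>} \<and> Cod C g \<in> {M \<in> Obj C. ASupp C M \<subseteq> \<Phi>}" for f g
    using that ASupp_ses[of f g] ses_simps(1)[of f g] by auto
qed blast

section \<open>The category of noetherian objects compared with the ambient one\<close>

lemma noeth_simps [simp]:
  "Obj (noeth C) = {M. noetherian C M}"
  "Arr (noeth C) = {f \<in> Arr C. noetherian C (Dom C f) \<and> noetherian C (Cod C f)}"
  "Dom (noeth C) = Dom C" "Cod (noeth C) = Cod C" "Ident (noeth C) = Ident C" "Comp (noeth C) = Comp C"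
  "Add (noeth C) = Add C" "Zero (noeth C) = Zero C"
  by (simp_all add: noeth_def full_subcategory_def)

lemma Hom_noeth: "f \<in> Hom (noeth C) A B \<longleftrightarrow> f \<in> Hom C A B \<and> noetherian C A \<and> noetherian C B"
  unfolding Hom_def by auto

lemma is_zero_noeth: "is_zero (noeth C) Z \<longleftrightarrow> is_zero C Z"
proof
  assume z: "is_zero (noeth C) Z"
  then have n: "noetherian C Z" "\<exists>!f. f \<in> Hom (noeth C) Z Z" by (auto simp: is_zero_def)
  have O: "Z \<in> Obj C" using n noetherian_Obj by blast
  then have "Ident C Z \<in> Hom (noeth C) Z Z" "Zero C Z Z \<in> Hom (noeth C) Z Z"
    using n unfolding Hom_noeth by simp_all
  then have "Ident C Z = Zero C Z Z" using n(2) by blast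
  then show "is_zero C Z" unfolding is_zero_iff using O by simp
next
  assume z: "is_zero C Z"
  have n: "noetherian C Z" using noetherian_zero z .
  show "is_zero (noeth C) Z"
    unfolding is_zero_def Hom_noeth using z n noetherian_Obj
    by (auto simp: is_zero_def simp del: Hom_iff)
qed

lemma is_mono_noeth:
  "is_mono C f \<Longrightarrow> noetherian C (Dom C f) \<Longrightarrow> noetherian C (Cod C f) \<Longrightarrow> is_mono (noeth C) f"
  unfolding is_mono_def[of "noeth C"] using mono_Arr by (auto simp: Hom_noeth intro!: mono_cancel[of f])

lemma is_epi_noeth:
  "is_epi C f \<Longrightarrow> noetherian C (Dom C f) \<Longrightarrow> noetherian C (Cod C f) \<Longrightarrow> is_epi (noeth C) f"
  unfolding is_epi_def[of "noeth C"] using epi_Arr by (auto simp: Hom_noeth intro!: epi_cancel[of f])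

text \<open>The kernel of \<open>f\<close> is itself a noetherian test object, being a subobject of
  \<open>Dom C f\<close>. Monomorphisms of \<open>noeth C\<close> are therefore monomorphisms of
  \<open>C\<close>.\<close>

lemma mono_if_noetherian_cancel:
  assumes f: "f \<in> Arr C" "noetherian C (Dom C f)"
    and c: "\<And>k. k \<in> Arr C \<Longrightarrow> Cod C k = Dom C f \<Longrightarrow> noetherian C (Dom C k) \<Longrightarrow> null (f \<odot> k) \<Longrightarrow> null k"
  shows "is_mono C f"
proof (rule monoI[OF f(1)])
  obtain k where k: "is_mono C k" "Cod C k = Dom C f"
    "\<And>x. x \<in> Arr C \<Longrightarrow> Cod C x = Dom C f \<Longrightarrow> x \<preceq> k \<longleftrightarrow> null (f \<odot> x)"
    using kernelE[OF f(1)] by blast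
  have kA: "k \<in> Arr C" using k by simp
  have "null k" using c[OF kA k(2)] noetherian_mono[OF k(1)] k(2) k(3)[OF kA k(2)] f kA by simp
  fix x assume x: "x \<in> Arr C" "Cod C x = Dom C f" "null (f \<odot> x)"
  then have "x \<preceq> k" using k by blast
  then obtain v where v: "v \<in> Arr C" "Cod C v = Dom C k" "k \<odot> v = x" by (rule leE)
  then show "null x" using null_comp2[OF \<open>null k\<close>, of v] by simp
qed

lemma epi_if_noetherian_cancel:
  assumes f: "f \<in> Arr C" "noetherian C (Cod C f)"
    and c: "\<And>k. k \<in> Arr C \<Longrightarrow> Dom C k = Cod C f \<Longrightarrow> noetherian C (Cod C k) \<Longrightarrow> null (k \<odot> f) \<Longrightarrow> null k"
  shows "is_epi C f"
proof (rule epiI[OF f(1)])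
  obtain k where k: "is_cokernel C k f" using ex_cokernel f by blast
  note ks = cokernel_simps[OF k] cokernel_epi[OF k]
  have "null k" using c[OF ks(1,3)] noetherian_epi[OF ks(5)] ks f by simp
  fix x assume x: "x \<in> Arr C" "Dom C x = Cod C f" "null (x \<odot> f)"
  then obtain v where v: "v \<in> Arr C" "Dom C v = Cod C k" "v \<odot> k = x"
    using cokernel_desc[OF k] by metis
  then show "null x" using null_comp1[OF \<open>null k\<close>, of v] by simp
qed

lemma is_mono_noethD:
  assumes "is_mono (noeth C) f" shows "is_mono C f"
proof (rule mono_if_noetherian_cancel)
  have "f \<in> Arr (noeth C)" using assms unfolding is_mono_def by blast
  then show f: "f \<in> Arr C" "noetherian C (Dom C f)" by simp_all
  fix k assume k: "k \<in> Arr C" "Cod C k = Dom C f" "noetherian C (Dom C k)" "null (f \<odot> k)"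
  let ?z = "Zero C (Dom C k) (Dom C f)"
  have "f \<odot> k = f \<odot> ?z" using null_eq[OF k(4)] k f by simp
  moreover have "k \<in> Hom (noeth C) (Dom C k) (Dom C f)" "?z \<in> Hom (noeth C) (Dom C k) (Dom C f)"
    using k f by (simp_all add: Hom_noeth)
  ultimately have "k = ?z" using assms unfolding is_mono_def noeth_simps by blast
  then show "null k" using k f by (metis Dom_Cod_obj(1) null_Zero)
qed

lemma is_epi_noethD:
  assumes "is_epi (noeth C) f" shows "is_epi C f"
proof (rule epi_if_noetherian_cancel)
  have "f \<in> Arr (noeth C)" using assms unfolding is_epi_def by blast
  then show f: "f \<in> Arr C" "noetherian C (Cod C f)" by simp_all
  fix k assume k: "k \<in> Arr C" "Dom C k = Cod C f" "noetherian C (Cod C k)" "null (k \<odot> f)"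
  let ?z = "Zero C (Cod C f) (Cod C k)"
  have "k \<odot> f = ?z \<odot> f" using null_eq[OF k(4)] k f by simp
  moreover have "k \<in> Hom (noeth C) (Cod C f) (Cod C k)" "?z \<in> Hom (noeth C) (Cod C f) (Cod C k)"
    using k f by (simp_all add: Hom_noeth)
  ultimately have "k = ?z" using assms unfolding is_epi_def noeth_simps by blast
  then show "null k" using k f by (metis Dom_Cod_obj(2) null_Zero)
qed

lemma isomorphic_noethD:
  assumes "isomorphic (noeth C) A B" shows "isomorphic C A B \<and> noetherian C B"
proof -
  obtain f g where f: "f \<in> Hom (noeth C) A B" and g: "g \<in> Hom (noeth C) B A"
    and fg: "g \<odot> f = Ident C A" "f \<odot> g = Ident C B"
    using assms unfolding isomorphic_def is_iso_def noeth_simps by (force simp: Hom_def[of "noeth C"])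
  have A: "f \<in> Arr C" "Dom C f = A" "Cod C f = B" "noetherian C B" "g \<in> Arr C" "Dom C g = B" "Cod C g = A"
    using f g unfolding Hom_noeth by simp_all
  then have "is_iso C f" unfolding is_iso_def using fg by (intro conjI bexI[of _ g]) simp_all
  then show ?thesis unfolding isomorphic_def using A by auto
qed

text \<open>The ambient kernel of \<open>g\<close> is a subobject of a noetherian object, so the
  universal property inside \<open>noeth C\<close> applies to it and places it in
  \<open>f\<close>.\<close>

lemma short_exact_noethD:
  assumes s: "short_exact (noeth C) f g"
  shows "short_exact C f g"
proof -
  have k: "is_kernel (noeth C) f g" and c: "is_cokernel (noeth C) g f" using s by (auto simp: short_exact_def)
  have A: "f \<in> Arr C" "g \<in> Arr C" "Cod C f = Dom C g" "noetherian C (Dom C f)" "noetherian C (Cod C f)" "noetherian C (Cod C g)"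
    and z: "g \<odot> f = Zero C (Dom C f) (Cod C g)"
    using k by (auto simp: is_kernel_def)
  have ku: "\<exists>!h. h \<in> Hom (noeth C) X (Dom C f) \<and> f \<odot> h = u"
    if "u \<in> Hom (noeth C) X (Dom C g)" "g \<odot> u = Zero C X (Cod C g)" for u X
    using k that unfolding is_kernel_def noeth_simps by blast
  have cu: "\<exists>!h. h \<in> Hom (noeth C) (Cod C g) X \<and> h \<odot> g = u"
    if "u \<in> Hom (noeth C) (Cod C f) X" "u \<odot> f = Zero C (Dom C f) X" for u X
    using c that unfolding is_cokernel_def noeth_simps by blast
  show ?thesis
  proof (rule short_exactI)
    show "is_mono C f"
    proof (rule mono_if_noetherian_cancel[OF A(1,4)])
      fix x assume x: "x \<in> Arr C" "Cod C x = Dom C f" "noetherian C (Dom C x)" "null (f \<odot> x)"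
      let ?z = "Zero C (Dom C x) (Dom C f)" and ?u = "Zero C (Dom C x) (Dom C g)"
      have "\<exists>!h. h \<in> Hom (noeth C) (Dom C x) (Dom C f) \<and> f \<odot> h = ?u"
        by (rule ku) (use x A in \<open>simp_all add: Hom_noeth\<close>)
      moreover have "x \<in> Hom (noeth C) (Dom C x) (Dom C f)" "?z \<in> Hom (noeth C) (Dom C x) (Dom C f)"
        using x A by (simp_all add: Hom_noeth)
      moreover have "f \<odot> x = ?u" "f \<odot> ?z = ?u" using null_eq[OF x(4)] x A by simp_all
      ultimately have "x = ?z" by blast
      then show "null x" using x A by (metis Dom_Cod_obj(1) null_Zero)
    qed
    show "is_epi C g"
    proof (rule epi_if_noetherian_cancel[OF A(2,6)])
      fix x assume x: "x \<in> Arr C" "Dom C x = Cod C g" "noetherian C (Cod C x)" "null (x \<odot> g)"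
      let ?z = "Zero C (Cod C g) (Cod C x)" and ?u = "Zero C (Cod C f) (Cod C x)"
      have "\<exists>!h. h \<in> Hom (noeth C) (Cod C g) (Cod C x) \<and> h \<odot> g = ?u"
        by (rule cu) (use x A in \<open>simp_all add: Hom_noeth\<close>)
      moreover have "x \<in> Hom (noeth C) (Cod C g) (Cod C x)" "?z \<in> Hom (noeth C) (Cod C g) (Cod C x)"
        using x A by (simp_all add: Hom_noeth)
      moreover have "x \<odot> g = ?u" "?z \<odot> g = ?u" using null_eq[OF x(4)] x A by simp_all
      ultimately have "x = ?z" by blast
      then show "null x" using x A by (metis Dom_Cod_obj(2) null_Zero)
    qed
    show "null (g \<odot> f)" using z A by simp
    fix x assume x: "x \<in> Arr C" "Cod C x = Dom C g" "null (g \<odot> x)"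
    obtain l where l: "is_mono C l" "Cod C l = Dom C g"
      "\<And>x. x \<in> Arr C \<Longrightarrow> Cod C x = Dom C g \<Longrightarrow> x \<preceq> l \<longleftrightarrow> null (g \<odot> x)"
      using kernelE[OF A(2)] by blast
    have lA: "l \<in> Arr C" using l by simp
    have nl: "noetherian C (Dom C l)" using noetherian_mono[OF l(1)] l A by simp
    have "null (g \<odot> l)" using l(3)[OF lA l(2)] lA by simp
    then have "g \<odot> l = Zero C (Dom C l) (Cod C g)" by (rule null_eq) (use lA l A in simp_all)
    then have "\<exists>!h. h \<in> Hom (noeth C) (Dom C l) (Dom C f) \<and> f \<odot> h = l"
      by (intro ku) (use lA nl l A in \<open>simp_all add: Hom_noeth\<close>)
    then have "l \<preceq> f" unfolding subobject_le_def Hom_noeth by blast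
    moreover have "x \<preceq> l" using l(3) x by blast
    ultimately show "x \<preceq> f" using le_trans A by blast
  qed (rule A)
qed

text \<open>Outer terms inherit noetherianity from the middle one, and the universal properties
  restrict because the subcategory is full.\<close>

lemma short_exact_noeth:
  assumes s: "short_exact C f g" and n: "noetherian C (Cod C f)"
  shows "short_exact (noeth C) f g"
proof -
  note fs = ses_simps[OF s]
  have k: "is_kernel C f g" and c: "is_cokernel C g f" using s by (auto simp: short_exact_def)
  have N: "noetherian C (Dom C f)" "noetherian C (Dom C g)" "noetherian C (Cod C g)"
    using noetherian_mono[OF fs(4) n] noetherian_epi[OF fs(5)] fs n by simp_all
  have "is_kernel (noeth C) f g"
    unfolding is_kernel_def noeth_simps
  proof (intro conjI allI ballI impI)
    show "g \<odot> f = Zero C (Dom C f) (Cod C g)" using k by (simp add: is_kernel_def)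
    fix A u assume u: "u \<in> Hom (noeth C) A (Dom C g)" "g \<odot> u = Zero C A (Cod C g)"
    then have "\<exists>!h. h \<in> Hom C A (Dom C f) \<and> f \<odot> h = u"
      by (intro kernel_univ[OF k]) (simp_all add: Hom_noeth)
    then show "\<exists>!h. h \<in> Hom (noeth C) A (Dom C f) \<and> f \<odot> h = u" using u N unfolding Hom_noeth by blast
  qed (use fs n N in simp_all)
  moreover have "is_cokernel (noeth C) g f"
    unfolding is_cokernel_def noeth_simps
  proof (intro conjI allI ballI impI)
    show "g \<odot> f = Zero C (Dom C f) (Cod C g)" using k by (simp add: is_kernel_def)
    fix A u assume u: "u \<in> Hom (noeth C) (Cod C f) A" "u \<odot> f = Zero C (Dom C f) A"
    then have "\<exists>!h. h \<in> Hom C (Cod C g) A \<and> h \<odot> g = u"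
      by (intro cokernel_univ[OF c]) (simp_all add: Hom_noeth)
    then show "\<exists>!h. h \<in> Hom (noeth C) (Cod C g) A \<and> h \<odot> g = u" using u N unfolding Hom_noeth by blast
  qed (use fs n N in simp_all)
  ultimately show ?thesis by (simp add: short_exact_def)
qed

lemma serre_noeth_ASupp: "serre_subcategory (noeth C) {M. noetherian C M \<and> ASupp C M \<subseteq> \<Phi>}"
proof -
  note s = serre_subcategory_ASupp[of \<Phi>, unfolded serre_subcategory_def subcategory_def]
  let ?X = "{M. noetherian C M \<and> ASupp C M \<subseteq> \<Phi>}"
  show ?thesis
    unfolding serre_subcategory_def subcategory_def
  proof (intro conjI ballI allI impI)
    show "Z \<in> ?X" if "is_zero (noeth C) Z" for Z
      using that noetherian_zero ASupp_zero unfolding is_zero_noeth by simp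
    show "B \<in> ?X" if "A \<in> ?X" "isomorphic (noeth C) A B" for A B
      using that isomorphic_noethD[OF that(2)] ASupp_isomorphic by blast
    show "Dom (noeth C) f \<in> ?X" if "is_mono (noeth C) f \<and> Cod (noeth C) f \<in> ?X" for f
      using that is_mono_noethD[of f] noetherian_mono[of f] ASupp_mono[OF subquotient_embeds[OF embedsI[of f]]] by auto
    show "Cod (noeth C) f \<in> ?X" if "is_epi (noeth C) f \<and> Dom (noeth C) f \<in> ?X" for f
      using that is_epi_noethD[of f] noetherian_epi[of f] ASupp_mono[OF subquotient_epi[of f]] by auto
    show "Cod (noeth C) f \<in> ?X"
      if a: "short_exact (noeth C) f g \<and> Dom (noeth C) f \<in> ?X \<and> Cod (noeth C) g \<in> ?X" for f g
    proof -
      have "noetherian C (Cod C f)" using a by (auto simp: short_exact_def is_kernel_def)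
      then show ?thesis using a short_exact_noethD[of f g] ASupp_ses[of f g] by auto
    qed
  qed auto
qed

text \<open>Noetherian induction asks for closure under extensions with noetherian middle term only;
  those are exactly the ambient exact sequences that \<open>short_exact_noeth\<close> places inside
  \<open>noeth C\<close>.\<close>

lemma serre_noeth_ASupp_iff:
  assumes Y: "serre_subcategory (noeth C) \<Y>"
  shows "{M. noetherian C M \<and> ASupp C M \<subseteq> (\<Union>N\<in>\<Y>. ASupp C N)} = \<Y>"
proof
  have YN: "noetherian C N" if "N \<in> \<Y>" for N
    using Y that unfolding serre_subcategory_def subcategory_def by auto
  show "\<Y> \<subseteq> {M. noetherian C M \<and> ASupp C M \<subseteq> (\<Union>N\<in>\<Y>. ASupp C N)}" using YN by blast
  have Ym: "Dom C f \<in> \<Y>" if "is_mono C f" "Cod C f \<in> \<Y>" for f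
    using Y is_mono_noeth[OF that(1)] noetherian_mono[OF that(1)] YN[OF that(2)] that(2)
    unfolding serre_subcategory_def noeth_simps by blast
  have Ye: "Cod C f \<in> \<Y>" if "is_epi C f" "Dom C f \<in> \<Y>" for f
    using Y is_epi_noeth[OF that(1)] noetherian_epi[OF that(1)] YN[OF that(2)] that(2)
    unfolding serre_subcategory_def noeth_simps by blast
  show "{M. noetherian C M \<and> ASupp C M \<subseteq> (\<Union>N\<in>\<Y>. ASupp C N)} \<subseteq> \<Y>"
  proof (clarify, rule noetherian_mem_if_ASupp_subset)
    show "Z \<in> \<Y>" if "is_zero C Z" for Z
      using Y that unfolding serre_subcategory_def subcategory_def is_zero_noeth by blast
    show "B \<in> \<Y>" if "A \<in> \<Y>" "subquotient C B A" for A B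
      using that(2) by (rule subquotientE) (use Ym Ye that(1) in metis)
    show "Cod C f \<in> \<Y>" if "short_exact C f g" "noetherian C (Cod C f)" "Dom C f \<in> \<Y>" "Cod C g \<in> \<Y>" for f g
      using Y short_exact_noeth[OF that(1,2)] that(3,4) unfolding serre_subcategory_def noeth_simps by blast
  qed
qed

end

context grothendieck_category
begin

lemma localizing_ASupp: "localizing_subcategory C small {M \<in> Obj C. ASupp C M \<subseteq> \<Phi>}"
  unfolding localizing_subcategory_def
proof (intro conjI allI impI)
  fix I F S \<iota> assume a: "small I \<and> F ` I \<subseteq> {M \<in> Obj C. ASupp C M \<subseteq> \<Phi>} \<and> is_coproduct C I F S \<iota>"
  have "is_small small I" unfolding is_small_def using a lepoll_refl by blast
  then have "ASupp C S \<subseteq> \<Phi>" by (rule ASupp_coproduct) (use a in auto)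
  then show "S \<in> {M \<in> Obj C. ASupp C M \<subseteq> \<Phi>}" using a coproduct_simps(1) by blast
qed (rule serre_subcategory_ASupp)

end

context locally_noetherian_grothendieck_category
begin

text \<open>Some arrow from a noetherian generator is nonzero; its image is noetherian as a quotient
  of the generator.\<close>

lemma noetherian_sub:
  assumes M: "M \<in> Obj C" "\<not> is_zero C M"
  obtains N where "noetherian C N" "\<not> is_zero C N" "embeds C N M"
proof -
  obtain \<G> where G: "generating_set C \<G>" "\<And>G. G \<in> \<G> \<Longrightarrow> noetherian C G"
    using ex_noetherian_generators by blast
  have "\<not> null (Ident C M)" using M by (simp add: is_zero_iff)
  then obtain G h where h: "G \<in> \<G>" "h \<in> Arr C" "Dom C h = G" "Cod C h = M" "\<not> null h"
    using generating_set_null[OF G(1), of "Ident C M"] M by auto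
  obtain e m where e: "is_epi C e" "is_mono C m" "Cod C e = Dom C m" "Dom C e = Dom C h"
    "Cod C m = Cod C h" "m \<odot> e = h"
    using image_factorization[OF h(2)] by blast
  have A: "e \<in> Arr C" "m \<in> Arr C" using e by simp_all
  have "\<not> null m" using h(5) e A null_comp2[of m e] by auto
  then have "\<not> is_zero C (Dom C m)" using zero_Dom_iff e by blast
  moreover have "noetherian C (Dom C m)" using noetherian_epi[OF e(1)] e G(2) h by simp
  ultimately show ?thesis using that embedsI[OF e(2)] e h by simp
qed

lemma atom_noetherian:
  assumes "\<alpha> \<in> ASpec C" "H \<in> \<alpha>"
  obtains K where "K \<in> \<alpha>" "noetherian C K" "embeds C K H"
proof -
  have "H \<in> Obj C" "\<not> is_zero C H" using monoformD ASpec_monoform assms by blast+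
  then obtain K where "noetherian C K" "\<not> is_zero C K" "embeds C K H" using noetherian_sub by blast
  then show ?thesis using that ASpec_sub assms by blast
qed

lemma aspec_open_noetherian:
  assumes "aspec_open C \<Phi>" "\<alpha> \<in> \<Phi>"
  obtains H where "H \<in> \<alpha>" "noetherian C H" "ASupp C H \<subseteq> \<Phi>" "\<alpha> \<in> ASupp C H"
proof -
  have \<alpha>: "\<alpha> \<in> ASpec C" using assms by (auto simp: aspec_open_def)
  obtain H where H: "H \<in> \<alpha>" "ASupp C H \<subseteq> \<Phi>" using assms by (auto simp: aspec_open_def)
  obtain K where K: "K \<in> \<alpha>" "noetherian C K" "embeds C K H" using atom_noetherian \<alpha> H by blast
  then show ?thesis using that ASupp_mono[OF subquotient_embeds[OF K(3)]] H ASupp_atom[OF \<alpha> K(1)] by blast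
qed

lemma localizing_ASupp_iff:
  assumes X: "localizing_subcategory C small \<X>"
  shows "{M \<in> Obj C. ASupp C M \<subseteq> (\<Union>N\<in>\<X>. ASupp C N)} = \<X>"
proof
  have S: "serre_subcategory C \<X>" using X by (simp add: localizing_subcategory_def)
  then have XO: "\<X> \<subseteq> Obj C" unfolding serre_subcategory_def subcategory_def by blast
  show "\<X> \<subseteq> {M \<in> Obj C. ASupp C M \<subseteq> (\<Union>N\<in>\<X>. ASupp C N)}" using XO by blast
  have Xm: "Dom C f \<in> \<X>" if "is_mono C f" "Cod C f \<in> \<X>" for f
    using S that unfolding serre_subcategory_def by blast
  have Xe: "Cod C f \<in> \<X>" if "is_epi C f" "Dom C f \<in> \<X>" for f
    using S that unfolding serre_subcategory_def by blast
  have noeth: "M \<in> \<X>" if "noetherian C M" "ASupp C M \<subseteq> (\<Union>N\<in>\<X>. ASupp C N)" for M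
  proof (rule noetherian_mem_if_ASupp_subset[OF _ _ _ that])
    show "Z \<in> \<X>" if "is_zero C Z" for Z
      using S that unfolding serre_subcategory_def subcategory_def by blast
    show "B \<in> \<X>" if "A \<in> \<X>" "subquotient C B A" for A B
      using that(2) by (rule subquotientE) (use Xm Xe that(1) in metis)
    show "Cod C f \<in> \<X>" if "short_exact C f g" "noetherian C (Cod C f)" "Dom C f \<in> \<X>" "Cod C g \<in> \<X>" for f g
      using S that(1,3,4) unfolding serre_subcategory_def by blast
  qed
  show "{M \<in> Obj C. ASupp C M \<subseteq> (\<Union>N\<in>\<X>. ASupp C N)} \<subseteq> \<X>"
  proof clarify
    fix M assume M: "M \<in> Obj C" "ASupp C M \<subseteq> (\<Union>N\<in>\<X>. ASupp C N)"
    obtain \<G> where G: "is_small small \<G>" "generating_set C \<G>" "\<And>G. G \<in> \<G> \<Longrightarrow> noetherian C G"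
      using ex_noetherian_generators by blast
    have GO: "\<G> \<subseteq> Obj C" using G(2) by (simp add: generating_set_def)
    define J where "J = Sigma \<G> (\<lambda>G. Hom C G M)"
    have "is_small small J" unfolding J_def
      by (intro is_small_Sigma G(1) small_Hom M(1)) (use GO in blast)
    \<comment> \<open>Closure under coproducts is formulated for index sets in \<open>'u\<close>, so
      the arrows from generators into \<open>M\<close> are reindexed there.\<close>
    then obtain U \<phi> where U: "small U" "inj_on \<phi> J" "\<phi> ` J \<subseteq> U"
      by (auto simp: is_small_def lepoll_def)
    have sJ: "small (\<phi> ` J)" using small_lepoll U subset_imp_lepoll by blast
    have "\<forall>j\<in>\<phi> ` J. \<exists>m. is_mono C m \<and> Cod C m = M \<and> noetherian C (Dom C m) \<and> snd (inv_into J \<phi> j) \<preceq> m"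
    proof
      fix j assume "j \<in> \<phi> ` J"
      then have "inv_into J \<phi> j \<in> J" by (rule inv_into_into)
      then obtain G h where h: "inv_into J \<phi> j = (G, h)" "G \<in> \<G>" "h \<in> Arr C" "Dom C h = G" "Cod C h = M"
        by (auto simp: J_def)
      obtain e m where e: "is_epi C e" "is_mono C m" "Cod C e = Dom C m" "Dom C e = Dom C h"
        "Cod C m = Cod C h" "m \<odot> e = h"
        using image_factorization[OF h(3)] by blast
      have "noetherian C (Dom C m)" using noetherian_epi[OF e(1)] e G(3) h by simp
      moreover have "h \<preceq> m" by (rule leI[of e]) (use e in simp_all)
      ultimately show "\<exists>m. is_mono C m \<and> Cod C m = M \<and> noetherian C (Dom C m) \<and> snd (inv_into J \<phi> j) \<preceq> m"
        using e h by auto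
    qed
    from bchoice[OF this] obtain m where m: "\<And>j. j \<in> \<phi> ` J \<Longrightarrow> is_mono C (m j)" "\<And>j. j \<in> \<phi> ` J \<Longrightarrow> Cod C (m j) = M"
      "\<And>j. j \<in> \<phi> ` J \<Longrightarrow> noetherian C (Dom C (m j))" "\<And>j. j \<in> \<phi> ` J \<Longrightarrow> snd (inv_into J \<phi> j) \<preceq> m j"
      by blast
    have mX: "Dom C (m j) \<in> \<X>" if j: "j \<in> \<phi> ` J" for j
      using noeth[OF m(3)[OF j]] ASupp_mono[OF subquotient_embeds[OF embedsI[OF m(1)[OF j]]]] m(2)[OF j] M(2) by auto
    then have FX: "(\<lambda>j. Dom C (m j)) ` (\<phi> ` J) \<subseteq> \<X>" by blast
    obtain S \<iota> where S: "is_coproduct C (\<phi> ` J) (\<lambda>j. Dom C (m j)) S \<iota>"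
      using ex_coproduct[OF sJ order_trans[OF FX XO]] by blast
    have SX: "S \<in> \<X>"
      using X conjI[OF sJ conjI[OF FX S]] unfolding localizing_subcategory_def by blast
    note s = coproduct_simps[OF S]
    have mA: "m j \<in> Arr C" if "j \<in> \<phi> ` J" for j using m(1)[OF that] by simp
    obtain f where f: "f \<in> Arr C" "Dom C f = S" "Cod C f = M" "\<And>j. j \<in> \<phi> ` J \<Longrightarrow> f \<odot> \<iota> j = m j"
      using coproduct_desc[OF S M(1) mA refl m(2)] by blast
    have "is_epi C f"
    proof (rule epiI[OF f(1)])
      fix t assume t: "t \<in> Arr C" "Dom C t = Cod C f" "null (t \<odot> f)"
      \<comment> \<open>Each arrow from a generator lies in one of the chosen noetherian subobjects,
        on which \<open>t\<close> vanishes because it kills \<open>f\<close>.\<close>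
      show "null t"
      proof (rule generating_set_null[OF G(2) t(1)])
        fix G h assume h: "G \<in> \<G>" "h \<in> Arr C" "Dom C h = G" "Cod C h = Dom C t"
        have "(G, h) \<in> J" using h t f by (simp add: J_def)
        then have j: "\<phi> (G, h) \<in> \<phi> ` J" "inv_into J \<phi> (\<phi> (G, h)) = (G, h)" using U(2) by simp_all
        let ?j = "\<phi> (G, h)"
        have "h \<preceq> m ?j" using m(4)[OF j(1)] j(2) by simp
        then obtain v where v: "v \<in> Arr C" "Cod C v = Dom C (m ?j)" "m ?j \<odot> v = h" by (rule leE)
        note sj = s(2-4)[OF j(1)]
        have "null (t \<odot> f \<odot> (\<iota> ?j \<odot> v))" using t f(1-3) sj v by (rule_tac null_comp2) simp_all
        then have "null (t \<odot> (f \<odot> \<iota> ?j \<odot> v))" using t(1,2) f(1-3) sj v by simp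
        then show "null (t \<odot> h)" by (simp only: f(4)[OF j(1)] v(3))
      qed
    qed
    then show "M \<in> \<X>" using Xe f SX by metis
  qed
qed

lemma bij_localizing_open:
  "bij_betw (\<lambda>\<X>. \<Union>N\<in>\<X>. ASupp C N) {\<X>. localizing_subcategory C small \<X>} {U. aspec_open C U}"
proof (rule bij_betw_byWitness[where f' = "\<lambda>\<Phi>. {M \<in> Obj C. ASupp C M \<subseteq> \<Phi>}"])
  show "\<forall>\<X>\<in>{\<X>. localizing_subcategory C small \<X>}. {M \<in> Obj C. ASupp C M \<subseteq> (\<Union>N\<in>\<X>. ASupp C N)} = \<X>"
    using localizing_ASupp_iff by blast
  show "\<forall>\<Phi>\<in>{U. aspec_open C U}. (\<Union>N\<in>{M \<in> Obj C. ASupp C M \<subseteq> \<Phi>}. ASupp C N) = \<Phi>"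
  proof (intro ballI equalityI subsetI)
    fix \<Phi> \<alpha> assume "\<Phi> \<in> {U. aspec_open C U}" "\<alpha> \<in> \<Phi>"
    then obtain H where "noetherian C H" "ASupp C H \<subseteq> \<Phi>" "\<alpha> \<in> ASupp C H"
      using aspec_open_noetherian by blast
    then show "\<alpha> \<in> (\<Union>N\<in>{M \<in> Obj C. ASupp C M \<subseteq> \<Phi>}. ASupp C N)" using noetherian_Obj by blast
  qed blast
  show "(\<lambda>\<X>. \<Union>N\<in>\<X>. ASupp C N) ` {\<X>. localizing_subcategory C small \<X>} \<subseteq> {U. aspec_open C U}"
    by (auto intro!: aspec_open_Union aspec_open_ASupp)
  show "(\<lambda>\<Phi>. {M \<in> Obj C. ASupp C M \<subseteq> \<Phi>}) ` {U. aspec_open C U} \<subseteq> {\<X>. localizing_subcategory C small \<X>}"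
    using localizing_ASupp by blast
qed

lemma bij_serre_noeth_open:
  "bij_betw (\<lambda>\<X>. \<Union>N\<in>\<X>. ASupp C N) {\<X>. serre_subcategory (noeth C) \<X>} {U. aspec_open C U}"
proof (rule bij_betw_byWitness[where f' = "\<lambda>\<Phi>. {M. noetherian C M \<and> ASupp C M \<subseteq> \<Phi>}"])
  show "\<forall>\<X>\<in>{\<X>. serre_subcategory (noeth C) \<X>}. {M. noetherian C M \<and> ASupp C M \<subseteq> (\<Union>N\<in>\<X>. ASupp C N)} = \<X>"
    using serre_noeth_ASupp_iff by blast
  show "\<forall>\<Phi>\<in>{U. aspec_open C U}. (\<Union>N\<in>{M. noetherian C M \<and> ASupp C M \<subseteq> \<Phi>}. ASupp C N) = \<Phi>"
  proof (intro ballI equalityI subsetI)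
    fix \<Phi> \<alpha> assume "\<Phi> \<in> {U. aspec_open C U}" "\<alpha> \<in> \<Phi>"
    then obtain H where "noetherian C H" "ASupp C H \<subseteq> \<Phi>" "\<alpha> \<in> ASupp C H"
      using aspec_open_noetherian by blast
    then show "\<alpha> \<in> (\<Union>N\<in>{M. noetherian C M \<and> ASupp C M \<subseteq> \<Phi>}. ASupp C N)" by blast
  qed blast
  show "(\<lambda>\<X>. \<Union>N\<in>\<X>. ASupp C N) ` {\<X>. serre_subcategory (noeth C) \<X>} \<subseteq> {U. aspec_open C U}"
    by (auto intro!: aspec_open_Union aspec_open_ASupp)
  show "(\<lambda>\<Phi>. {M. noetherian C M \<and> ASupp C M \<subseteq> \<Phi>}) ` {U. aspec_open C U} \<subseteq> {\<X>. serre_subcategory (noeth C) \<X>}"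
    using serre_noeth_ASupp by blast
qed

end

section \<open>Indecomposable injectives and the Ziegler spectrum\<close>

context abelian_category
begin

definition indec_injective where
  "indec_injective I \<longleftrightarrow> indecomposable C I \<and> injective_object C I"

lemma indec_injectiveD:
  assumes "indec_injective I"
  shows "I \<in> Obj C" "\<not> is_zero C I" "injective_object C I" "indecomposable C I"
  using assms unfolding indec_injective_def indecomposable_def by blast+

lemma equiv_isomorphic_indec_injective:
  "equiv {I. indec_injective I} {(I, J). indec_injective I \<and> indec_injective J \<and> isomorphic C I J}"
proof (rule equivI)
  show "refl_on {I. indec_injective I} {(I, J). indec_injective I \<and> indec_injective J \<and> isomorphic C I J}"
    unfolding refl_on_def using isomorphic_refl indec_injectiveD(1) by blast
  show "sym {(I, J). indec_injective I \<and> indec_injective J \<and> isomorphic C I J}"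
    unfolding sym_def using isomorphic_sym by blast
  show "trans {(I, J). indec_injective I \<and> indec_injective J \<and> isomorphic C I J}"
    unfolding trans_def using isomorphic_trans by blast
qed blast

lemma Zg_eq_quotient:
  "Zg C = {I. indec_injective I} // {(I, J). indec_injective I \<and> indec_injective J \<and> isomorphic C I J}"
  unfolding Zg_def indec_injective_def by (simp add: conj_assoc)

lemma Zg_indec_injective: "\<xi> \<in> Zg C \<Longrightarrow> I \<in> \<xi> \<Longrightarrow> indec_injective I"
  unfolding Zg_eq_quotient using in_quotient_imp_subset[OF equiv_isomorphic_indec_injective] by blast

lemma Zg_isomorphic: "\<xi> \<in> Zg C \<Longrightarrow> I \<in> \<xi> \<Longrightarrow> J \<in> \<xi> \<Longrightarrow> isomorphic C I J"
  unfolding Zg_eq_quotient using in_quotient_imp_in_rel[OF equiv_isomorphic_indec_injective, of \<xi> I J] by auto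

lemma Zg_closed: "\<xi> \<in> Zg C \<Longrightarrow> I \<in> \<xi> \<Longrightarrow> indec_injective J \<Longrightarrow> isomorphic C I J \<Longrightarrow> J \<in> \<xi>"
  using in_quotient_imp_closed[OF equiv_isomorphic_indec_injective, of \<xi> I J] Zg_indec_injective[of \<xi> I]
  unfolding Zg_eq_quotient by auto

lemma Zg_nonempty: "\<xi> \<in> Zg C \<Longrightarrow> \<exists>I. I \<in> \<xi>"
  unfolding Zg_eq_quotient using in_quotient_imp_non_empty[OF equiv_isomorphic_indec_injective] by blast

lemma Zg_eq: "\<xi> \<in> Zg C \<Longrightarrow> \<zeta> \<in> Zg C \<Longrightarrow> I \<in> \<xi> \<Longrightarrow> I \<in> \<zeta> \<Longrightarrow> \<xi> = \<zeta>"
  unfolding Zg_eq_quotient using quotient_disj[OF equiv_isomorphic_indec_injective, of \<xi> \<zeta>] by blast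

lemma indec_injective_Zg:
  assumes "indec_injective I" obtains \<xi> where "\<xi> \<in> Zg C" "I \<in> \<xi>"
proof -
  let ?R = "{(I, J). indec_injective I \<and> indec_injective J \<and> isomorphic C I J}"
  have "?R `` {I} \<in> Zg C" unfolding Zg_eq_quotient using assms by (intro quotientI) simp
  moreover have "I \<in> ?R `` {I}" using equiv_class_self[OF equiv_isomorphic_indec_injective] assms by blast
  ultimately show ?thesis using that by blast
qed

text \<open>Two nonzero summands would meet in a nonzero element, yet the projection to one summand
  kills whatever comes from the other.\<close>

lemma uniform_indecomposable:
  assumes "uniform E" "E \<in> Obj C" "\<not> is_zero C E"
  shows "indecomposable C E"
  unfolding indecomposable_def
proof (intro conjI allI impI)
  fix A B i1 i2 p1 p2 assume B: "is_biproduct C A B E i1 i2 p1 p2"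
  note b = biproduct_simps[OF B]
  show "is_zero C A \<or> is_zero C B"
  proof (rule ccontr)
    assume "\<not> (is_zero C A \<or> is_zero C B)"
    then have z: "\<not> null (Ident C A)" "\<not> null (Ident C B)" using b by (auto simp: is_zero_iff)
    have "\<not> null i1" using z(1) null_comp1[of i1 p1] b by auto
    moreover have "\<not> null i2" using z(2) null_comp1[of i2 p2] b by auto
    ultimately obtain y w where y: "y \<in> Arr C" "w \<in> Arr C" "Cod C y = Dom C i1" "Cod C w = Dom C i2" "Dom C y = Dom C w"
      "i1 \<odot> y = i2 \<odot> w" "\<not> null (i1 \<odot> y)"
      using uniformE[OF assms(1) b(4,10) _ b(5,11)] by blast
    have "y = p1 \<odot> (i2 \<odot> w)" using biproduct_elem(1)[OF B y(1)] y(3,6) b by simp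
    also have "\<dots> = Zero C (Dom C w) A" using biproduct_elem(4)[OF B y(2)] y b by simp
    finally have "null y" using y b by (metis Dom_Cod_obj(1) null_Zero)
    then show False using null_comp1[of y i1] y b by simp
  qed
qed (use assms in auto)

text \<open>Essentiality moves nonzero elements of the extension into \<open>H\<close>, where
  uniformity makes them meet.\<close>

lemma uniform_essential:
  assumes u: "uniform H" and h: "is_mono C h" "Dom C h = H"
    and ess: "\<And>x. x \<in> Arr C \<Longrightarrow> Cod C x = Cod C h \<Longrightarrow> \<not> null x \<Longrightarrow>
      \<exists>y w. y \<in> Arr C \<and> Cod C y = Dom C x \<and> w \<in> Arr C \<and> Cod C w = H \<and> Dom C w = Dom C y \<and>
        x \<odot> y = h \<odot> w \<and> \<not> null (x \<odot> y)"
  shows "uniform (Cod C h)"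
  unfolding uniform_def
proof (intro allI impI)
  have hA: "h \<in> Arr C" using h by simp
  fix x z assume x: "x \<in> Arr C" "Cod C x = Cod C h" "\<not> null x" and z: "z \<in> Arr C" "Cod C z = Cod C h" "\<not> null z"
  obtain y w where y: "y \<in> Arr C" "Cod C y = Dom C x" "w \<in> Arr C" "Cod C w = H" "Dom C w = Dom C y"
    "x \<odot> y = h \<odot> w" "\<not> null (x \<odot> y)"
    using ess[OF x] by blast
  obtain y' w' where y': "y' \<in> Arr C" "Cod C y' = Dom C z" "w' \<in> Arr C" "Cod C w' = H" "Dom C w' = Dom C y'"
    "z \<odot> y' = h \<odot> w'" "\<not> null (z \<odot> y')"
    using ess[OF z] by blast
  have "\<not> null w" using y(3,4,6,7) null_comp1[of w h] hA h by auto
  moreover have "\<not> null w'" using y'(3,4,6,7) null_comp1[of w' h] hA h by auto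
  ultimately obtain a b where a: "a \<in> Arr C" "b \<in> Arr C" "Cod C a = Dom C w" "Cod C b = Dom C w'" "Dom C a = Dom C b"
    "w \<odot> a = w' \<odot> b" "\<not> null (w \<odot> a)"
    using uniformE[OF u y(3,4) _ y'(3,4)] by blast
  have "x \<odot> (y \<odot> a) = h \<odot> w \<odot> a" by (rule comp_subst[OF y(6)]) (use x y(1-5) a(1-5) in simp_all)
  then have e1: "x \<odot> (y \<odot> a) = h \<odot> (w \<odot> a)" using y(3-5) a(1-5) hA h by simp
  have "z \<odot> (y' \<odot> b) = h \<odot> w' \<odot> b" by (rule comp_subst[OF y'(6)]) (use z y'(1-5) a(1-5) in simp_all)
  then have e2: "z \<odot> (y' \<odot> b) = h \<odot> (w' \<odot> b)" using y'(3-5) a(1-5) hA h by simp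
  have "\<not> null (h \<odot> (w \<odot> a))" using mono_null[OF h(1), of "w \<odot> a"] a(1-5,7) y(3-5) h by simp
  then show "\<exists>y w. y \<in> Arr C \<and> w \<in> Arr C \<and> Cod C y = Dom C x \<and> Cod C w = Dom C z \<and> Dom C y = Dom C w \<and>
      x \<odot> y = z \<odot> w \<and> \<not> null (x \<odot> y)"
    using e1 e2 a y(1-5) y'(1-5) by (intro exI[of _ "y \<odot> a"] exI[of _ "y' \<odot> b"]) simp_all
qed

text \<open>A nonzero element killed by \<open>g\<close> would meet \<open>k\<close>, on which
  \<open>g\<close> is monic.\<close>

lemma uniform_mono_extension:
  assumes u: "uniform E" and k: "k \<in> Arr C" "Cod C k = E" "\<not> null k"
    and g: "g \<in> Arr C" "Dom C g = E" "is_mono C (g \<odot> k)"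
  shows "is_mono C g"
proof (rule monoI[OF g(1)])
  fix x assume x: "x \<in> Arr C" "Cod C x = Dom C g" "null (g \<odot> x)"
  show "null x"
  proof (rule ccontr)
    assume n: "\<not> null x"
    have xE: "Cod C x = E" using x g by simp
    obtain y w where y: "y \<in> Arr C" "w \<in> Arr C" "Cod C y = Dom C x" "Cod C w = Dom C k" "Dom C y = Dom C w"
      "x \<odot> y = k \<odot> w" "\<not> null (x \<odot> y)"
      by (rule uniformE[OF u x(1) xE n k])
    have "null (g \<odot> x \<odot> y)" using x y(1,3) g by (rule_tac null_comp2) simp_all
    then have "null (g \<odot> (x \<odot> y))" using x y(1,3) g by simp
    then have "null (g \<odot> k \<odot> w)" unfolding y(6) using y(2,4) g k by simp
    then have "null w" using mono_null[OF g(3), of w] y(2,4) g k by simp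
    then have "null (k \<odot> w)" using null_comp1[of w k] k y by simp
    then show False using y by simp
  qed
qed

text \<open>Extending the embedding of the shared subobject gives a monic \<open>g\<close> from
  \<open>E\<close> to \<open>E'\<close>. Injectivity of \<open>E\<close> gives a retraction
  \<open>r\<close>, which is monic as well because it is monic on the image of \<open>g\<close>; so
  \<open>g\<close> and \<open>r\<close> are mutually inverse.\<close>

lemma uniform_injectives_isomorphic:
  assumes E: "uniform E" "injective_object C E" and E': "uniform E'" "injective_object C E'"
    and com: "common_nonzero_subobject C E E'"
  shows "isomorphic C E E'"
proof -
  obtain k k' where k: "is_mono C k" "Cod C k = E" "is_mono C k'" "Cod C k' = E'" "Dom C k = Dom C k'"
    "\<not> is_zero C (Dom C k)"
    using com unfolding common_nonzero_subobject_def embeds_iff by auto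
  have A: "k \<in> Arr C" "k' \<in> Arr C" "\<not> null k"
    using k zero_Dom_iff[OF k(1)] by simp_all
  have EO: "E \<in> Obj C" using k A by auto
  obtain g where g: "g \<in> Arr C" "Dom C g = E" "Cod C g = E'" "g \<odot> k = k'"
    using injectiveE[OF E'(2) k(1) A(2)] k by metis
  have gm: "is_mono C g"
    by (rule uniform_mono_extension[OF E(1) A(1) k(2) A(3) g(1,2)]) (use g k in simp)
  obtain r where r: "r \<in> Arr C" "Dom C r = E'" "Cod C r = E" "r \<odot> g = Ident C E"
    using injectiveE[OF E(2) gm, of "Ident C E"] g EO by auto
  have "\<not> null k'" using zero_Dom_iff[OF k(3)] k(5,6) by simp
  then have "\<not> null g" using g A k null_comp2[of g k] by auto
  then have rm: "is_mono C r"
    by (rule uniform_mono_extension[OF E'(1) g(1,3) _ r(1,2)]) (use r EO in simp)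
  have "g \<odot> r = Ident C E'"
    by (rule mono_cancel[OF rm]) (use r g comp_subst[OF r(4), of r] injective_Obj[OF E'(2)] in simp_all)
  then have "is_epi C g" using epi_factor[of g r] g r injective_Obj[OF E'(2)] by simp
  then show ?thesis using isomorphicI[OF gm] g by simp
qed

end

context grothendieck_category
begin

text \<open>The subobject \<open>m\<close> is essential in a direct summand, and indecomposability
  makes the complement zero. So \<open>m\<close> is essential in all of \<open>I\<close> and meets
  \<open>n\<close>.\<close>

lemma indec_injective_uniform:
  assumes I: "indec_injective I"
  shows "uniform I"
proof (rule uniform_if_mono_meet)
  note I' = indec_injectiveD[OF I]
  fix m n assume m: "is_mono C m" "is_mono C n" "Cod C m = I" "Cod C n = I" "\<not> null m" "\<not> null n"
  have mA: "m \<in> Arr C" "n \<in> Arr C" using m by simp_all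
  obtain N L i1 i2 p1 p2 h' where B: "is_biproduct C N L I i1 i2 p1 p2"
    and h': "is_mono C h'" "Dom C h' = Dom C m" "Cod C h' = N" "i1 \<odot> h' = m"
    and ess: "\<And>x. x \<in> Arr C \<Longrightarrow> Cod C x = N \<Longrightarrow> \<not> null x \<Longrightarrow>
      \<exists>y w. y \<in> Arr C \<and> Cod C y = Dom C x \<and> w \<in> Arr C \<and> Cod C w = Dom C m \<and> Dom C w = Dom C y \<and>
        x \<odot> y = h' \<odot> w \<and> \<not> null (x \<odot> y)"
    using essential_summand[OF I'(3) m(1,3)] by blast
  note b = biproduct_simps[OF B]
  have hA: "h' \<in> Arr C" using h' by simp
  have "\<not> is_zero C N" using is_zero_null[of N h'] h' hA null_comp1[of h' i1] b m by auto
  then have L: "is_zero C L" using I'(4) B unfolding indecomposable_def by blast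
  have pn: "p1 \<odot> n \<in> Arr C" "Cod C (p1 \<odot> n) = N" "Dom C (p1 \<odot> n) = Dom C n" using b m mA by simp_all
  have "\<not> null (p1 \<odot> n)"
  proof
    assume "null (p1 \<odot> n)"
    moreover have "null (p2 \<odot> n)" using is_zero_null[OF L, of "p2 \<odot> n"] b m mA by simp
    ultimately show False using biproduct_null_into[OF B mA(2) m(4)] m by blast
  qed
  then obtain y w where y: "y \<in> Arr C" "Cod C y = Dom C n" "w \<in> Arr C" "Cod C w = Dom C m" "Dom C w = Dom C y"
    "p1 \<odot> n \<odot> y = h' \<odot> w" "\<not> null (p1 \<odot> n \<odot> y)"
    using ess[OF pn(1,2)] pn(3) by auto
  have mw: "m \<odot> w = i1 \<odot> (h' \<odot> w)" using comp_subst[OF h'(4), of w] h'(1-3) hA b y(3,4) by simp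
  have d: "n \<odot> y \<ominus> m \<odot> w \<in> Arr C" "Cod C (n \<odot> y \<ominus> m \<odot> w) = I" using y(1-5) mA m by simp_all
  \<comment> \<open>The second projection lands in a zero object, so equality in \<open>I\<close>
    can be read off from the first projection.\<close>
  have "null (n \<odot> y \<ominus> m \<odot> w)"
  proof (rule biproduct_null_into[OF B d])
    have "p1 \<odot> (m \<odot> w) = h' \<odot> w" unfolding mw using biproduct_elem(1)[OF B, of "h' \<odot> w"] hA h'(2,3) y(3,4) by simp
    moreover have "p1 \<odot> (n \<odot> y) = h' \<odot> w" using y(1,2,6) b m mA by simp
    ultimately have "p1 \<odot> (n \<odot> y \<ominus> m \<odot> w) = h' \<odot> w \<ominus> h' \<odot> w"
      using comp_sub[of "n \<odot> y" "m \<odot> w" p1] y(1-5) mA m b by simp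
    then show "null (p1 \<odot> (n \<odot> y \<ominus> m \<odot> w))" using hA h'(2) y(3,4) by simp
    show "null (p2 \<odot> (n \<odot> y \<ominus> m \<odot> w))" using is_zero_null[OF L, of "p2 \<odot> (n \<odot> y \<ominus> m \<odot> w)"] b d by simp
  qed
  then have eq: "n \<odot> y = m \<odot> w" using y(1-5) mA m by simp
  have "n \<odot> y \<preceq> n" using y(1,2) mA by simp
  moreover have "n \<odot> y \<preceq> m" unfolding eq using y(3,4) mA by simp
  moreover have "\<not> null (n \<odot> y)"
  proof
    assume "null (n \<odot> y)"
    then have "null (p1 \<odot> (n \<odot> y))" using y(1,2) b m mA by (rule_tac null_comp1) simp_all
    then show False using y(1,2,7) b m mA by simp
  qed
  ultimately show "\<not> disj m n" unfolding disj_def by blast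
qed

end

section \<open>Atoms and their injective hulls\<close>

context locally_noetherian_grothendieck_category
begin

text \<open>The hull is cut out of any injective object containing \<open>H\<close>: the summand in
  which \<open>H\<close> is essential inherits uniformity, hence is indecomposable.\<close>

lemma monoform_embeds_indec_injective:
  assumes H: "monoform C H"
  obtains E where "indec_injective E" "embeds C H E"
proof -
  have HO: "H \<in> Obj C" using monoformD H by blast
  obtain m where m: "is_mono C m" "Dom C m = H" "injective_object C (Cod C m)" using enough_injectives[OF HO] by blast
  obtain N L i1 i2 p1 p2 h' where B: "is_biproduct C N L (Cod C m) i1 i2 p1 p2"
    and h': "is_mono C h'" "Dom C h' = Dom C m" "Cod C h' = N" "i1 \<odot> h' = m"
    and ess: "\<And>x. x \<in> Arr C \<Longrightarrow> Cod C x = N \<Longrightarrow> \<not> null x \<Longrightarrow>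
      \<exists>y w. y \<in> Arr C \<and> Cod C y = Dom C x \<and> w \<in> Arr C \<and> Cod C w = Dom C m \<and> Dom C w = Dom C y \<and>
        x \<odot> y = h' \<odot> w \<and> \<not> null (x \<odot> y)"
    using essential_summand[OF m(3,1) refl] by blast
  have hD: "Dom C h' = H" using h' m by simp
  have "uniform (Cod C h')"
    by (rule uniform_essential[OF monoform_uniform[OF H] h'(1) hD]) (use ess h'(3) m(2) in simp)
  then have u: "uniform N" using h' by simp
  have HN: "embeds C H N" using embedsI[OF h'(1)] h' m by simp
  have "\<not> is_zero C N"
  proof
    assume "is_zero C N"
    then have "null h'" using is_zero_null h' by simp
    then show False using zero_Dom_iff[OF h'(1)] hD monoformD(2)[OF H] by simp
  qed
  then have "indecomposable C N" using uniform_indecomposable[OF u] biproduct_simps(1)[OF B] by blast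
  moreover have "injective_object C N" using injective_summand[OF B m(3)] .
  ultimately show ?thesis using that HN unfolding indec_injective_def by blast
qed

text \<open>A relation asking for some representatives on both sides, so that no hull is chosen yet.
  By \<open>atom_injective_common\<close>, arbitrary representatives \<open>H\<close> and
  \<open>I\<close> are still linked by a member of the atom embedding in both.\<close>

definition atom_injective where
  "atom_injective \<alpha> \<xi> \<longleftrightarrow> \<alpha> \<in> ASpec C \<and> \<xi> \<in> Zg C \<and> (\<exists>H\<in>\<alpha>. \<exists>I\<in>\<xi>. embeds C H I)"

lemma atom_injective_common:
  assumes r: "atom_injective \<alpha> \<xi>" and H: "H \<in> \<alpha>" and I: "I \<in> \<xi>"
  obtains K where "K \<in> \<alpha>" "embeds C K H" "embeds C K I"
proof -
  obtain H0 I0 where 0: "H0 \<in> \<alpha>" "I0 \<in> \<xi>" "embeds C H0 I0" "\<alpha> \<in> ASpec C" "\<xi> \<in> Zg C"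
    using r unfolding atom_injective_def by blast
  obtain K where K: "\<not> is_zero C K" "embeds C K H0" "embeds C K H"
    using ASpec_common[OF 0(4,1) H] unfolding common_nonzero_subobject_def by blast
  have "embeds C K I"
    using embeds_trans[OF embeds_trans[OF K(2) 0(3)] isomorphic_embeds[OF Zg_isomorphic[OF 0(5,2) I]]] .
  then show ?thesis using that ASpec_sub[OF 0(4) H K(3,1)] K by blast
qed

lemma ex_atom_injective:
  assumes "\<alpha> \<in> ASpec C" shows "\<exists>\<xi>. atom_injective \<alpha> \<xi>"
proof -
  obtain H where H: "H \<in> \<alpha>" using ASpec_nonempty assms by blast
  obtain E where E: "indec_injective E" "embeds C H E"
    using monoform_embeds_indec_injective ASpec_monoform assms H by blast
  obtain \<xi> where "\<xi> \<in> Zg C" "E \<in> \<xi>" using indec_injective_Zg E by blast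
  then show ?thesis unfolding atom_injective_def using assms H E by blast
qed

text \<open>Every nonzero object contains a nonzero noetherian one, and that contains a monoform
  object.\<close>

lemma atom_injective_surj:
  assumes "\<xi> \<in> Zg C" shows "\<exists>\<alpha>. atom_injective \<alpha> \<xi>"
proof -
  obtain I where I: "I \<in> \<xi>" using Zg_nonempty assms by blast
  have "indec_injective I" using Zg_indec_injective assms I by blast
  then obtain N where N: "noetherian C N" "\<not> is_zero C N" "embeds C N I"
    using noetherian_sub indec_injectiveD by metis
  obtain X where X: "monoform C X" "embeds C X N" using noetherian_monoform_sub N by blast
  obtain \<alpha> where "\<alpha> \<in> ASpec C" "X \<in> \<alpha>" using monoform_atom X by blast
  then show ?thesis unfolding atom_injective_def using assms I embeds_trans[OF X(2) N(3)] by blast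
qed

text \<open>Both injectives contain a common member of the atom, and uniform injectives sharing a
  nonzero subobject are isomorphic.\<close>

lemma atom_injective_right_unique:
  assumes r: "atom_injective \<alpha> \<xi>" and s: "atom_injective \<alpha> \<zeta>" shows "\<xi> = \<zeta>"
proof -
  have Z: "\<xi> \<in> Zg C" "\<zeta> \<in> Zg C" "\<alpha> \<in> ASpec C" using r s unfolding atom_injective_def by blast+
  obtain H I J where H: "H \<in> \<alpha>" "I \<in> \<xi>" "J \<in> \<zeta>" using ASpec_nonempty Zg_nonempty Z by metis
  obtain K where K: "K \<in> \<alpha>" "embeds C K I" using atom_injective_common[OF r H(1,2)] by blast
  obtain L where L: "L \<in> \<alpha>" "embeds C L K" "embeds C L J" using atom_injective_common[OF s K(1) H(3)] by blast
  have "common_nonzero_subobject C I J"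
    unfolding common_nonzero_subobject_def
    using monoformD(1,2)[OF ASpec_monoform[OF Z(3) L(1)]] embeds_trans[OF L(2) K(2)] L(3) by blast
  moreover have I: "indec_injective I" "indec_injective J" using Zg_indec_injective Z H by blast+
  ultimately have "isomorphic C I J"
    using uniform_injectives_isomorphic indec_injective_uniform indec_injectiveD(3) by blast
  then show ?thesis using Zg_eq[OF Z(1,2)] Zg_closed Z H I by blast
qed

text \<open>Members of both atoms embed in one uniform object, so they share a nonzero
  subobject.\<close>

lemma atom_injective_left_unique:
  assumes r: "atom_injective \<alpha> \<xi>" and s: "atom_injective \<beta> \<xi>" shows "\<alpha> = \<beta>"
proof -
  have Z: "\<xi> \<in> Zg C" "\<beta> \<in> ASpec C" "\<alpha> \<in> ASpec C" using r s unfolding atom_injective_def by blast+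
  obtain H H' I where H: "H \<in> \<alpha>" "H' \<in> \<beta>" "I \<in> \<xi>" using ASpec_nonempty Zg_nonempty Z by metis
  obtain K where K: "K \<in> \<alpha>" "embeds C K I" using atom_injective_common[OF r H(1,3)] by blast
  obtain L where L: "L \<in> \<beta>" "embeds C L I" using atom_injective_common[OF s H(2,3)] by blast
  have m: "monoform C K" "monoform C L" using ASpec_monoform K L Z by blast+
  have "common_nonzero_subobject C K L"
    using uniform_common[OF indec_injective_uniform[OF Zg_indec_injective[OF Z(1) H(3)]] K(2) monoformD(2)[OF m(1)] L(2) monoformD(2)[OF m(2)]] .
  then have "L \<in> \<alpha>" using ASpec_closed Z K m by blast
  then show ?thesis using ASpec_eq Z L by blast
qed

text \<open>An atom occurring as a quotient of a subobject of \<open>M\<close> yields a nonzero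
  arrow from that subobject to \<open>I\<close>, which injectivity extends to \<open>M\<close>.
  Conversely, the image of a nonzero arrow from \<open>M\<close> to \<open>I\<close> meets the
  members of the atom inside the uniform \<open>I\<close>.\<close>

lemma atom_injective_ASupp_iff:
  assumes r: "atom_injective \<alpha> \<xi>" and M: "M \<in> Obj C"
  shows "\<alpha> \<in> ASupp C M \<longleftrightarrow> \<xi> \<in> Zg_basic C M"
proof
  have Z: "\<xi> \<in> Zg C" "\<alpha> \<in> ASpec C" using r unfolding atom_injective_def by blast+
  { assume "\<alpha> \<in> ASupp C M"
    then obtain H m e where a: "\<alpha> \<in> ASpec C" "H \<in> \<alpha>" "is_mono C m" "Cod C m = M" "is_epi C e" "Dom C e = Dom C m" "Cod C e = H"
      by (rule ASuppE)
    have A: "m \<in> Arr C" "e \<in> Arr C" using a by simp_all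
    obtain I where I: "I \<in> \<xi>" using Zg_nonempty Z by blast
    have inj: "injective_object C I" using indec_injectiveD Zg_indec_injective Z I by blast
    obtain K where K: "K \<in> \<alpha>" "embeds C K H" "embeds C K I" using atom_injective_common[OF r a(2) I] by blast
    have nK: "\<not> is_zero C K" using monoformD ASpec_monoform Z K by blast
    obtain k k' where k: "is_mono C k" "Dom C k = K" "Cod C k = H" "is_mono C k'" "Dom C k' = K" "Cod C k' = I"
      using K unfolding embeds_iff by blast
    have kA: "k \<in> Arr C" "k' \<in> Arr C" using k by simp_all
    obtain s where s: "s \<in> Arr C" "Dom C s = H" "Cod C s = I" "s \<odot> k = k'"
      using injectiveE[OF inj k(1) kA(2)] k by metis
    have "\<not> null k'" using zero_Dom_iff[OF k(4)] k nK by simp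
    then have "\<not> null s" using s k kA null_comp2[of s k] by auto
    then have n: "\<not> null (s \<odot> e)" using epi_null[OF a(5), of s] s a by simp
    have se: "s \<odot> e \<in> Arr C" "Dom C (s \<odot> e) = Dom C m" "Cod C (s \<odot> e) = I" using s(1-3) a A by simp_all
    obtain u where u: "u \<in> Arr C" "Dom C u = Cod C m" "Cod C u = I" "u \<odot> m = s \<odot> e"
      using injectiveE[OF inj a(3) se] by blast
    have "\<not> null u" using n u A null_comp2[of u m] by auto
    then have "u \<noteq> Zero C M I" using null_Zero[OF M injective_Obj[OF inj]] by metis
    moreover have "u \<in> Hom C M I" using u a by simp
    ultimately have "Hom C M I \<noteq> {Zero C M I}" by blast
    then show "\<xi> \<in> Zg_basic C M" unfolding Zg_basic_def using Z I by blast }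
  { assume "\<xi> \<in> Zg_basic C M"
    then obtain I where I: "I \<in> \<xi>" "Hom C M I \<noteq> {Zero C M I}" unfolding Zg_basic_def by blast
    have ii: "indec_injective I" using Zg_indec_injective Z I by blast
    have IO: "I \<in> Obj C" using indec_injectiveD ii by blast
    have "Zero C M I \<in> Hom C M I" using M IO by simp
    then obtain u where "u \<in> Hom C M I" "u \<noteq> Zero C M I" using I by blast
    then have u: "u \<in> Arr C" "Dom C u = M" "Cod C u = I" "\<not> null u" by (auto simp: null_def)
    obtain e m where e: "is_epi C e" "is_mono C m" "Cod C e = Dom C m" "Dom C e = Dom C u"
      "Cod C m = Cod C u" "m \<odot> e = u"
      using image_factorization[OF u(1)] by blast
    have A: "e \<in> Arr C" "m \<in> Arr C" using e by simp_all
    have "\<not> null m" using u(4) e A null_comp2[of m e] by auto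
    then have nD: "\<not> is_zero C (Dom C m)" using zero_Dom_iff e by blast
    have DI: "embeds C (Dom C m) I" using embedsI[OF e(2)] e u by simp
    obtain H where H: "H \<in> \<alpha>" using ASpec_nonempty Z by blast
    obtain K where K: "K \<in> \<alpha>" "embeds C K I" using atom_injective_common[OF r H I(1)] by blast
    have nK: "\<not> is_zero C K" using monoformD ASpec_monoform Z K by blast
    obtain W where W: "\<not> is_zero C W" "embeds C W (Dom C m)" "embeds C W K"
      using uniform_common[OF indec_injective_uniform[OF ii] DI nD K(2) nK] unfolding common_nonzero_subobject_def by blast
    have "W \<in> \<alpha>" using ASpec_sub[OF Z(2) K(1) W(3,1)] .
    moreover have "subquotient C W M"
      using subquotient_trans[OF subquotient_embeds[OF W(2)]] subquotient_epi[OF e(1)] e u by simp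
    ultimately show "\<alpha> \<in> ASupp C M" using ASuppI Z by blast }
qed

definition atom_hull where
  "atom_hull \<alpha> = (SOME \<xi>. atom_injective \<alpha> \<xi>)"

lemma atom_hull: "\<alpha> \<in> ASpec C \<Longrightarrow> atom_injective \<alpha> (atom_hull \<alpha>)"
  unfolding atom_hull_def using ex_atom_injective by (rule someI_ex)

lemma inj_atom_hull: "inj_on atom_hull (ASpec C)"
  using atom_hull atom_injective_left_unique unfolding inj_on_def by metis

lemma atom_hull_image: "atom_hull ` ASpec C = Zg C"
proof
  show "atom_hull ` ASpec C \<subseteq> Zg C" using atom_hull unfolding atom_injective_def by blast
  show "Zg C \<subseteq> atom_hull ` ASpec C"
  proof
    fix \<xi> assume "\<xi> \<in> Zg C"
    then obtain \<alpha> where a: "atom_injective \<alpha> \<xi>" using atom_injective_surj by blast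
    then have \<alpha>: "\<alpha> \<in> ASpec C" unfolding atom_injective_def by blast
    then have "atom_hull \<alpha> = \<xi>" using atom_injective_right_unique atom_hull a by blast
    then show "\<xi> \<in> atom_hull ` ASpec C" using \<alpha> by blast
  qed
qed

lemma atom_hull_ASupp:
  assumes M: "M \<in> Obj C" shows "atom_hull ` ASupp C M = Zg_basic C M"
proof
  show "atom_hull ` ASupp C M \<subseteq> Zg_basic C M"
    using atom_injective_ASupp_iff[OF atom_hull M] ASupp_subset_ASpec by blast
  show "Zg_basic C M \<subseteq> atom_hull ` ASupp C M"
  proof
    fix \<xi> assume x: "\<xi> \<in> Zg_basic C M"
    then have "\<xi> \<in> atom_hull ` ASpec C" unfolding atom_hull_image by (simp add: Zg_basic_def)
    then show "\<xi> \<in> atom_hull ` ASupp C M" using atom_injective_ASupp_iff[OF atom_hull M] x by blast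
  qed
qed

text \<open>Basic sets are images of supports of noetherian objects, and such supports form a basis
  of the open sets of atoms.\<close>

lemma Zg_basis_iff:
  "(arbitrary union_of (\<lambda>U. \<exists>M. noetherian C M \<and> U = Zg_basic C M)) W \<longleftrightarrow>
    (\<exists>\<Phi>. aspec_open C \<Phi> \<and> W = atom_hull ` \<Phi>)"
proof
  assume "(arbitrary union_of (\<lambda>U. \<exists>M. noetherian C M \<and> U = Zg_basic C M)) W"
  then obtain \<U> where U: "\<And>U. U \<in> \<U> \<Longrightarrow> \<exists>M. noetherian C M \<and> U = Zg_basic C M" "\<Union>\<U> = W"
    unfolding union_of_def arbitrary_def by blast
  let ?\<K> = "ASupp C ` {M. noetherian C M \<and> Zg_basic C M \<in> \<U>}"
  have "aspec_open C (\<Union>?\<K>)" by (auto intro!: aspec_open_Union aspec_open_ASupp)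
  moreover have "W = atom_hull ` \<Union>?\<K>"
    unfolding image_Union image_image U(2)[symmetric] using U(1) atom_hull_ASupp noetherian_Obj by fastforce
  ultimately show "\<exists>\<Phi>. aspec_open C \<Phi> \<and> W = atom_hull ` \<Phi>" by blast
next
  assume "\<exists>\<Phi>. aspec_open C \<Phi> \<and> W = atom_hull ` \<Phi>"
  then obtain \<Phi> where \<Phi>: "aspec_open C \<Phi>" "W = atom_hull ` \<Phi>" by blast
  let ?\<M> = "{M. noetherian C M \<and> ASupp C M \<subseteq> \<Phi>}"
  have "\<Phi> = (\<Union>M\<in>?\<M>. ASupp C M)" using aspec_open_noetherian[OF \<Phi>(1)] by blast
  then have "W = (\<Union>M\<in>?\<M>. atom_hull ` ASupp C M)" unfolding \<Phi>(2) by (metis image_UN)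
  then have "W = \<Union>(Zg_basic C ` ?\<M>)" using atom_hull_ASupp noetherian_Obj by auto
  then show "(arbitrary union_of (\<lambda>U. \<exists>M. noetherian C M \<and> U = Zg_basic C M)) W"
    unfolding union_of_def arbitrary_def by (intro exI[of _ "Zg_basic C ` ?\<M>"]) auto
qed

section \<open>Comparison of the two topologies\<close>

lemma openin_ASpec: "openin (ASpec_topology C) = aspec_open C"
  unfolding ASpec_topology_def by (rule topology_inverse') (rule istopology_aspec_open)

lemma aspec_open_subset: "aspec_open C \<Phi> \<Longrightarrow> \<Phi> \<subseteq> ASpec C"
  by (simp add: aspec_open_def)

text \<open>Closure under finite intersections is inherited from the atom spectrum, since
  \<open>atom_hull\<close> is injective on it; unions need only that images commute with
  unions.\<close>

lemma openin_Zg: "openin (Zg_topology C) W \<longleftrightarrow> (\<exists>\<Phi>. aspec_open C \<Phi> \<and> W = atom_hull ` \<Phi>)"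
proof -
  let ?P = "arbitrary union_of (\<lambda>U. \<exists>M. noetherian C M \<and> U = Zg_basic C M)"
  have "istopology ?P"
    unfolding istopology_def
  proof (intro conjI allI impI)
    fix S T assume "?P S" "?P T"
    then obtain \<Phi> \<Psi> where o: "aspec_open C \<Phi>" "S = atom_hull ` \<Phi>" "aspec_open C \<Psi>" "T = atom_hull ` \<Psi>"
      unfolding Zg_basis_iff by blast
    have "aspec_open C (\<Phi> \<inter> \<Psi>)" using istopology_aspec_open o unfolding istopology_def by blast
    moreover have "S \<inter> T = atom_hull ` (\<Phi> \<inter> \<Psi>)"
      using inj_on_image_Int[OF inj_atom_hull aspec_open_subset[OF o(1)] aspec_open_subset[OF o(3)]] o by simp
    ultimately show "?P (S \<inter> T)" unfolding Zg_basis_iff by blast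
  next
    fix \<K> assume "\<forall>K\<in>\<K>. ?P K"
    then have K: "\<And>K. K \<in> \<K> \<Longrightarrow> \<exists>\<Phi>. aspec_open C \<Phi> \<and> K = atom_hull ` \<Phi>" unfolding Zg_basis_iff by blast
    let ?\<L> = "{\<Phi>. aspec_open C \<Phi> \<and> atom_hull ` \<Phi> \<in> \<K>}"
    have "aspec_open C (\<Union>?\<L>)" by (rule aspec_open_Union) simp
    moreover have "\<Union>\<K> = atom_hull ` \<Union>?\<L>"
    proof -
      have "\<K> = image atom_hull ` ?\<L>" using K by blast
      from arg_cong[of _ _ Union, OF this] show ?thesis unfolding image_Union .
    qed
    ultimately show "?P (\<Union>\<K>)" unfolding Zg_basis_iff by blast
  qed
  then show ?thesis unfolding Zg_topology_def Zg_basis_iff[symmetric] by (simp add: topology_inverse')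
qed

lemma topspace_ASpec: "topspace (ASpec_topology C) = ASpec C"
  unfolding topspace_def openin_ASpec using aspec_open_ASpec aspec_open_subset by blast

lemma topspace_Zg: "topspace (Zg_topology C) = Zg C"
proof -
  have "topspace (Zg_topology C) = atom_hull ` ASpec C"
    unfolding topspace_def openin_Zg using aspec_open_ASpec aspec_open_subset by blast
  then show ?thesis by (simp add: atom_hull_image)
qed

lemma homeomorphic_map_atom_hull: "homeomorphic_map (ASpec_topology C) (Zg_topology C) atom_hull"
proof (rule bijective_open_imp_homeomorphic_map)
  show "continuous_map (ASpec_topology C) (Zg_topology C) atom_hull"
    unfolding continuous_map topspace_ASpec topspace_Zg openin_ASpec
  proof (intro conjI allI impI)
    show "atom_hull ` ASpec C \<subseteq> Zg C" by (simp add: atom_hull_image)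
    fix U assume "openin (Zg_topology C) U"
    then obtain \<Phi> where \<Phi>: "aspec_open C \<Phi>" "U = atom_hull ` \<Phi>" unfolding openin_Zg by blast
    have "{\<alpha> \<in> ASpec C. atom_hull \<alpha> \<in> U} = \<Phi>"
      unfolding \<Phi>(2) using inj_on_image_mem_iff[OF inj_atom_hull] aspec_open_subset[OF \<Phi>(1)] by blast
    then show "aspec_open C {\<alpha> \<in> ASpec C. atom_hull \<alpha> \<in> U}" using \<Phi> by simp
  qed
  show "open_map (ASpec_topology C) (Zg_topology C) atom_hull"
    unfolding open_map_def openin_ASpec openin_Zg by blast
qed (simp_all add: topspace_ASpec topspace_Zg atom_hull_image inj_atom_hull)

end

theorem theorem2:
  fixes C :: "('o, 'm) category" and small :: "'u set \<Rightarrow> bool"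
  assumes "locally_noetherian_grothendieck_category C small"
  shows "ASpec_topology C homeomorphic_space Zg_topology C \<and>
    (\<exists>\<Phi> \<Psi>. bij_betw \<Phi> {\<X>. localizing_subcategory C small \<X>} {\<X>. serre_subcategory (noeth C) \<X>} \<and>
      bij_betw \<Psi> {\<X>. serre_subcategory (noeth C) \<X>} {U. aspec_open C U})"
proof -
  interpret locally_noetherian_grothendieck_category C small by (rule assms)
  \<comment> \<open>Localizing subcategories are sent to open sets and from there back along the
    inverse of the bijection for \<open>noeth C\<close>.\<close>
  show ?thesis
    using homeomorphic_map_imp_homeomorphic_space[OF homeomorphic_map_atom_hull]
      bij_betw_trans[OF bij_localizing_open bij_betw_inv_into[OF bij_serre_noeth_open]] bij_serre_noeth_open
    by blast
qed

end
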